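(* Let $\theta>0$, let $U\subseteq\mathbb{R}^d$ be open and bounded, and let $u,v:\overline U\to\mathbb{R}$ be such that $u$ and $-v$ are upper semicontinuous on $\overline U$ and, in the viscosity sense, $$-\mathrm{tr}\big(A(x)D^2u\big)+H(Du,x)\le-\theta<0\le-\mathrm{tr}\big(A(x)D^2v\big)+H(Dv,x)\quad\text{in }U.$$ Then $$\sup_U(u-v)\le\sup_{\partial U}(u-v).$$
   Context: Notation: $B_R$ is the open ball of radius $R$ centered at $0$ in $\mathbb{R}^d$; $\mathbb{S}^d$ is the set of real symmetric $d\times d$ matrices; $|\cdot|$ is the Euclidean norm (Frobenius norm for matrices). Standing assumptions on the coefficients. Fix $m>1$, $n\in\mathbb{N}$, $\Lambda_1\ge1$, $\Lambda_2\ge0$. The map $A:\mathbb{R}^d\to\mathbb{S}^d$ has the form $A=\frac12\sigma^t\sigma$ with $\sigma:\mathbb{R}^d\to\mathbb{R}^{n\times d}$ satisfying $|\sigma(x)|\le\Lambda_2$ and $|\sigma(x)-\sigma(y)|\le\Lambda_2|x-y|$ for all $x,y\in\mathbb{R}^d$. The Hamiltonian $H:\mathbb{R}^d\times\mathbb{R}^d\to\mathbb{R}$, $(p,x)\mapsto H(p,x)$, satisfies: $p\mapsto H(p,x)$ is convex for every $x\in\mathbb{R}^d$; and for every $R>0$ there exist constants $0<a_R\le1$ and $M_R\ge1$ such that for all $p,q\in\mathbb{R}^d$ and $x,y\in B_R$, $$a_R|p|^m-M_R\le H(p,x)\le\Lambda_1(|p|^m+1),$$ $$|H(p,x)-H(p,y)|\le(\Lambda_1|p|^m+M_R)|x-y|,$$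 $$|H(p,x)-H(q,x)|\le\Lambda_1(|p|+|q|+1)^{m-1}|p-q|.$$ Viscosity sense: for upper semicontinuous $u$, the inequality $-\mathrm{tr}(A D^2u)+H(Du,x)\le-\theta$ in $U$ means that whenever $\varphi$ is smooth near $y\in U$ and $u-\varphi$ has a local maximum at $y$, then $-\mathrm{tr}(A(y)D^2\varphi(y))+H(D\varphi(y),y)\le-\theta$. For lower semicontinuous $v$, the inequality $\ge0$ means that whenever $v-\varphi$ has a local minimum at $y\in U$, then $-\mathrm{tr}(A(y)D^2\varphi(y))+H(D\varphi(y),y)\ge0$. *)

theory Defs
  imports "HOL-Analysis.Analysis"
begin

definition usc_on :: "'a::topological_space set \<Rightarrow> ('a \<Rightarrow> real) \<Rightarrow> bool" where
  "usc_on S f \<longleftrightarrow> (\<forall>x\<in>S. \<forall>a>f x. \<forall>\<^sub>F y in at x within S. f y < a)"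

text \<open>Meaningful for open \<open>S\<close>: then the derivatives \<open>at x\<close> depend only on the values on \<open>S\<close>.\<close>

primrec Ck_on :: "nat \<Rightarrow> ('a::real_normed_vector \<Rightarrow> real) \<Rightarrow> 'a set \<Rightarrow> bool" where
  "Ck_on 0 f S \<longleftrightarrow> continuous_on S f"
| "Ck_on (Suc k) f S \<longleftrightarrow> f differentiable_on S \<and>
     (\<forall>v. Ck_on k (\<lambda>x. frechet_derivative f (at x) v) S)"

definition smooth_near :: "'a::real_normed_vector \<Rightarrow> ('a \<Rightarrow> real) \<Rightarrow> bool" where
  "smooth_near y f \<longleftrightarrow> (\<exists>W. open W \<and> y \<in> W \<and> (\<forall>k. Ck_on k f W))"

definition gradient :: "(real^'d \<Rightarrow> real) \<Rightarrow> real^'d \<Rightarrow> real^'d" where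
  "gradient f x = (\<chi> i. frechet_derivative f (at x) (axis i 1))"

definition hessian :: "(real^'d \<Rightarrow> real) \<Rightarrow> real^'d \<Rightarrow> real^'d^'d" where
  "hessian f x = (\<chi> i j. frechet_derivative (\<lambda>z. gradient f z $ j) (at x) (axis i 1))"

text \<open>Viscosity sense of \<open>-tr (A D\<^sup>2u) + H(Du,x) \<le> c\<close>, respectively \<open>\<ge> c\<close>, in an open set \<open>U\<close>.
  The semicontinuity of \<open>u\<close> is not part of these predicates and has to be required separately.\<close>

definition viscosity_le ::
  "(real^'d \<Rightarrow> real^'d^'d) \<Rightarrow> (real^'d \<Rightarrow> real^'d \<Rightarrow> real) \<Rightarrow> real \<Rightarrow> (real^'d) set
    \<Rightarrow> (real^'d \<Rightarrow> real) \<Rightarrow> bool" where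
  "viscosity_le A H c U u \<longleftrightarrow>
    (\<forall>\<phi>. \<forall>y\<in>U. smooth_near y \<phi> \<longrightarrow>
       (\<forall>\<^sub>F x in at y within U. u x - \<phi> x \<le> u y - \<phi> y) \<longrightarrow>
       - trace (A y ** hessian \<phi> y) + H (gradient \<phi> y) y \<le> c)"

definition viscosity_ge ::
  "(real^'d \<Rightarrow> real^'d^'d) \<Rightarrow> (real^'d \<Rightarrow> real^'d \<Rightarrow> real) \<Rightarrow> real \<Rightarrow> (real^'d) set
    \<Rightarrow> (real^'d \<Rightarrow> real) \<Rightarrow> bool" where
  "viscosity_ge A H c U v \<longleftrightarrow>
    (\<forall>\<phi>. \<forall>y\<in>U. smooth_near y \<phi> \<longrightarrow>
       (\<forall>\<^sub>F x in at y within U. v x - \<phi> x \<ge> v y - \<phi> y) \<longrightarrow>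
       - trace (A y ** hessian \<phi> y) + H (gradient \<phi> y) y \<ge> c)"

text \<open>The norm of \<open>real^'d^'n\<close> is the Frobenius norm.\<close>

definition admissible_diffusion ::
  "real \<Rightarrow> (real^'d \<Rightarrow> real^'d^'n) \<Rightarrow> (real^'d \<Rightarrow> real^'d^'d) \<Rightarrow> bool" where
  "admissible_diffusion \<Lambda>\<^sub>2 \<sigma> A \<longleftrightarrow>
    (\<forall>x. A x = (1/2) *\<^sub>R (transpose (\<sigma> x) ** \<sigma> x)) \<and>
    (\<forall>x. norm (\<sigma> x) \<le> \<Lambda>\<^sub>2) \<and>
    (\<forall>x y. norm (\<sigma> x - \<sigma> y) \<le> \<Lambda>\<^sub>2 * norm (x - y))"

definition admissible_hamiltonian ::
  "real \<Rightarrow> real \<Rightarrow> (real^'d \<Rightarrow> real^'d \<Rightarrow> real) \<Rightarrow> bool" where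
  "admissible_hamiltonian m \<Lambda>\<^sub>1 H \<longleftrightarrow>
    (\<forall>x. convex_on UNIV (\<lambda>p. H p x)) \<and>
    (\<forall>R>0. \<exists>a M. 0 < a \<and> a \<le> 1 \<and> 1 \<le> M \<and>
      (\<forall>p q. \<forall>x\<in>ball 0 R. \<forall>y\<in>ball 0 R.
         a * norm p powr m - M \<le> H p x \<and>
         H p x \<le> \<Lambda>\<^sub>1 * (norm p powr m + 1) \<and>
         \<bar>H p x - H p y\<bar> \<le> (\<Lambda>\<^sub>1 * norm p powr m + M) * norm (x - y) \<and>
         \<bar>H p x - H q x\<bar> \<le> \<Lambda>\<^sub>1 * (norm p + norm q + 1) powr (m - 1) * norm (p - q)))"

end

theory Submission
  imports Defs
begin

text \<open>
  Replacing \<open>u\<close> by \<open>\<mu> u\<close> with \<open>\<mu> < 1\<close> close to \<open>1\<close>, convexity and coercivity of \<open>H\<close> gain a term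
  \<open>c (1 - \<mu>) |p|\<^sup>m\<close>, which absorbs every error of order \<open>|p|\<^sup>m |x - y|\<close> when variables are doubled.
  The second-order part is the theorem on sums. Maximise
  \<open>\<mu> u(x) - v(y) - \<kappa>/2 (|x - \<xi>|\<^sup>2 + |y - \<eta>|\<^sup>2 + |\<xi> - \<eta>|\<^sup>2) - p \<bullet> (\<xi>,\<eta>)\<close> over all four points:
  maximising first in \<open>x\<close> and \<open>y\<close> leaves a convex function \<open>\<Psi>\<close> of \<open>(\<xi>,\<eta>)\<close> minus a quadratic form.
  The proximal map of \<open>\<Psi>\<close> is Lipschitz, hence differentiable almost everywhere by Rademacher's
  theorem, and the points \<open>\<zeta> + g\<close> (\<open>\<zeta>\<close> a maximiser for a small slope \<open>p\<close>, \<open>g\<close> the gradient of \<open>\<Psi>\<close>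
  there) form a set that a Lipschitz map sends onto a ball of slopes, so they are not all exceptional.
  At a good one the derivative of the proximal map is invertible, because \<open>\<Psi>\<close> is touched from above
  by a paraboloid, and its inverse yields the second-order expansion of \<open>\<Psi>\<close>. That expansion passes to \<open>u\<close>
  at \<open>x\<close> and to \<open>v\<close> at \<open>y\<close>.
\<close>

section \<open>Derivatives of monotone functions\<close>

text \<open>The slope at the maximum, about \<kappa> (\<xi> - \<eta>), may be unbounded as \<kappa>
  grows, since no gradient estimate is used. Doubling only gives \<kappa> |x - y|^2 \<rightarrow> 0,
  which does not control the term |p|^m |x - y| permitted by the hypothesis on H. So \<mu> is fixed
  first, so close to 1 that the gap to the boundary survives and \<mu> \<theta> exceeds the loss (1
  - \<mu>) C. Only then \<kappa> \<rightarrow> \<infinity> and \<delta> \<rightarrow> 0, and every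
  error proportional to |p|^m drops below (1 - \<mu>) c |p|^m. The small extra slopes make the
  gradients for u and v differ; that costs about \<delta> |p|^(m-1), absorbed by the same gain. The
  points \<xi>, \<eta> regularise functions that are only semicontinuous: with x in a compact set,
  the maximum is finite everywhere and has linear growth in \<xi>. Using the same \<kappa> in all
  three squares makes the quadratic form coercive, and the two outer squares cancel exactly when
  second-order information returns to u and v, leaving \<kappa> |a - b|^2. Rademacher's theorem is
  reduced to monotone functions of one variable on parallel lines.\<close>

definition dini_below :: "('a::real_normed_vector \<Rightarrow> real) \<Rightarrow> 'a \<Rightarrow> real \<Rightarrow> 'a set" where
  "dini_below f v r = {x. \<forall>d>0. \<exists>t. t \<noteq> 0 \<and> \<bar>t\<bar> < d \<and> (f (x + t *\<^sub>R v) - f x) / t < r}"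

text \<open>Both sets speak of some t arbitrarily close to 0 and so avoid Dini derivatives with
  extended real values. Where bounded quotients have no limit, the point lies in
  \<open>dini_below f v r\<close> and \<open>dini_above f v s\<close> for some rationals r < s, so
  it is enough to show that countably many intersections are null.\<close>

definition dini_above :: "('a::real_normed_vector \<Rightarrow> real) \<Rightarrow> 'a \<Rightarrow> real \<Rightarrow> 'a set" where
  "dini_above f v s = {x. \<forall>d>0. \<exists>t. t \<noteq> 0 \<and> \<bar>t\<bar> < d \<and> s < (f (x + t *\<^sub>R v) - f x) / t}"

lemma dini_above_eq: "dini_above f v s = dini_below (\<lambda>x. - f x) v (- s)"
proof -
  have "(- f (x + t *\<^sub>R v) - - f x) / t < - s \<longleftrightarrow> s < (f (x + t *\<^sub>R v) - f x) / t" for x t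
    by (simp add: diff_divide_distrib) linarith
  then show ?thesis by (simp only: dini_above_def dini_below_def)
qed

text \<open>For fixed t the condition on x is open, and a union of open sets over uncountably many t
  is still open. Only the bound on |t| has to be made countable, which gives a G-delta set.\<close>

lemma borel_dini_below:
  fixes f :: "'a::real_normed_vector \<Rightarrow> real"
  assumes "continuous_on UNIV f"
  shows "dini_below f v r \<in> sets borel"
proof -
  let ?O = "\<lambda>n::nat. \<Union>t\<in>{t. t \<noteq> 0 \<and> \<bar>t\<bar> < 1 / real (Suc n)}. {x. (f (x + t *\<^sub>R v) - f x) / t < r}"
  have "dini_below f v r = (\<Inter>n. ?O n)"
  proof (intro set_eqI iffI)
    fix x assume "x \<in> dini_below f v r"
    then show "x \<in> (\<Inter>n. ?O n)"
      by (fastforce simp: dini_below_def)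
  next
    fix x assume x: "x \<in> (\<Inter>n. ?O n)"
    show "x \<in> dini_below f v r"
      unfolding dini_below_def
    proof clarify
      fix d :: real assume "d > 0"
      then obtain n where "1 / real (Suc n) < d" using nat_approx_posE by blast
      then show "\<exists>t. t \<noteq> 0 \<and> \<bar>t\<bar> < d \<and> (f (x + t *\<^sub>R v) - f x) / t < r"
        using x by (fastforce dest: spec[of _ n])
    qed
  qed
  moreover have "open (?O n)" for n
    by (intro open_UN ballI open_Collect_less continuous_intros continuous_on_compose2[OF assms]) auto
  ultimately show ?thesis by auto
qed

lemma borel_dini_above:
  fixes f :: "'a::real_normed_vector \<Rightarrow> real"
  assumes "continuous_on UNIV f"
  shows "dini_above f v r \<in> sets borel"
  unfolding dini_above_eq by (intro borel_dini_below continuous_intros assms)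

lemma negligible_iff_emeasure0:
  fixes S :: "'a::euclidean_space set"
  assumes "S \<in> sets borel"
  shows "negligible S \<longleftrightarrow> emeasure lborel S = 0"
  using assms by (simp add: negligible_iff_null_sets null_sets_def)

lemma negligible_if_countable:
  fixes S :: "'a::euclidean_space set"
  assumes "countable S"
  shows "negligible S"
  using countable_imp_null_set_lborel[OF assms] by (simp add: negligible_iff_null_sets null_sets_completionI)

text \<open>Closed intervals are balls around their midpoints. The point x may be an endpoint of its
  interval, as it is when the interval comes from a difference quotient at x. Confinement to V is
  built into the covering family.\<close>

lemma interval_Vitali_cover:
  fixes S :: "real set"
  assumes "open V" "S \<subseteq> V"
    and fine: "\<And>x d. x \<in> S \<Longrightarrow> d > 0 \<Longrightarrow> \<exists>a b. a < b \<and> x \<in> {a..b} \<and> b - a < d \<and> Q a b"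
  obtains C where "countable C" "\<And>a b. (a,b) \<in> C \<Longrightarrow> a < b \<and> Q a b \<and> {a..b} \<subseteq> V"
    "disjoint_family_on (\<lambda>(a,b). {a..b}) C" "negligible (S - (\<Union>(a,b)\<in>C. {a..b}))"
proof -
  let ?K = "{(a,b). a < b \<and> Q a b \<and> {a..b} \<subseteq> V}"
  let ?a = "\<lambda>i::real \<times> real. (fst i + snd i)/2" and ?r = "\<lambda>i::real \<times> real. (snd i - fst i)/2"
  have cb: "cball (?a i) (?r i) = {fst i..snd i}" for i
    by (simp add: cball_eq_atLeastAtMost field_simps)
  have 1: "0 < ?r i" if "i \<in> ?K" for i using that by auto
  have 2: "\<exists>i. i \<in> ?K \<and> x \<in> cball (?a i) (?r i) \<and> ?r i < d"
    if "x \<in> S" "d > 0" for x d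
  proof -
    obtain e where e: "e > 0" "ball x e \<subseteq> V" using openE[OF \<open>open V\<close>, of x] \<open>S \<subseteq> V\<close> \<open>x \<in> S\<close> by blast
    obtain a b where ab: "a < b" "x \<in> {a..b}" "b - a < min d e" "Q a b"
      using fine[OF \<open>x \<in> S\<close>, of "min d e"] e(1) \<open>d > 0\<close> by auto
    have "{a..b} \<subseteq> ball x e" using ab by (auto simp: dist_real_def)
    with e(2) have "{a..b} \<subseteq> V" by blast
    with ab show ?thesis
      unfolding cb by (intro exI[of _ "(a,b)"]) simp
  qed
  obtain C where C: "countable C" "C \<subseteq> ?K"
     "pairwise (\<lambda>i j. disjnt (cball (?a i) (?r i)) (cball (?a j) (?r j))) C"
     "negligible (S - (\<Union>i \<in> C. cball (?a i) (?r i)))"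
    using Vitali_covering_theorem_cballs[of ?K ?r S ?a, OF 1 2] by blast
  show thesis
  proof (rule that[OF C(1)])
    show "disjoint_family_on (\<lambda>(a,b). {a..b}) C"
      using C(3) unfolding cb by (auto simp: disjoint_family_on_def pairwise_def disjnt_def case_prod_unfold)
    show "negligible (S - (\<Union>(a,b)\<in>C. {a..b}))" using C(4) unfolding cb by (simp add: case_prod_unfold)
  qed (use C(2) in auto)
qed

lemma emeasure_disjoint_Icc:
  fixes C :: "(real \<times> real) set"
  assumes "countable C" "disjoint_family_on (\<lambda>(a,b). {a..b}) C" "sets M = sets borel"
  shows "emeasure M (\<Union>(a,b)\<in>C. {a..b}) = (\<integral>\<^sup>+(a,b). emeasure M {a..b} \<partial>count_space C)"
proof -
  have "emeasure M (\<Union>i\<in>C. {fst i..snd i}) = (\<integral>\<^sup>+i. emeasure M {fst i..snd i} \<partial>count_space C)"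
  proof (rule emeasure_UN_countable)
    show "{fst i..snd i} \<in> sets M" for i :: "real \<times> real" unfolding assms(3) by simp
    show "disjoint_family_on (\<lambda>i. {fst i..snd i}) C" using assms(2) by (simp add: case_prod_unfold)
  qed (rule assms(1))
  then show ?thesis by (simp add: case_prod_unfold)
qed

text \<open>Two Vitali coverings are played against each other through the Stieltjes measure of F.
  Intervals of mean slope at most r, inside a neighbourhood of nearly the same length as S, give
  total mass at most r (m + e). Inside them, intervals of mean slope at least s still cover almost
  all of S and give mass at least s m. Since r < s, this forces m = 0.\<close>

lemma negligible_dini_mono:
  fixes F :: "real \<Rightarrow> real"
  assumes mono: "\<And>x y. x \<le> y \<Longrightarrow> F x \<le> F y" and cont: "continuous_on UNIV F" and "r < s"
  shows "negligible (dini_below F 1 r \<inter> dini_above F 1 s)"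
proof (cases "0 < r")
  case False
  have "0 \<le> (F (x + t) - F x) / t" for x t
    using mono[of x "x+t"] mono[of "x+t" x] by (cases "t \<ge> 0") (auto simp: divide_nonpos_neg divide_nonneg_nonneg)
  then have nonneg: "0 \<le> (F (x + t *\<^sub>R 1) - F x) / t" for x t by simp
  have "dini_below F 1 r = {}"
  proof (rule equals0I)
    fix x assume "x \<in> dini_below F 1 r"
    then obtain t where "(F (x + t *\<^sub>R 1) - F x) / t < r"
      unfolding dini_below_def by (blast intro: zero_less_one)
    with nonneg[of x t] False show False by linarith
  qed
  then show ?thesis by simp
next
  case True
  define \<mu> where "\<mu> = interval_measure F"
  have mu_Icc: "emeasure \<mu> {a..b} = ennreal (F b - F a)" if "a \<le> b" for a b
    unfolding \<mu>_def using emeasure_interval_measure_Icc[OF that mono cont] by simp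
  \<comment> \<open>Bounded pieces have finite measure, so that s m \<le> r m really implies m =
    0.\<close>
  have "negligible (dini_below F 1 r \<inter> dini_above F 1 s \<inter> cball 0 (real k))" for k :: nat
  proof -
    define S where "S = dini_below F 1 r \<inter> dini_above F 1 s \<inter> cball 0 (real k)"
    have Sb: "S \<in> sets borel"
      unfolding S_def using cont by (intro sets.Int borel_dini_below borel_dini_above) auto
    have "emeasure lborel S \<le> emeasure lborel (cball 0 (real k) :: real set)"
      by (rule emeasure_mono) (auto simp: S_def)
    also have "\<dots> < \<infinity>" by (intro emeasure_bounded_finite) simp
    finally have fin: "emeasure lborel S < \<infinity>" .
    define m where "m = measure lborel S"
    have m: "emeasure lborel S = ennreal m" "m \<ge> 0"
      using fin by (auto simp: m_def emeasure_eq_ennreal_measure)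
    have key: "s * m \<le> r * (m + e)" if "e > 0" for e
    proof -
      obtain V where V: "open V" "S \<subseteq> V" "emeasure lborel (V - S) < ennreal e"
        using outer_regular_lborel[OF Sb \<open>e > 0\<close>] by blast
      have fine1: "\<exists>a b. a < b \<and> x \<in> {a..b} \<and> b - a < d \<and> F b - F a \<le> r * (b - a)"
        if "x \<in> S" "d > 0" for x d
      proof -
        have "\<forall>d>0. \<exists>t. t \<noteq> 0 \<and> \<bar>t\<bar> < d \<and> (F (x + t) - F x) / t < r"
          using that(1) by (simp add: S_def dini_below_def)
        from this[rule_format, OF \<open>d > 0\<close>]
        obtain t where t: "t \<noteq> 0" "\<bar>t\<bar> < d" "(F (x + t) - F x) / t < r" by (elim exE conjE)
        show ?thesis
        proof (cases "t > 0")
          case True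
          then show ?thesis using t
            by (intro exI[of _ x] exI[of _ "x+t"]) (auto simp: divide_simps mult.commute)
        next
          case False
          then show ?thesis using t
            by (intro exI[of _ "x+t"] exI[of _ x]) (auto simp: divide_simps mult.commute split: if_splits)
        qed
      qed
      have fine2: "\<exists>a b. a < b \<and> x \<in> {a..b} \<and> b - a < d \<and> s * (b - a) \<le> F b - F a"
        if "x \<in> S" "d > 0" for x d
      proof -
        have "\<forall>d>0. \<exists>t. t \<noteq> 0 \<and> \<bar>t\<bar> < d \<and> s < (F (x + t) - F x) / t"
          using that(1) by (simp add: S_def dini_above_def)
        from this[rule_format, OF \<open>d > 0\<close>]
        obtain t where t: "t \<noteq> 0" "\<bar>t\<bar> < d" "s < (F (x + t) - F x) / t" by (elim exE conjE)
        show ?thesis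
        proof (cases "t > 0")
          case True
          then show ?thesis using t
            by (intro exI[of _ x] exI[of _ "x+t"]) (auto simp: divide_simps mult.commute)
        next
          case False
          then show ?thesis using t
            by (intro exI[of _ "x+t"] exI[of _ x]) (auto simp: divide_simps mult.commute split: if_splits)
        qed
      qed
      obtain C where C: "countable C"
        "\<And>a b. (a,b) \<in> C \<Longrightarrow> a < b \<and> F b - F a \<le> r * (b - a) \<and> {a..b} \<subseteq> V"
        "disjoint_family_on (\<lambda>(a,b). {a..b}) C" "negligible (S - (\<Union>(a,b)\<in>C. {a..b}))"
        using interval_Vitali_cover[OF V(1,2), of "\<lambda>a b. F b - F a \<le> r * (b - a)"] fine1 by blast
      define T where "T = (\<Union>(a,b)\<in>C. {a..b})"
      \<comment> \<open>The second covering needs an open set to live in. Passing to open intervals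
        loses only their endpoints, which are countably many.\<close>
      define T0 where "T0 = (\<Union>(a,b)\<in>C. {a<..<b})"
      have T0: "open T0" "T0 \<subseteq> T" by (auto simp: T_def T0_def)
      have Tb: "T \<in> sets borel" unfolding T_def by (rule sets.countable_UN') (use C in auto)
      have "emeasure \<mu> T = (\<integral>\<^sup>+(a,b). emeasure \<mu> {a..b} \<partial>count_space C)"
        unfolding T_def by (rule emeasure_disjoint_Icc) (use C in \<open>auto simp: \<mu>_def\<close>)
      also have "\<dots> \<le> (\<integral>\<^sup>+(a,b). ennreal r * emeasure lborel {a..b} \<partial>count_space C)"
      proof (intro nn_integral_mono, clarify)
        fix a b assume "(a, b) \<in> space (count_space C)"
        then have ab: "a < b" "F b - F a \<le> r * (b - a)" using C(2) by auto
        then show "emeasure \<mu> {a..b} \<le> ennreal r * emeasure lborel {a..b}"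
          using True by (simp add: mu_Icc ennreal_mult'[symmetric] ennreal_leI)
      qed
      also have "\<dots> = ennreal r * (\<integral>\<^sup>+(a,b). emeasure lborel {a..b} \<partial>count_space C)"
        by (subst nn_integral_cmult[symmetric]) (auto simp: case_prod_unfold)
      also have "(\<integral>\<^sup>+(a,b). emeasure lborel {a..b} \<partial>count_space C) = emeasure lborel T"
        unfolding T_def by (rule emeasure_disjoint_Icc[symmetric]) (use C in auto)
      also have "emeasure lborel T \<le> emeasure lborel V"
        by (rule emeasure_mono) (use C(2) V(1) in \<open>auto simp: T_def\<close>)
      also have "emeasure lborel V \<le> emeasure lborel S + emeasure lborel (V - S)"
      proof -
        have "V = S \<union> (V - S)" using V(2) by auto
        then show ?thesis
          using emeasure_subadditive[of S lborel "V - S"] Sb V(1) by auto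
      qed
      also have "\<dots> \<le> ennreal (m + e)"
        using V(3) m \<open>e > 0\<close> by (simp add: ennreal_plus less_imp_le)
      finally have upper: "emeasure \<mu> T \<le> ennreal (r * (m + e))"
        using True m \<open>e > 0\<close> by (simp add: ennreal_mult mult_left_mono)
      obtain C' where C': "countable C'"
        "\<And>a b. (a,b) \<in> C' \<Longrightarrow> a < b \<and> s * (b - a) \<le> F b - F a \<and> {a..b} \<subseteq> T0"
        "disjoint_family_on (\<lambda>(a,b). {a..b}) C'" "negligible ((S \<inter> T0) - (\<Union>(a,b)\<in>C'. {a..b}))"
        by (rule interval_Vitali_cover[OF T0(1) Int_lower2[of S T0] fine2[OF IntD1]]) (assumption+, blast)
      define T' where "T' = (\<Union>(a,b)\<in>C'. {a..b})"
      have T'b: "T' \<in> sets borel" unfolding T'_def by (rule sets.countable_UN') (use C' in auto)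
      have "S - T' \<subseteq> (S - T) \<union> (S \<inter> T0 - T') \<union> (fst ` C \<union> snd ` C)"
        unfolding T_def T0_def by force
      moreover have "negligible ((S - T) \<union> (S \<inter> T0 - T') \<union> (fst ` C \<union> snd ` C))"
        using C(1,4) C'(4) unfolding T_def T'_def
        by (intro negligible_Un negligible_if_countable[of "_ ` _"] countable_image)
      ultimately have "negligible (S - T')" using negligible_subset by blast
      then have "emeasure lborel (S - T') = 0"
        using Sb T'b by (simp add: negligible_iff_null_sets null_sets_def)
      moreover have "emeasure lborel S \<le> emeasure lborel T' + emeasure lborel (S - T')"
        by (rule order_trans[OF emeasure_mono emeasure_subadditive]) (use Sb T'b in auto)
      ultimately have "ennreal m \<le> emeasure lborel T'" using m by simp
      then have "ennreal s * ennreal m \<le> ennreal s * emeasure lborel T'"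
        by (rule mult_left_mono) simp
      also have "\<dots> = ennreal s * (\<integral>\<^sup>+(a,b). emeasure lborel {a..b} \<partial>count_space C')"
        unfolding T'_def by (subst emeasure_disjoint_Icc) (use C' in auto)
      also have "\<dots> = (\<integral>\<^sup>+(a,b). ennreal s * emeasure lborel {a..b} \<partial>count_space C')"
        by (subst nn_integral_cmult[symmetric]) (auto simp: case_prod_unfold)
      also have "\<dots> \<le> (\<integral>\<^sup>+(a,b). emeasure \<mu> {a..b} \<partial>count_space C')"
      proof (intro nn_integral_mono, clarify)
        fix a b assume "(a, b) \<in> space (count_space C')"
        then have ab: "a < b" "s * (b - a) \<le> F b - F a" using C'(2) by auto
        then show "ennreal s * emeasure lborel {a..b} \<le> emeasure \<mu> {a..b}"
          using True \<open>r < s\<close> by (simp add: mu_Icc ennreal_mult'[symmetric] ennreal_leI)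
      qed
      also have "\<dots> = emeasure \<mu> T'"
        unfolding T'_def by (rule emeasure_disjoint_Icc[symmetric]) (use C' in \<open>auto simp: \<mu>_def\<close>)
      also have "\<dots> \<le> emeasure \<mu> T"
        by (rule emeasure_mono) (use C'(2) T0 Tb in \<open>auto simp: T'_def \<mu>_def\<close>)
      also note upper
      finally have "ennreal (s * m) \<le> ennreal (r * (m + e))"
        using True m \<open>r < s\<close> by (simp add: ennreal_mult)
      then show ?thesis
        using True m \<open>e > 0\<close> by (simp add: ennreal_le_iff)
    qed
    have "s * m \<le> r * m"
    proof (rule field_le_epsilon)
      fix e :: real assume "e > 0"
      then show "s * m \<le> r * m + e" using key[of "e / r"] True by (simp add: distrib_left)
    qed
    then have "m = 0" using \<open>r < s\<close> m(2)
      by (smt (verit) mult_less_cancel_right_disj)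
    then show ?thesis using m Sb
      by (auto simp: S_def negligible_iff_null_sets null_sets_def)
  qed
  then have "negligible (\<Union>k. dini_below F 1 r \<inter> dini_above F 1 s \<inter> cball 0 (real k))"
    by (intro negligible_Union_nat)
  moreover have "(\<Union>k. dini_below F 1 r \<inter> dini_above F 1 s \<inter> cball 0 (real k)) = dini_below F 1 r \<inter> dini_above F 1 s"
    using real_arch_simple by (auto simp: dist_real_def)
  ultimately show ?thesis by simp
qed

lemma dini_add_linear:
  "dini_below (\<lambda>x. F x + L * x) 1 (r + L) = dini_below F (1::real) r"
  "dini_above (\<lambda>x. F x + L * x) 1 (s + L) = dini_above F (1::real) s"
proof -
  have "(F (x + t) + L * (x + t) - (F x + L * x)) / t = (F (x + t) - F x) / t + L" if "t \<noteq> 0" for x t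
    using that by (simp add: field_simps)
  then show "dini_below (\<lambda>x. F x + L * x) 1 (r + L) = dini_below F (1::real) r"
  "dini_above (\<lambda>x. F x + L * x) 1 (s + L) = dini_above F (1::real) s"
    unfolding dini_below_def dini_above_def by (simp_all cong: conj_cong)
qed

text \<open>Adding L x makes F nondecreasing and shifts both thresholds by L, so the gap between r
  and s is kept.\<close>

lemma negligible_dini_Lipschitz_real:
  fixes F :: "real \<Rightarrow> real"
  assumes lip: "\<And>x y. \<bar>F x - F y\<bar> \<le> L * \<bar>x - y\<bar>" and "r < s"
  shows "negligible (dini_below F 1 r \<inter> dini_above F 1 s)"
proof -
  have "L-lipschitz_on UNIV F"
    using lip[of 0 1] by (intro lipschitz_onI) (auto simp: dist_real_def lip)
  then have c: "continuous_on UNIV F" by (rule lipschitz_on_continuous_on)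
  have "negligible (dini_below (\<lambda>x. F x + L * x) 1 (r + L) \<inter> dini_above (\<lambda>x. F x + L * x) 1 (s + L))"
  proof (rule negligible_dini_mono)
    show "F x + L * x \<le> F y + L * y" if "x \<le> y" for x y
      using lip[of x y] that by (simp add: algebra_simps abs_le_iff)
  qed (use \<open>r < s\<close> c in \<open>auto intro!: continuous_intros\<close>)
  then show ?thesis by (simp add: dini_add_linear)
qed

section \<open>Rademacher's theorem\<close>

definition dir_deriv_at :: "('a::real_normed_vector \<Rightarrow> real) \<Rightarrow> 'a \<Rightarrow> 'a \<Rightarrow> real \<Rightarrow> bool" where
  "dir_deriv_at f v x l \<longleftrightarrow> ((\<lambda>t. (f (x + t *\<^sub>R v) - f x) / t) \<longlongrightarrow> l) (at 0)"

text \<open>The limit is taken along one fixed sequence so that the function is Borel measurable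
  whether or not the directional derivative exists. Where it exists the two agree.\<close>

definition dir_deriv :: "('a::real_normed_vector \<Rightarrow> real) \<Rightarrow> 'a \<Rightarrow> 'a \<Rightarrow> real" where
  "dir_deriv f v x = lim (\<lambda>n. (f (x + (1 / real (Suc n)) *\<^sub>R v) - f x) * real (Suc n))"

lemma dir_deriv_at_lim:
  assumes "dir_deriv_at f v x l"
  shows "(\<lambda>n. (f (x + (1 / real (Suc n)) *\<^sub>R v) - f x) * real (Suc n)) \<longlonglongrightarrow> l"
proof -
  have "filterlim (\<lambda>n. 1 / real (Suc n)) (at 0) sequentially"
    unfolding filterlim_at using LIMSEQ_inverse_real_of_nat by (auto simp: divide_inverse)
  from filterlim_compose[OF assms[unfolded dir_deriv_at_def] this] show ?thesis
    by (simp add: mult.commute)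
qed

lemma dir_deriv_at_imp_eq: "dir_deriv_at f v x l \<Longrightarrow> dir_deriv f v x = l"
  unfolding dir_deriv_def by (rule limI[OF dir_deriv_at_lim])

lemma borel_measurable_dir_deriv:
  fixes f :: "'a::euclidean_space \<Rightarrow> real"
  assumes "continuous_on UNIV f"
  shows "dir_deriv f v \<in> borel_measurable borel"
proof -
  have "(\<lambda>x. f (x + a)) \<in> borel_measurable borel" for a
    by (intro borel_measurable_continuous_onI continuous_on_compose2[OF assms] continuous_intros) auto
  moreover have "f \<in> borel_measurable borel"
    by (intro borel_measurable_continuous_onI assms)
  ultimately have "(\<lambda>x. lim (\<lambda>n. (f (x + (1 / real (Suc n)) *\<^sub>R v) - f x) * real (Suc n))) \<in> borel_measurable borel"
    by (intro borel_measurable_lim_metric borel_measurable_times borel_measurable_diff borel_measurable_const)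
  then show ?thesis unfolding dir_deriv_def .
qed

text \<open>Boundedness makes Liminf and Limsup finite, so the absence of a limit means that they
  differ. The two separating numbers are rational because the exceptional sets are later united over
  all such pairs.\<close>

lemma no_limit_oscillates:
  fixes q :: "real \<Rightarrow> real"
  assumes bnd: "\<And>t. t \<noteq> 0 \<Longrightarrow> \<bar>q t\<bar> \<le> C" and nolim: "\<nexists>l. (q \<longlongrightarrow> l) (at 0)"
  obtains r s :: rat where "real_of_rat r < real_of_rat s"
    "\<exists>\<^sub>F t in at 0. q t < real_of_rat r" "\<exists>\<^sub>F t in at 0. q t > real_of_rat s"
proof -
  let ?q = "\<lambda>t. ereal (q t)"
  let ?l = "Liminf (at 0) ?q" and ?u = "Limsup (at 0) ?q"
  have evb: "\<forall>\<^sub>F t in at 0. ereal (-C) \<le> ?q t" "\<forall>\<^sub>F t in at 0. ?q t \<le> ereal C"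
    using bnd by (auto simp: eventually_at_filter abs_le_iff minus_le_iff)
  have lb: "ereal (-C) \<le> ?l" by (rule Liminf_bounded[OF evb(1)])
  have ub: "?u \<le> ereal C" by (rule Limsup_bounded[OF evb(2)])
  have lu: "?l \<le> ?u" by (rule Liminf_le_Limsup) (rule at_neq_bot)
  have "?l < ?u"
  proof (rule ccontr)
    assume "\<not> ?l < ?u"
    then have eq: "?l = ?u" using lu by simp
    have "\<bar>?l\<bar> \<noteq> \<infinity>" using lb ub eq by (auto simp: ereal_infty_less_eq2)
    then have l: "?l = ereal (real_of_ereal ?l)" by (simp add: ereal_real')
    have "(?q \<longlongrightarrow> ereal (real_of_ereal ?l)) (at 0)"
      using eq l by (simp add: tendsto_iff_Liminf_eq_Limsup)
    then show False using nolim by auto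
  qed
  then obtain s where s: "?l < ereal (real_of_rat s)" "ereal (real_of_rat s) < ?u"
    using ereal_dense3 by blast
  obtain r where r: "?l < ereal (real_of_rat r)" "ereal (real_of_rat r) < ereal (real_of_rat s)"
    using ereal_dense3[OF s(1)] by blast
  show thesis
  proof (rule that)
    show "real_of_rat r < real_of_rat s" using r by simp
    show "\<exists>\<^sub>F t in at 0. q t < real_of_rat r"
    proof (rule ccontr)
      assume "\<not> ?thesis"
      then have "\<forall>\<^sub>F t in at 0. ereal (real_of_rat r) \<le> ?q t"
        by (simp add: frequently_def not_less)
      from Liminf_bounded[OF this] r(1) show False by simp
    qed
    show "\<exists>\<^sub>F t in at 0. q t > real_of_rat s"
    proof (rule ccontr)
      assume "\<not> ?thesis"
      then have "\<forall>\<^sub>F t in at 0. ?q t \<le> ereal (real_of_rat s)"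
        by (simp add: frequently_def not_less)
      from Limsup_bounded[OF this] s(2) show False by simp
    qed
  qed
qed

lemma frequently_at_0_iff:
  fixes P :: "real \<Rightarrow> bool"
  shows "(\<exists>\<^sub>F t in at 0. P t) \<longleftrightarrow> (\<forall>d>0. \<exists>t. t \<noteq> 0 \<and> \<bar>t\<bar> < d \<and> P t)"
  unfolding frequently_def eventually_at by (auto simp: dist_real_def)

lemma emeasure_lborel_translation:
  fixes N :: "'a::euclidean_space set"
  assumes "N \<in> sets borel"
  shows "(\<integral>\<^sup>+x. indicator N (x + c) \<partial>lborel) = emeasure lborel N"
proof -
  have "emeasure lborel N = (\<integral>\<^sup>+x. indicator N x \<partial>distr lborel borel ((+) c))"
    using assms by (simp add: lborel_distr_plus)
  also have "\<dots> = (\<integral>\<^sup>+x. indicator N (c + x) \<partial>lborel)"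
    by (subst nn_integral_distr) (use assms in auto)
  finally show ?thesis by (simp add: add.commute)
qed

text \<open>Translation invariance in direction \<open>v\<close> replaces a choice of coordinates adapted to \<open>v\<close>.\<close>

lemma null_if_null_on_lines:
  fixes N :: "'a::euclidean_space set"
  assumes N[measurable]: "N \<in> sets borel" and lines: "\<And>x. emeasure lborel {t::real. x + t *\<^sub>R v \<in> N} = 0"
  shows "emeasure lborel N = 0"
proof -
  have "(\<integral>\<^sup>+t. emeasure lborel N \<partial>(lborel :: real measure)) = (\<integral>\<^sup>+t. \<integral>\<^sup>+x. indicator N (x + t *\<^sub>R v) \<partial>lborel \<partial>(lborel :: real measure))"
    by (simp add: emeasure_lborel_translation)
  also have "\<dots> = (\<integral>\<^sup>+x. \<integral>\<^sup>+t. indicator N (x + t *\<^sub>R v) \<partial>(lborel :: real measure) \<partial>lborel)"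
    by (rule lborel_pair.Fubini') measurable
  also have "\<dots> = (\<integral>\<^sup>+x. 0 \<partial>(lborel::'a measure))"
  proof (rule nn_integral_cong)
    fix x :: 'a
    have "{t::real. x + t *\<^sub>R v \<in> N} \<in> sets borel" by measurable
    then have "(\<integral>\<^sup>+t. indicator {t::real. x + t *\<^sub>R v \<in> N} t \<partial>lborel) = 0"
      using lines[of x] by simp
    then show "(\<integral>\<^sup>+t. indicator N (x + t *\<^sub>R v) \<partial>(lborel :: real measure)) = 0"
      by (simp add: indicator_def)
  qed
  finally have "emeasure lborel N * \<infinity> = 0" by simp
  then show ?thesis by simp
qed

lemma Lipschitz_continuous:
  fixes f :: "'a::real_normed_vector \<Rightarrow> 'b::real_normed_vector"
  assumes lip: "\<And>x y. norm (f x - f y) \<le> L * norm (x - y)"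
  shows "continuous_on UNIV f"
proof -
  have "\<bar>L\<bar>-lipschitz_on UNIV f"
  proof (rule lipschitz_onI)
    fix x y show "dist (f x) (f y) \<le> \<bar>L\<bar> * dist x y"
      using order_trans[OF lip mult_right_mono[OF abs_ge_self norm_ge_zero]] by (simp add: dist_norm)
  qed simp
  then show ?thesis by (rule lipschitz_on_continuous_on)
qed

text \<open>On each line in direction v the function is Lipschitz in one variable, so every set of
  oscillation between r and s meets the line in a null set. \<open>null_if_null_on_lines\<close>
  turns this into a null set of the whole space, and rational r, s keep the union countable.\<close>

lemma AE_dir_deriv_at:
  fixes f :: "'a::euclidean_space \<Rightarrow> real"
  assumes lip: "\<And>x y. \<bar>f x - f y\<bar> \<le> L * norm (x - y)"
  shows "AE x in lborel. dir_deriv_at f v x (dir_deriv f v x)"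
proof -
  have cont: "continuous_on UNIV f" using lip by (intro Lipschitz_continuous) simp
  let ?N = "\<lambda>r s. dini_below f v r \<inter> dini_above f v s"
  have Nb: "?N r s \<in> sets borel" for r s
    by (intro sets.Int borel_dini_below borel_dini_above cont)
  have null: "emeasure lborel (?N r s) = 0" if "r < s" for r s
  proof (rule null_if_null_on_lines[OF Nb])
    fix x
    let ?F = "\<lambda>t. f (x + t *\<^sub>R v)"
    have lipF: "\<bar>?F a - ?F b\<bar> \<le> (L * norm v) * \<bar>a - b\<bar>" for a b
    proof -
      have "x + a *\<^sub>R v - (x + b *\<^sub>R v) = (a - b) *\<^sub>R v" by (simp add: algebra_simps)
      with lip[of "x + a *\<^sub>R v" "x + b *\<^sub>R v"] show ?thesis by (simp add: mult_ac)
    qed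
    have contF: "continuous_on UNIV ?F"
      by (intro continuous_on_compose2[OF cont] continuous_intros) auto
    have "{t. x + t *\<^sub>R v \<in> ?N r s} = dini_below ?F 1 r \<inter> dini_above ?F 1 s"
      by (simp add: dini_below_def dini_above_def scaleR_add_left add.assoc Collect_conj_eq)
    moreover have "negligible (dini_below ?F 1 r \<inter> dini_above ?F 1 s)"
      using negligible_dini_Lipschitz_real[OF lipF that] .
    moreover have "dini_below ?F 1 r \<inter> dini_above ?F 1 s \<in> sets borel"
      by (intro sets.Int borel_dini_below borel_dini_above contF)
    ultimately show "emeasure lborel {t. x + t *\<^sub>R v \<in> ?N r s} = 0"
      by (simp add: negligible_iff_emeasure0)
  qed
  have "AE x in lborel. \<forall>r s :: rat. real_of_rat r < real_of_rat s \<longrightarrow> x \<notin> ?N (real_of_rat r) (real_of_rat s)"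
  proof (subst AE_all_countable, intro allI, subst AE_all_countable, intro allI)
    fix r s :: rat
    show "AE x in lborel. real_of_rat r < real_of_rat s \<longrightarrow> x \<notin> ?N (real_of_rat r) (real_of_rat s)"
    proof (cases "real_of_rat r < real_of_rat s")
      case True
      then have "?N (real_of_rat r) (real_of_rat s) \<in> null_sets lborel"
        using null Nb by (simp add: null_sets_def)
      then have "AE x in lborel. x \<notin> ?N (real_of_rat r) (real_of_rat s)" by (rule AE_not_in)
      then show ?thesis by (rule AE_mp) (rule AE_I2, simp)
    qed simp
  qed
  then show ?thesis
  proof (rule AE_mp, intro AE_I2 impI)
    fix x assume x: "\<forall>r s :: rat. real_of_rat r < real_of_rat s \<longrightarrow> x \<notin> ?N (real_of_rat r) (real_of_rat s)"
    let ?q = "\<lambda>t. (f (x + t *\<^sub>R v) - f x) / t"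
    have "\<exists>l. (?q \<longlongrightarrow> l) (at 0)"
    proof (rule ccontr)
      assume no: "\<nexists>l. (?q \<longlongrightarrow> l) (at 0)"
      have bnd: "\<bar>?q t\<bar> \<le> L * norm v" if "t \<noteq> 0" for t
        using lip[of "x + t *\<^sub>R v" x] that by (simp add: divide_simps mult_ac)
      obtain r s :: rat where rs: "real_of_rat r < real_of_rat s"
        "\<exists>\<^sub>F t in at 0. ?q t < real_of_rat r" "\<exists>\<^sub>F t in at 0. ?q t > real_of_rat s"
        using no_limit_oscillates[of ?q, OF bnd no] by blast
      then have "x \<in> ?N (real_of_rat r) (real_of_rat s)"
        unfolding frequently_at_0_iff dini_below_def dini_above_def by simp
      then show False using x rs(1) by blast
    qed
    then obtain l where l: "dir_deriv_at f v x l" by (auto simp: dir_deriv_at_def)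
    then show "dir_deriv_at f v x (dir_deriv f v x)" using dir_deriv_at_imp_eq[OF l] by simp
  qed
qed

text \<open>Adding C makes g a nonnegative density almost everywhere. The measures with densities C
  + g and C agree on boxes, an intersection-stable generator, hence everywhere, and densities are
  unique almost everywhere.\<close>

lemma AE_0_if_box_integrals_0:
  fixes g :: "'a::euclidean_space \<Rightarrow> real"
  assumes g[measurable]: "g \<in> borel_measurable borel" and bnd: "AE x in lborel. \<bar>g x\<bar> \<le> C" and C: "0 \<le> C"
    and zero: "\<And>a b. (\<integral>x. indicator (box a b) x * g x \<partial>lborel) = 0"
  shows "AE x in lborel. g x = 0"
proof -
  have intg: "integrable lborel (\<lambda>x. indicator (box a b) x * g x)" for a b
  proof (rule Bochner_Integration.integrable_bound)
    show "integrable lborel (\<lambda>x. C * indicator (box a b) x :: real)"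
      by (intro integrable_mult_right integrable_real_indicator) (auto simp: emeasure_bounded_finite[OF bounded_box, unfolded infinity_ennreal_def])
    show "AE x in lborel. norm (indicator (box a b) x * g x) \<le> norm (C * indicator (box a b) x)"
      using bnd by (rule AE_mp) (use C in \<open>auto intro!: AE_I2 simp: indicator_def\<close>)
  qed measurable
  have "density lborel (\<lambda>x. ennreal (C + g x)) = density lborel (\<lambda>x. ennreal C)"
  proof (rule measure_eqI_generator_eq)
    let ?E = "range (\<lambda>(a, b). box a b::'a set)"
    show "Int_stable ?E"
      by (auto simp: Int_stable_def box_Int_box)
    show "?E \<subseteq> Pow UNIV" "sets (density lborel (\<lambda>x. ennreal (C + g x))) = sigma_sets UNIV ?E"
      "sets (density lborel (\<lambda>x. ennreal C)) = sigma_sets UNIV ?E"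
      by (simp_all add: borel_eq_box)
    let ?A = "\<lambda>n::nat. box (- (real n *\<^sub>R One)) (real n *\<^sub>R One) :: 'a set"
    show "range ?A \<subseteq> ?E" "(\<Union>i. ?A i) = UNIV"
      unfolding UN_box_eq_UNIV by auto
    have eq: "emeasure (density lborel (\<lambda>x. ennreal (C + g x))) (box a b) = emeasure (density lborel (\<lambda>x. ennreal C)) (box a b)"
      and fin: "emeasure (density lborel (\<lambda>x. ennreal (C + g x))) (box a b) < \<infinity>" for a b :: 'a
    proof -
      let ?l = "emeasure (density lborel (\<lambda>x. ennreal (C + g x))) (box a b)"
        and ?r = "emeasure (density lborel (\<lambda>x. ennreal C)) (box a b)"
      have 1: "integrable lborel (\<lambda>x. C * indicator (box a b) x :: real)"
        by (intro integrable_mult_right integrable_real_indicator) (auto simp: emeasure_bounded_finite[OF bounded_box, unfolded infinity_ennreal_def])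
      have nonneg: "AE x in lborel. 0 \<le> C * indicator (box a b) x + indicator (box a b) x * g x"
        using bnd by (rule AE_mp) (auto intro!: AE_I2 simp: indicator_def)
      have "?l = (\<integral>\<^sup>+x. ennreal (C + g x) * indicator (box a b) x \<partial>lborel)"
        by (subst emeasure_density) auto
      also have "\<dots> = (\<integral>\<^sup>+x. ennreal (C * indicator (box a b) x + indicator (box a b) x * g x) \<partial>lborel)"
        by (intro nn_integral_cong) (auto simp: indicator_def)
      also have "\<dots> = ennreal (\<integral>x. C * indicator (box a b) x + indicator (box a b) x * g x \<partial>lborel)"
        by (rule nn_integral_eq_integral[OF Bochner_Integration.integrable_add[OF 1 intg] nonneg])
      also have "(\<integral>x. C * indicator (box a b) x + indicator (box a b) x * g x \<partial>lborel) = (\<integral>x. C * indicator (box a b) x \<partial>lborel)"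
        by (subst Bochner_Integration.integral_add[OF 1 intg]) (simp only: zero add_0_right)
      also have "ennreal \<dots> = (\<integral>\<^sup>+x. ennreal (C * indicator (box a b) x) \<partial>lborel)"
        by (rule nn_integral_eq_integral[symmetric, OF 1]) (use C in \<open>auto simp: indicator_def\<close>)
      also have "\<dots> = (\<integral>\<^sup>+x. ennreal C * indicator (box a b) x \<partial>lborel)"
        by (intro nn_integral_cong) (auto simp: indicator_def)
      also have "\<dots> = ?r" by (subst emeasure_density) auto
      finally show "?l = ?r" .
      have "?r = ennreal C * emeasure lborel (box a b)" by (subst emeasure_density_const) auto
      also have "\<dots> < \<infinity>" by (auto simp: ennreal_mult_less_top emeasure_bounded_finite[OF bounded_box, unfolded infinity_ennreal_def])
      finally show "?l < \<infinity>" using \<open>?l = ?r\<close> by simp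
    qed
    show "emeasure (density lborel (\<lambda>x. ennreal (C + g x))) X = emeasure (density lborel (\<lambda>x. ennreal C)) X" if "X \<in> ?E" for X
      using that eq by auto
    show "emeasure (density lborel (\<lambda>x. ennreal (C + g x))) (?A i) \<noteq> \<infinity>" for i
      using fin[of "- (real i *\<^sub>R One)" "real i *\<^sub>R One"] by auto
  qed
  then have "AE x in lborel. ennreal (C + g x) = ennreal C"
    by (subst (asm) sigma_finite_measure.density_unique_iff[OF sigma_finite_lborel]) auto
  with bnd show ?thesis
    by eventually_elim (use C in \<open>auto simp: abs_le_iff\<close>)
qed

text \<open>
  With \<open>\<psi> n\<close> the difference quotients in direction \<open>v\<close> and \<open>e n = u / n\<close>, this shows that
  \<open>D\<^bsub>u+v\<^esub> f - D\<^bsub>u\<^esub> f - D\<^bsub>v\<^esub> f\<close> integrates to \<open>0\<close> over boxes.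
\<close>

lemma continuity_of_translation_box:
  fixes \<psi> :: "nat \<Rightarrow> 'a::euclidean_space \<Rightarrow> real"
  assumes meas[measurable]: "\<And>n. \<psi> n \<in> borel_measurable borel" and bnd: "\<And>n x. \<bar>\<psi> n x\<bar> \<le> K"
    and e: "e \<longlonglongrightarrow> 0"
  shows "(\<lambda>n. \<integral>x. indicator (box a b) x * (\<psi> n (x + e n) - \<psi> n x) \<partial>lborel) \<longlonglongrightarrow> 0"
proof -
  let ?I = "\<lambda>x. indicator (box a b) x :: real"
  have K: "0 \<le> K" using bnd[of 0 0] by linarith
  have int1: "integrable lborel (\<lambda>x. ?I x * \<psi> n (x + c))" for n c
  proof (rule Bochner_Integration.integrable_bound)
    show "integrable lborel (\<lambda>x. K * ?I x)"
      by (intro integrable_mult_right integrable_real_indicator) (auto simp: emeasure_bounded_finite[OF bounded_box, unfolded infinity_ennreal_def])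
    show "AE x in lborel. norm (?I x * \<psi> n (x + c)) \<le> norm (K * ?I x)"
      using bnd K by (auto intro!: AE_I2 simp: indicator_def)
  qed measurable
  have tr: "has_bochner_integral lborel (\<lambda>x. ?I (x - c) * \<psi> n x) (\<integral>x. ?I x * \<psi> n (x + c) \<partial>lborel)" for n c
  proof -
    have "has_bochner_integral (distr lborel borel ((+) c)) (\<lambda>x. ?I (x - c) * \<psi> n x) (\<integral>x. ?I x * \<psi> n (x + c) \<partial>lborel)"
      using int1[of n c] by (intro has_bochner_integral_distr) (auto simp: has_bochner_integral_iff add.commute)
    then show ?thesis by (simp only: lborel_distr_plus)
  qed
  \<comment> \<open>The translation is moved onto the indicator. Nothing is known about the
    convergence of \<open>\<psi> n\<close>, whereas the shifted indicators converge off the null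
    frontier of the box.\<close>
  have eq: "(\<integral>x. ?I x * (\<psi> n (x + e n) - \<psi> n x) \<partial>lborel) = (\<integral>x. (?I (x - e n) - ?I x) * \<psi> n x \<partial>lborel)" for n
  proof -
    have "(\<integral>x. ?I x * (\<psi> n (x + e n) - \<psi> n x) \<partial>lborel) = (\<integral>x. ?I x * \<psi> n (x + e n) \<partial>lborel) - (\<integral>x. ?I x * \<psi> n x \<partial>lborel)"
      using int1[of n "e n"] int1[of n 0] by (simp add: right_diff_distrib)
    also have "(\<integral>x. ?I x * \<psi> n (x + e n) \<partial>lborel) = (\<integral>x. ?I (x - e n) * \<psi> n x \<partial>lborel)"
      using tr[where c="e n" and n=n] by (simp add: has_bochner_integral_iff)
    also have "\<dots> - (\<integral>x. ?I x * \<psi> n x \<partial>lborel) = (\<integral>x. (?I (x - e n) - ?I x) * \<psi> n x \<partial>lborel)"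
      using int1[of n 0] tr[where c="e n" and n=n] by (simp add: has_bochner_integral_iff left_diff_distrib)
    finally show ?thesis .
  qed
  obtain E where E: "\<And>n. norm (e n) \<le> E"
    using convergent_imp_Bseq[OF convergentI[OF e]] unfolding Bseq_def by blast
  obtain R where R: "\<And>x. x \<in> box a b \<Longrightarrow> norm x \<le> R" using bounded_box[of a b] unfolding bounded_iff by auto
  have "(\<lambda>n. \<integral>x. (?I (x - e n) - ?I x) * \<psi> n x \<partial>lborel) \<longlonglongrightarrow> (\<integral>x. 0 \<partial>(lborel::'a measure))"
  proof (rule integral_dominated_convergence)
    show "integrable lborel (\<lambda>x. K * indicator (cball 0 (R + E)) x :: real)"
      by (intro integrable_mult_right integrable_real_indicator) (auto simp: emeasure_bounded_finite[OF bounded_cball, unfolded infinity_ennreal_def])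
    have "emeasure lborel (frontier (box a b)) = 0"
      using negligible_convex_frontier[OF convex_box(2)] by (subst (asm) negligible_iff_emeasure0) auto
    then have "AE x in lborel. x \<notin> frontier (box a b)" by (intro AE_not_in) (auto simp: null_sets_def)
    then show "AE x in lborel. (\<lambda>n. (?I (x - e n) - ?I x) * \<psi> n x) \<longlonglongrightarrow> 0"
    proof (rule AE_mp, intro AE_I2 impI)
      fix x assume x: "x \<notin> frontier (box a b)"
      have lim: "(\<lambda>n. x - e n) \<longlonglongrightarrow> x" using tendsto_diff[OF tendsto_const e, of x] by simp
      have "\<forall>\<^sub>F n in sequentially. ?I (x - e n) = ?I x"
      proof (cases "x \<in> box a b")
        case True
        then have "\<forall>\<^sub>F n in sequentially. x - e n \<in> box a b"
          using topological_tendstoD[OF lim open_box] by blast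
        then show ?thesis by (rule eventually_mono) (simp add: True)
      next
        case False
        then have "x \<in> - closure (box a b)" using x unfolding frontier_def interior_open[OF open_box] by simp
        then have "\<forall>\<^sub>F n in sequentially. x - e n \<in> - closure (box a b)"
          using topological_tendstoD[OF lim, of "- closure (box a b)"] by blast
        then show ?thesis by (rule eventually_mono) (use False closure_subset[of "box a b"] in \<open>auto simp: indicator_def\<close>)
      qed
      then show "(\<lambda>n. (?I (x - e n) - ?I x) * \<psi> n x) \<longlonglongrightarrow> 0"
        by (intro tendsto_eventually) (auto elim: eventually_mono)
    qed
    show "AE x in lborel. norm ((?I (x - e n) - ?I x) * \<psi> n x) \<le> K * indicator (cball 0 (R + E)) x" for n
    proof (rule AE_I2)
      fix x
      have "x \<in> cball 0 (R + E)" if "?I (x - e n) - ?I x \<noteq> 0"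
      proof -
        have "x - e n \<in> box a b \<or> x \<in> box a b" using that by (auto simp: indicator_def split: if_splits)
        then have "norm (x - e n) \<le> R \<or> norm x \<le> R" using R by auto
        then show ?thesis using E[of n] norm_triangle_ineq[of "x - e n" "e n"] order_trans[OF norm_ge_zero E[of n]] by auto
      qed
      then show "norm ((?I (x - e n) - ?I x) * \<psi> n x) \<le> K * indicator (cball 0 (R + E)) x"
        using bnd[of n x] K by (auto simp: indicator_def)
    qed
  qed measurable
  then show ?thesis by (simp add: eq)
qed

text \<open>The quotient in direction u + v minus the quotient in direction u is the quotient in
  direction v at the shifted point x + u/n. The defect of additivity is therefore a limit of
  translation differences of one bounded sequence, whose box integrals tend to 0. This takes the
  place of integration by parts against test functions.\<close>

lemma AE_dir_deriv_add:
  fixes f :: "'a::euclidean_space \<Rightarrow> real"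
  assumes lip: "\<And>x y. \<bar>f x - f y\<bar> \<le> L * norm (x - y)"
  shows "AE x in lborel. dir_deriv f (u + v) x = dir_deriv f u x + dir_deriv f v x"
proof -
  have cont: "continuous_on UNIV f" using lip by (intro Lipschitz_continuous) simp
  have [measurable]: "f \<in> borel_measurable borel" by (intro borel_measurable_continuous_onI cont)
  note [measurable] = borel_measurable_dir_deriv[OF cont]
  let ?e = "\<lambda>n. 1 / real (Suc n)"
  define \<psi> where "\<psi> n x = (f (x + ?e n *\<^sub>R v) - f x) * real (Suc n)" for n x
  have [measurable]: "\<psi> n \<in> borel_measurable borel" for n unfolding \<psi>_def by measurable
  define K where "K = L * norm v"
  have \<psi>K: "\<bar>\<psi> n x\<bar> \<le> K" for n x
    using lip[of "x + ?e n *\<^sub>R v" x] by (simp add: \<psi>_def K_def abs_mult divide_simps mult_ac)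
  have K: "0 \<le> K" using \<psi>K[of 0 0] by linarith
  let ?g = "\<lambda>x. dir_deriv f (u + v) x - dir_deriv f u x - dir_deriv f v x"
  let ?gn = "\<lambda>n x. \<psi> n (x + ?e n *\<^sub>R u) - \<psi> n x"
  have lim: "AE x in lborel. (\<lambda>n. ?gn n x) \<longlonglongrightarrow> ?g x"
    using AE_dir_deriv_at[OF lip, of "u + v"] AE_dir_deriv_at[OF lip, of u] AE_dir_deriv_at[OF lip, of v]
  proof eventually_elim
    fix x
    assume "dir_deriv_at f (u + v) x (dir_deriv f (u + v) x)" "dir_deriv_at f u x (dir_deriv f u x)"
      "dir_deriv_at f v x (dir_deriv f v x)"
    note tendsto_diff[OF tendsto_diff[OF this(1,2)[THEN dir_deriv_at_lim]] this(3)[THEN dir_deriv_at_lim]]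
    then show "(\<lambda>n. ?gn n x) \<longlonglongrightarrow> ?g x"
      by (rule filterlim_cong[THEN iffD1, rotated -1]) (auto simp: \<psi>_def algebra_simps)
  qed
  have bnd: "\<bar>?gn n x\<bar> \<le> 2 * K" for n x
    using \<psi>K[of n x] \<psi>K[of n "x + ?e n *\<^sub>R u"] by linarith
  have e0: "(\<lambda>n. ?e n *\<^sub>R u) \<longlonglongrightarrow> 0"
    using tendsto_scaleR[OF LIMSEQ_inverse_real_of_nat tendsto_const[of u]] by (simp add: divide_inverse)
  have "AE x in lborel. ?g x = 0"
  proof (rule AE_0_if_box_integrals_0)
    show "AE x in lborel. \<bar>?g x\<bar> \<le> 2 * K"
      using lim
    proof eventually_elim
      fix x assume "(\<lambda>n. ?gn n x) \<longlonglongrightarrow> ?g x"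
      from tendsto_rabs[OF this] show "\<bar>?g x\<bar> \<le> 2 * K"
        by (rule LIMSEQ_le_const2) (use bnd in auto)
    qed
    fix a b :: 'a
    have "(\<lambda>n. \<integral>x. indicator (box a b) x * ?gn n x \<partial>lborel) \<longlonglongrightarrow> (\<integral>x. indicator (box a b) x * ?g x \<partial>lborel)"
    proof (rule integral_dominated_convergence)
      show "integrable lborel (\<lambda>x. (2 * K) * indicator (box a b) x :: real)"
        by (intro integrable_mult_right integrable_real_indicator) (auto simp: emeasure_bounded_finite[OF bounded_box, unfolded infinity_ennreal_def])
      show "AE x in lborel. (\<lambda>n. indicator (box a b) x * ?gn n x) \<longlonglongrightarrow> indicator (box a b) x * ?g x"
        using lim by eventually_elim (intro tendsto_mult tendsto_const)
      show "AE x in lborel. norm (indicator (box a b) x * ?gn n x) \<le> (2 * K) * indicator (box a b) x" for n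
        using bnd[of n] by (intro AE_I2) (auto simp: indicator_def)
    qed measurable
    moreover have "(\<lambda>n. \<integral>x. indicator (box a b) x * ?gn n x \<partial>lborel) \<longlonglongrightarrow> 0"
      by (rule continuity_of_translation_box[OF _ \<psi>K e0]) measurable
    ultimately show "(\<integral>x. indicator (box a b) x * ?g x \<partial>lborel) = 0"
      by (rule LIMSEQ_unique)
  qed (use K in auto)
  then show ?thesis by eventually_elim simp
qed

section \<open>From directional derivatives to differentiability\<close>

lemma dir_deriv_at_scaleR:
  assumes "dir_deriv_at f v x l"
  shows "dir_deriv_at f (c *\<^sub>R v) x (c * l)"
proof (cases "c = 0")
  case False
  have "filterlim (\<lambda>t. c * t) (at 0) (at (0::real))"
    unfolding filterlim_at using False
    by (auto simp: eventually_at_filter intro!: tendsto_eq_intros)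
  then have "((\<lambda>t. (f (x + (c * t) *\<^sub>R v) - f x) / (c * t)) \<longlongrightarrow> l) (at 0)"
    using assms unfolding dir_deriv_at_def by (rule filterlim_compose[rotated])
  then have "((\<lambda>t. c * ((f (x + (c * t) *\<^sub>R v) - f x) / (c * t))) \<longlongrightarrow> c * l) (at 0)"
    by (intro tendsto_intros)
  then show ?thesis using False by (simp add: dir_deriv_at_def mult.commute)
qed (simp add: dir_deriv_at_def)

text \<open>Additivity and homogeneity are applied one basis vector at a time. The exceptional null
  set depends on v, so the result can be used simultaneously only for countably many
  directions.\<close>

lemma AE_dir_deriv_linear:
  fixes f :: "'a::euclidean_space \<Rightarrow> real"
  assumes lip: "\<And>x y. \<bar>f x - f y\<bar> \<le> L * norm (x - y)"
  shows "AE x in lborel. dir_deriv_at f v x (\<Sum>b\<in>Basis. (v \<bullet> b) * dir_deriv f b x)"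
proof -
  have sum: "AE x in lborel. dir_deriv f (\<Sum>b\<in>S. (v \<bullet> b) *\<^sub>R b) x = (\<Sum>b\<in>S. (v \<bullet> b) * dir_deriv f b x)"
    if "finite S" for S
    using that
  proof induction
    case empty
    have "dir_deriv f 0 x = 0" for x
      by (rule dir_deriv_at_imp_eq) (simp add: dir_deriv_at_def)
    then show ?case by simp
  next
    case (insert b S)
    show ?case
      using insert.IH AE_dir_deriv_add[OF lip, of "(v \<bullet> b) *\<^sub>R b" "\<Sum>b\<in>S. (v \<bullet> b) *\<^sub>R b"] AE_dir_deriv_at[OF lip, of b]
    proof eventually_elim
      case (elim x)
      have "dir_deriv f ((v \<bullet> b) *\<^sub>R b) x = (v \<bullet> b) * dir_deriv f b x"
        by (rule dir_deriv_at_imp_eq[OF dir_deriv_at_scaleR[OF elim(3)]])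
      then show ?case using elim insert.hyps by simp
    qed
  qed
  show ?thesis
    using sum[OF finite_Basis] AE_dir_deriv_at[OF lip, of v]
    by eventually_elim (simp add: euclidean_representation)
qed

text \<open>By compactness of the unit sphere, finitely many directions of D are \<eta>-dense in it.
  The quotients converge uniformly over these, and the Lipschitz bound passes to all other
  directions.\<close>

lemma differentiable_if_dense_dir_derivs:
  fixes f :: "'a::euclidean_space \<Rightarrow> real"
  assumes lip: "\<And>x y. \<bar>f x - f y\<bar> \<le> L * norm (x - y)"
    and D: "closure D = UNIV" and "linear l" and dd: "\<And>v. v \<in> D \<Longrightarrow> dir_deriv_at f v x (l v)"
  shows "(f has_derivative l) (at x)"
  unfolding has_derivative_at_alt
proof (intro conjI allI impI)
  show "bounded_linear l" using \<open>linear l\<close> by (simp add: linear_conv_bounded_linear)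
  obtain B where B: "B > 0" "\<And>h. \<bar>l h\<bar> \<le> B * norm h"
    using linear_bounded_pos[OF \<open>linear l\<close>] by auto
  obtain b :: 'a where "b \<in> Basis" using nonempty_Basis by blast
  then have L: "0 \<le> L" using order_trans[OF abs_ge_zero lip[of b 0]] by simp
  fix e :: real assume "e > 0"
  \<comment> \<open>Three errors are shared out: 1 for the quotient along v, L for replacing w by v
    in f, and B for the same replacement in l.\<close>
  define \<eta> where "\<eta> = e / (L + B + 1)"
  have \<eta>: "\<eta> > 0" using \<open>e > 0\<close> B L by (simp add: \<eta>_def)
  have "sphere 0 1 \<subseteq> (\<Union>v\<in>D. ball v \<eta>)"
  proof
    fix w :: 'a
    have "w \<in> closure D" using D by simp
    then obtain v where "v \<in> D" "dist v w < \<eta>" using \<eta> closure_approachable by blast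
    then show "w \<in> (\<Union>v\<in>D. ball v \<eta>)" by auto
  qed
  then obtain D' where D': "D' \<subseteq> D" "finite D'" "sphere 0 1 \<subseteq> (\<Union>v\<in>D'. ball v \<eta>)"
    using compactE_image[OF compact_sphere[of 0 1], of D "\<lambda>v. ball v \<eta>"] by auto
  have "\<forall>\<^sub>F t in at 0. \<forall>v\<in>D'. \<bar>(f (x + t *\<^sub>R v) - f x) / t - l v\<bar> < \<eta>"
  proof (intro eventually_ball_finite D'(2) ballI)
    fix v assume "v \<in> D'"
    then have "dir_deriv_at f v x (l v)" using dd D'(1) by blast
    from tendstoD[OF this[unfolded dir_deriv_at_def] \<eta>]
    show "\<forall>\<^sub>F t in at 0. \<bar>(f (x + t *\<^sub>R v) - f x) / t - l v\<bar> < \<eta>" by (simp add: dist_real_def)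
  qed
  then obtain d where d: "d > 0" "\<And>t v. t \<noteq> 0 \<Longrightarrow> \<bar>t\<bar> < d \<Longrightarrow> v \<in> D' \<Longrightarrow> \<bar>(f (x + t *\<^sub>R v) - f x) / t - l v\<bar> < \<eta>"
    unfolding eventually_at by (auto simp: dist_real_def)
  show "\<exists>d>0. \<forall>y. norm (y - x) < d \<longrightarrow> norm (f y - f x - l (y - x)) \<le> e * norm (y - x)"
  proof (rule exI[of _ d], intro conjI allI impI)
    fix y assume y: "norm (y - x) < d"
    show "norm (f y - f x - l (y - x)) \<le> e * norm (y - x)"
    proof (cases "y = x")
      case True
      then show ?thesis using linear_0[OF \<open>linear l\<close>] by simp
    next
      case False
      define t where "t = norm (y - x)"
      define w where "w = (y - x) /\<^sub>R t"
      have t: "t > 0" "t < d" using False y by (auto simp: t_def)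
      have yx: "y = x + t *\<^sub>R w" using t by (simp add: w_def)
      have "norm w = 1" using t by (simp add: w_def t_def)
      then have "w \<in> sphere 0 1" by simp
      then have "w \<in> (\<Union>v\<in>D'. ball v \<eta>)" using D'(3) by (rule rev_subsetD)
      then obtain v where v: "v \<in> D'" "norm (w - v) < \<eta>" by (auto simp: dist_norm norm_minus_commute)
      have "\<bar>(f (x + t *\<^sub>R v) - f x) / t - l v\<bar> < \<eta>" using d(2)[of t v] t v by auto
      moreover have "(f (x + t *\<^sub>R v) - f x) / t - l v = (f (x + t *\<^sub>R v) - f x - t * l v) / t"
        using t by (simp add: diff_divide_distrib)
      ultimately have 1: "\<bar>f (x + t *\<^sub>R v) - f x - t * l v\<bar> \<le> \<eta> * t"
        using t by (simp add: divide_simps mult.commute)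
      have "\<bar>f y - f (x + t *\<^sub>R v)\<bar> \<le> L * norm (t *\<^sub>R (w - v))"
        using lip[of y "x + t *\<^sub>R v"] by (simp add: yx algebra_simps)
      also have "\<dots> = L * norm (w - v) * t" using t by simp
      also have "\<dots> \<le> L * \<eta> * t" using t v L by (intro mult_right_mono mult_left_mono) auto
      finally have 2: "\<bar>f y - f (x + t *\<^sub>R v)\<bar> \<le> L * \<eta> * t" .
      have "l (y - x) - t * l v = t * l (w - v)"
        using \<open>linear l\<close> by (simp add: yx linear_cmul linear_diff algebra_simps)
      then have "\<bar>l (y - x) - t * l v\<bar> = t * \<bar>l (w - v)\<bar>" using t by (simp add: abs_mult)
      also have "\<dots> \<le> t * (B * \<eta>)"
        using B(2)[of "w - v"] B(1) v t by (intro mult_left_mono order_trans[OF B(2)]) auto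
      finally have 3: "\<bar>l (y - x) - t * l v\<bar> \<le> B * \<eta> * t" by (simp add: mult_ac)
      have "\<bar>f y - f x - l (y - x)\<bar> \<le> \<eta> * t + L * \<eta> * t + B * \<eta> * t" using 1 2 3 by linarith
      also have "\<dots> = ((L + B + 1) * \<eta>) * t" by (simp add: algebra_simps)
      also have "(L + B + 1) * \<eta> = e" using L B(1) by (simp add: \<eta>_def)
      finally show ?thesis by (simp add: t_def)
    qed
  qed (rule d(1))
qed

lemma AE_differentiable_Lipschitz_real:
  fixes f :: "'a::euclidean_space \<Rightarrow> real"
  assumes lip: "\<And>x y. \<bar>f x - f y\<bar> \<le> L * norm (x - y)"
  shows "AE x in lborel. f differentiable (at x)"
proof -
  obtain D :: "'a set" where D: "countable D" "closure D = UNIV"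
    using separable[of "UNIV :: 'a set"] by (metis top.extremum_uniqueI)
  have "AE x in lborel. \<forall>v\<in>D. dir_deriv_at f v x (\<Sum>b\<in>Basis. (v \<bullet> b) * dir_deriv f b x)"
    using D(1) AE_dir_deriv_linear[OF lip] by (subst AE_ball_countable) auto
  then show ?thesis
  proof eventually_elim
    fix x assume x: "\<forall>v\<in>D. dir_deriv_at f v x (\<Sum>b\<in>Basis. (v \<bullet> b) * dir_deriv f b x)"
    have "linear (\<lambda>v. \<Sum>b\<in>Basis. (v \<bullet> b) * dir_deriv f b x)"
      by (intro linearI) (simp_all add: inner_add_left sum.distrib sum_distrib_left algebra_simps)
    from differentiable_if_dense_dir_derivs[OF lip D(2) this] x
    show "f differentiable (at x)" unfolding differentiable_def by blast
  qed
qed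

theorem Rademacher:
  fixes f :: "'a::euclidean_space \<Rightarrow> 'b::euclidean_space"
  assumes lip: "\<And>x y. norm (f x - f y) \<le> L * norm (x - y)"
  shows "negligible {x. \<not> f differentiable (at x)}"
proof -
  have "AE x in lborel. (\<lambda>x. f x \<bullet> b) differentiable (at x)" if "b \<in> Basis" for b
  proof (rule AE_differentiable_Lipschitz_real)
    show "\<bar>f x \<bullet> b - f y \<bullet> b\<bar> \<le> L * norm (x - y)" for x y
      using Basis_le_norm[OF that, of "f x - f y"] lip[of x y] by (simp add: inner_diff_left)
  qed
  then have "AE x in lborel. \<forall>b\<in>Basis. (\<lambda>x. f x \<bullet> b) differentiable (at x)"
    by (intro AE_finite_allI) auto
  then have "AE x in lborel. f differentiable (at x)"
    by (rule eventually_mono) (rule differentiable_componentwise_within[THEN iffD2])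
  then obtain N where N: "{x. \<not> f differentiable (at x)} \<subseteq> N" "N \<in> null_sets lborel"
    unfolding eventually_ae_filter by auto
  have "negligible N" using N(2) by (simp add: negligible_iff_null_sets null_sets_completionI)
  then show ?thesis using N(1) by (rule negligible_subset)
qed

section \<open>The proximal map and second-order expansions of convex functions\<close>

definition subgradient :: "('a::real_inner \<Rightarrow> real) \<Rightarrow> 'a \<Rightarrow> 'a \<Rightarrow> bool" where
  "subgradient \<Psi> x g \<longleftrightarrow> (\<forall>y. \<Psi> x + g \<bullet> (y - x) \<le> \<Psi> y)"

lemma subgradientD: "subgradient \<Psi> x g \<Longrightarrow> \<Psi> x + g \<bullet> (y - x) \<le> \<Psi> y"
  by (simp add: subgradient_def)

lemma subgradient_monotone:
  assumes "subgradient \<Psi> x g" "subgradient \<Psi> y h"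
  shows "0 \<le> (g - h) \<bullet> (x - y)"
  using subgradientD[OF assms(1), of y] subgradientD[OF assms(2), of x]
  by (simp add: inner_diff_left inner_diff_right)

lemma convex_on_if_subgradient:
  assumes "\<And>x. \<exists>g. subgradient \<Psi> x g"
  shows "convex_on UNIV \<Psi>"
proof (rule convex_onI)
  fix t :: real and x y :: 'a
  assume t: "0 < t" "t < 1"
  let ?z = "(1 - t) *\<^sub>R x + t *\<^sub>R y"
  obtain g where g: "subgradient \<Psi> ?z g" using assms by blast
  have "x - ?z = t *\<^sub>R (x - y)" "y - ?z = (1 - t) *\<^sub>R (y - x)" by (simp_all add: algebra_simps)
  with subgradientD[OF g, of x] subgradientD[OF g, of y]
  have 1: "\<Psi> ?z + t * (g \<bullet> (x - y)) \<le> \<Psi> x" "\<Psi> ?z + (1 - t) * (g \<bullet> (y - x)) \<le> \<Psi> y" by simp_all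
  have "(1 - t) * (\<Psi> ?z + t * (g \<bullet> (x - y))) + t * (\<Psi> ?z + (1 - t) * (g \<bullet> (y - x))) \<le> (1 - t) * \<Psi> x + t * \<Psi> y"
    using 1 t by (intro add_mono mult_left_mono) auto
  then show "\<Psi> ?z \<le> (1 - t) * \<Psi> x + t * \<Psi> y" by (simp add: algebra_simps inner_diff_right)
qed simp

lemma attains_inf_if_quadratic_growth:
  fixes f :: "'a::euclidean_space \<Rightarrow> real"
  assumes cont: "continuous_on UNIV f" and "k > 0" and growth: "\<And>x. k * (norm x)\<^sup>2 - b * norm x - a \<le> f x"
  obtains x where "\<And>y. f x \<le> f y"
proof -
  \<comment> \<open>Outside the ball, norm y \<ge> 1 and k * norm y \<ge> |b| + |a| + |f 0|;
    multiplied by norm y, this makes the growth bound at least f 0.\<close>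
  define R where "R = (\<bar>b\<bar> + \<bar>a\<bar> + \<bar>f 0\<bar>) / k + 1"
  have R: "R \<ge> 1" using \<open>k > 0\<close> by (simp add: R_def)
  obtain x where x: "x \<in> cball 0 R" "\<And>y. y \<in> cball 0 R \<Longrightarrow> f x \<le> f y"
    using continuous_attains_inf[of "cball 0 R" f] continuous_on_subset[OF cont] R by auto
  have "f x \<le> f y" for y
  proof (cases "norm y \<le> R")
    case False
    then have y: "norm y \<ge> 1" "norm y > R" using R by auto
    have "k * (R - 1) \<le> k * norm y" using y \<open>k > 0\<close> by (intro mult_left_mono) auto
    then have "\<bar>b\<bar> + \<bar>a\<bar> + \<bar>f 0\<bar> \<le> k * norm y" using \<open>k > 0\<close> by (simp add: R_def)
    then have "norm y * (\<bar>b\<bar> + \<bar>a\<bar> + \<bar>f 0\<bar>) \<le> norm y * (k * norm y)" by (intro mult_left_mono) auto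
    moreover have "\<bar>a\<bar> * 1 \<le> \<bar>a\<bar> * norm y" "\<bar>f 0\<bar> * 1 \<le> \<bar>f 0\<bar> * norm y" "b * norm y \<le> \<bar>b\<bar> * norm y"
      using y by (intro mult_left_mono mult_right_mono; simp)+
    ultimately have "f 0 \<le> k * (norm y)\<^sup>2 - b * norm y - a"
      by (simp add: power2_eq_square algebra_simps)
    also have "\<dots> \<le> f y" by (rule growth)
    finally show ?thesis using x(2)[of 0] R by simp
  qed (use x(2)[of y] in simp)
  then show thesis by (rule that)
qed

text \<open>The minimiser of \<open>\<lambda>x. \<Psi> x + (norm (x - z))\<^sup>2 / 2\<close>, given by its optimality condition.\<close>

definition prox :: "('a::euclidean_space \<Rightarrow> real) \<Rightarrow> 'a \<Rightarrow> 'a" where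
  "prox \<Psi> z = (SOME x. subgradient \<Psi> x (z - x))"

lemma subgradient_if_minimizer:
  fixes \<Psi> :: "'a::real_inner \<Rightarrow> real"
  assumes "convex_on UNIV \<Psi>" and min: "\<And>y. \<Psi> x + (norm (x - z))\<^sup>2 / 2 \<le> \<Psi> y + (norm (y - z))\<^sup>2 / 2"
  shows "subgradient \<Psi> x (z - x)"
  unfolding subgradient_def
proof
  fix y
  show "\<Psi> x + (z - x) \<bullet> (y - x) \<le> \<Psi> y"
  proof (rule field_le_epsilon)
    fix e :: real assume "e > 0"
    \<comment> \<open>Along the segment from x to y the gain is of first order in t and the
      quadratic correction of second order. This t brings the correction, after division by t, below
      e; the cap 1/2 keeps t < 1.\<close>
    define t where "t = min (1/2) (e / ((norm (y - x))\<^sup>2 + 1))"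
    have pos: "(norm (y - x))\<^sup>2 + 1 > 0" by (simp add: add_nonneg_pos)
    have t: "0 < t" "t < 1" using \<open>e > 0\<close> pos by (auto simp: t_def)
    have "t * (norm (y - x))\<^sup>2 \<le> e / ((norm (y - x))\<^sup>2 + 1) * ((norm (y - x))\<^sup>2 + 1)"
      using \<open>e > 0\<close> pos by (intro mult_mono) (auto simp: t_def)
    then have te: "t * (norm (y - x))\<^sup>2 \<le> e" using pos by simp
    let ?w = "(1 - t) *\<^sub>R x + t *\<^sub>R y"
    have w: "?w - z = (x - z) + t *\<^sub>R (y - x)" by (simp add: algebra_simps)
    have nw: "(norm (?w - z))\<^sup>2 = (norm (x - z))\<^sup>2 + 2 * t * ((x - z) \<bullet> (y - x)) + t\<^sup>2 * (norm (y - x))\<^sup>2"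
      unfolding w power2_norm_eq_inner
      by (simp add: inner_add_left inner_add_right inner_commute power2_eq_square algebra_simps)
    have "\<Psi> ?w \<le> (1 - t) * \<Psi> x + t * \<Psi> y"
      using convex_onD[OF assms(1), of t x y] t by simp
    with min[of ?w] nw have "0 \<le> t * (\<Psi> y - \<Psi> x + (x - z) \<bullet> (y - x) + t * (norm (y - x))\<^sup>2 / 2)"
      by (simp add: algebra_simps power2_eq_square)
    then have "0 \<le> \<Psi> y - \<Psi> x + (x - z) \<bullet> (y - x) + t * (norm (y - x))\<^sup>2 / 2"
      using t by (simp add: zero_le_mult_iff)
    moreover have "(x - z) \<bullet> (y - x) = - ((z - x) \<bullet> (y - x))" by (simp add: inner_diff_left)
    moreover have "t * (norm (y - x))\<^sup>2 / 2 \<le> e" using te \<open>e > 0\<close> by simp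
    ultimately show "\<Psi> x + (z - x) \<bullet> (y - x) \<le> \<Psi> y + e" by linarith
  qed
qed

text \<open>Linear growth of \<Psi> is dominated by the square, so a minimiser exists and the choice
  in \<open>prox\<close> is not vacuous.\<close>

lemma subgradient_prox:
  fixes \<Psi> :: "'a::euclidean_space \<Rightarrow> real"
  assumes "convex_on UNIV \<Psi>" and lin: "\<And>x. \<bar>\<Psi> x\<bar> \<le> a + b * norm x"
  shows "subgradient \<Psi> (prox \<Psi> z) (z - prox \<Psi> z)"
proof -
  have cont: "continuous_on UNIV \<Psi>" using assms(1) by (intro convex_on_continuous) auto
  have "1/2 * (norm x)\<^sup>2 - (b + norm z) * norm x - a \<le> \<Psi> x + (norm (x - z))\<^sup>2 / 2" for x
  proof -
    have "(norm (x - z))\<^sup>2 = (norm x)\<^sup>2 - 2 * (x \<bullet> z) + (norm z)\<^sup>2"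
      unfolding power2_norm_eq_inner by (simp add: inner_diff_left inner_diff_right inner_commute)
    moreover have "x \<bullet> z \<le> norm x * norm z" by (rule norm_cauchy_schwarz)
    moreover have "0 \<le> (norm z)\<^sup>2" by simp
    moreover have "(b + norm z) * norm x = b * norm x + norm x * norm z" by (simp add: algebra_simps)
    ultimately show ?thesis using lin[of x] by linarith
  qed
  moreover have "continuous_on UNIV (\<lambda>x. \<Psi> x + (norm (x - z))\<^sup>2 / 2)"
    by (intro continuous_intros cont) auto
  ultimately obtain x where "\<And>y. \<Psi> x + (norm (x - z))\<^sup>2 / 2 \<le> \<Psi> y + (norm (y - z))\<^sup>2 / 2"
    using attains_inf_if_quadratic_growth[of "\<lambda>x. \<Psi> x + (norm (x - z))\<^sup>2 / 2" "1/2" "b + norm z" a]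
    by (metis half_gt_zero_iff zero_less_one)
  then have "subgradient \<Psi> x (z - x)" using subgradient_if_minimizer[OF assms(1)] by blast
  then show ?thesis unfolding prox_def by (rule someI)
qed

text \<open>Monotonicity of subgradients gives uniqueness. Hence \<open>prox\<close> is known at x +
  g as soon as g is a subgradient at x, which is how all its values are computed below.\<close>

lemma prox_eqI:
  fixes \<Psi> :: "'a::euclidean_space \<Rightarrow> real"
  assumes "subgradient \<Psi> x (z - x)"
  shows "prox \<Psi> z = x"
proof -
  have "subgradient \<Psi> (prox \<Psi> z) (z - prox \<Psi> z)" unfolding prox_def using assms by (rule someI)
  from subgradient_monotone[OF this assms] have "(norm (x - prox \<Psi> z))\<^sup>2 \<le> 0"
    unfolding power2_norm_eq_inner by (simp add: inner_diff_left inner_diff_right inner_commute)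
  then show ?thesis by simp
qed

lemma prox_nonexpansive:
  fixes \<Psi> :: "'a::euclidean_space \<Rightarrow> real"
  assumes "\<And>z. subgradient \<Psi> (prox \<Psi> z) (z - prox \<Psi> z)"
  shows "norm (prox \<Psi> z - prox \<Psi> z') \<le> norm (z - z')"
proof -
  let ?d = "prox \<Psi> z - prox \<Psi> z'"
  have "0 \<le> ((z - prox \<Psi> z) - (z' - prox \<Psi> z')) \<bullet> ?d" by (rule subgradient_monotone[OF assms assms])
  then have "(norm ?d)\<^sup>2 \<le> (z - z') \<bullet> ?d"
    unfolding power2_norm_eq_inner by (simp add: inner_diff_left inner_diff_right inner_commute)
  also have "\<dots> \<le> norm (z - z') * norm ?d" by (rule norm_cauchy_schwarz)
  finally have "norm ?d * norm ?d \<le> norm (z - z') * norm ?d" by (simp add: power2_eq_square)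
  then show ?thesis by (cases "norm ?d = 0") (auto simp: mult_le_cancel_right)
qed

text \<open>A Riemann sum argument: s is any selection of subgradients along a segment, so it need
  not be continuous. On each of n equal steps the increment of \<psi> lies between the left and
  right values of s times the step, and summing the nearly affine values gives \<beta>/2 up to
  \<beta>/(2n).\<close>

lemma second_order_increment:
  fixes \<psi> s :: "real \<Rightarrow> real"
  assumes sub: "\<And>t \<tau>. t \<in> {0..1} \<Longrightarrow> \<tau> \<in> {0..1} \<Longrightarrow> \<psi> t + s t * (\<tau> - t) \<le> \<psi> \<tau>"
    and s: "\<And>t. t \<in> {0..1} \<Longrightarrow> \<bar>s t - \<alpha> - \<beta> * t\<bar> \<le> e"
  shows "\<bar>\<psi> 1 - \<psi> 0 - \<alpha> - \<beta> / 2\<bar> \<le> e"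
proof -
  have e: "0 \<le> e" using s[of 0] by simp
  have key: "\<bar>\<psi> 1 - \<psi> 0 - \<alpha> - \<beta> / 2\<bar> \<le> e + \<bar>\<beta>\<bar> / (2 * N)" if N: "N > 0" "N = real n" for n N
  proof -
    \<comment> \<open>The left endpoints sum to k (k - 1) / 2 and the right endpoints to k (k + 1) /
      2, which explains the two different quadratic terms.\<close>
    have ind: "real k * \<alpha> / N + \<beta> * real k * (real k - 1) / (2 * N\<^sup>2) - real k * e / N \<le> \<psi> (real k / N) - \<psi> 0 \<and>
       \<psi> (real k / N) - \<psi> 0 \<le> real k * \<alpha> / N + \<beta> * real k * (real k + 1) / (2 * N\<^sup>2) + real k * e / N"
      if "k \<le> n" for k
      using that
    proof (induction k)
      case (Suc k)
      let ?t = "real k / N" and ?t' = "real (Suc k) / N"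
      have tt: "?t \<in> {0..1}" "?t' \<in> {0..1}" using Suc.prems N by auto
      have d: "?t' - ?t = 1 / N" "?t - ?t' = - (1 / N)" using N by (simp_all add: field_simps)
      have "\<psi> ?t + s ?t * (1 / N) \<le> \<psi> ?t'" "\<psi> ?t' - s ?t' * (1 / N) \<le> \<psi> ?t"
        using sub[OF tt] sub[OF tt(2,1)] by (simp_all only: d)
      moreover have "(\<alpha> + \<beta> * ?t - e) * (1 / N) \<le> s ?t * (1 / N)" "s ?t' * (1 / N) \<le> (\<alpha> + \<beta> * ?t' + e) * (1 / N)"
        using s[OF tt(1)] s[OF tt(2)] N by (intro mult_right_mono; simp add: abs_le_iff)+
      ultimately have step: "(\<alpha> + \<beta> * ?t - e) * (1 / N) \<le> \<psi> ?t' - \<psi> ?t" "\<psi> ?t' - \<psi> ?t \<le> (\<alpha> + \<beta> * ?t' + e) * (1 / N)"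
        by linarith+
      have e1: "real (Suc k) * \<alpha> / N + \<beta> * real (Suc k) * (real (Suc k) - 1) / (2 * N\<^sup>2) - real (Suc k) * e / N
         = (real k * \<alpha> / N + \<beta> * real k * (real k - 1) / (2 * N\<^sup>2) - real k * e / N) + (\<alpha> + \<beta> * ?t - e) * (1 / N)"
        using N(1) by (simp add: field_simps power2_eq_square)
      have e2: "real (Suc k) * \<alpha> / N + \<beta> * real (Suc k) * (real (Suc k) + 1) / (2 * N\<^sup>2) + real (Suc k) * e / N
         = (real k * \<alpha> / N + \<beta> * real k * (real k + 1) / (2 * N\<^sup>2) + real k * e / N) + (\<alpha> + \<beta> * ?t' + e) * (1 / N)"
        using N(1) by (simp add: field_simps power2_eq_square)
      have IH: "real k * \<alpha> / N + \<beta> * real k * (real k - 1) / (2 * N\<^sup>2) - real k * e / N \<le> \<psi> ?t - \<psi> 0"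
        "\<psi> ?t - \<psi> 0 \<le> real k * \<alpha> / N + \<beta> * real k * (real k + 1) / (2 * N\<^sup>2) + real k * e / N"
        using Suc by auto
      show ?case unfolding e1 e2 using step IH by (intro conjI) linarith+
    qed simp
    have "N * \<alpha> / N = \<alpha>" "N * e / N = e" "\<beta> * N * (N - 1) / (2 * N\<^sup>2) = \<beta> / 2 - \<beta> / (2 * N)"
      "\<beta> * N * (N + 1) / (2 * N\<^sup>2) = \<beta> / 2 + \<beta> / (2 * N)"
      using N(1) by (simp_all add: field_simps power2_eq_square)
    moreover have "N / N = 1" using N by simp
    ultimately have "\<alpha> + (\<beta> / 2 - \<beta> / (2 * N)) - e \<le> \<psi> 1 - \<psi> 0"
      "\<psi> 1 - \<psi> 0 \<le> \<alpha> + (\<beta> / 2 + \<beta> / (2 * N)) + e"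
      using ind[OF order_refl] N(2) by simp_all
    moreover have "\<beta> / (2 * N) \<le> \<bar>\<beta>\<bar> / (2 * N)" "- \<beta> / (2 * N) \<le> \<bar>\<beta>\<bar> / (2 * N)"
      using N(1) by (intro divide_right_mono; simp)+
    ultimately show ?thesis by (simp add: abs_le_iff)
  qed
  have "(\<lambda>n. e + \<bar>\<beta>\<bar> / 2 * inverse (real (Suc n))) \<longlonglongrightarrow> e + \<bar>\<beta>\<bar> / 2 * 0"
    by (intro tendsto_intros LIMSEQ_inverse_real_of_nat)
  moreover have "\<bar>\<psi> 1 - \<psi> 0 - \<alpha> - \<beta> / 2\<bar> \<le> e + \<bar>\<beta>\<bar> / 2 * inverse (real (Suc n))" for n
    using key[of "real (Suc n)" "Suc n"] by (simp only: divide_inverse inverse_mult_distrib mult.assoc)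
  ultimately show ?thesis by (intro LIMSEQ_le_const[where a="\<bar>\<psi> 1 - \<psi> 0 - \<alpha> - \<beta> / 2\<bar>"]) auto
qed

text \<open>\<open>B\<close> is a map because it arises as the inverse of a derivative minus the
  identity. Only its quadratic form enters; symmetry is restored later by
  \<open>symmetric_matrix_of_quadratic_form\<close>.\<close>

definition second_order_expansion :: "('a::real_inner \<Rightarrow> real) \<Rightarrow> 'a \<Rightarrow> 'a \<Rightarrow> ('a \<Rightarrow> 'a) \<Rightarrow> bool" where
  "second_order_expansion \<Psi> x g B \<longleftrightarrow>
    (\<forall>e>0. \<exists>r>0. \<forall>h. norm h < r \<longrightarrow> \<bar>\<Psi> (x + h) - \<Psi> x - g \<bullet> h - (h \<bullet> B h) / 2\<bar> \<le> e * (norm h)\<^sup>2)"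

text \<open>Compare the two affine minorants with the paraboloid at \<open>x' + (g' - g) / (2 K)\<close>.\<close>

lemma subgradient_Lipschitz_at_touching_point:
  fixes \<Psi> :: "'a::real_inner \<Rightarrow> real"
  assumes "subgradient \<Psi> x g" "subgradient \<Psi> x' g'" "K > 0"
    and up: "\<And>h. \<Psi> (x + h) \<le> \<Psi> x + g \<bullet> h + K / 2 * (norm h)\<^sup>2"
  shows "norm (g' - g) \<le> 2 * K * norm (x' - x)"
proof -
  define G where "G = g' - g"
  define y where "y = x' + (1 / (2 * K)) *\<^sub>R G"
  have "\<Psi> x + g \<bullet> (x' - x) + g' \<bullet> (y - x') \<le> \<Psi> y"
    using subgradientD[OF assms(1), of x'] subgradientD[OF assms(2), of y] by linarith
  also have "\<Psi> y \<le> \<Psi> x + g \<bullet> (y - x) + K / 2 * (norm (y - x))\<^sup>2"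
    using up[of "y - x"] by simp
  finally have "G \<bullet> (y - x') \<le> K / 2 * (norm (y - x))\<^sup>2"
    by (simp add: G_def inner_diff_left inner_diff_right)
  moreover have "G \<bullet> (y - x') = (norm G)\<^sup>2 / (2 * K)"
    by (simp add: y_def power2_norm_eq_inner)
  moreover have "(norm (y - x))\<^sup>2 \<le> (norm (x' - x) + norm G / (2 * K))\<^sup>2"
  proof (rule power_mono)
    have yx: "y - x = (x' - x) + (1 / (2 * K)) *\<^sub>R G" by (simp add: y_def)
    show "norm (y - x) \<le> norm (x' - x) + norm G / (2 * K)"
      unfolding yx using norm_triangle_ineq[of "x' - x" "(1 / (2 * K)) *\<^sub>R G"] \<open>K > 0\<close> by simp
  qed simp
  ultimately have "(norm G)\<^sup>2 / (2 * K) \<le> K / 2 * (norm (x' - x) + norm G / (2 * K))\<^sup>2"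
    using \<open>K > 0\<close> by (smt (verit) mult_left_mono divide_nonneg_pos)
  \<comment> \<open>With a = norm G / (2 K) the inequality reads (2 a)^2 \<le> (norm (x' - x) +
    a)^2, hence a \<le> norm (x' - x).\<close>
  then have "K / 2 * (2 * (norm G / (2 * K)))\<^sup>2 \<le> K / 2 * (norm (x' - x) + norm G / (2 * K))\<^sup>2"
    using \<open>K > 0\<close> by (simp add: power2_eq_square)
  moreover define a where "a = norm G / (2 * K)"
  ultimately have "K / 2 * (2 * a)\<^sup>2 \<le> K / 2 * (norm (x' - x) + a)\<^sup>2" by simp
  then have "(2 * a)\<^sup>2 \<le> (norm (x' - x) + a)\<^sup>2" using \<open>K > 0\<close> by (simp add: mult_le_cancel_left_pos)
  then have "2 * a \<le> norm (x' - x) + a"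
    by (rule power2_le_imp_le) (use \<open>K > 0\<close> in \<open>simp add: a_def\<close>)
  moreover have "norm G = 2 * K * a" using \<open>K > 0\<close> by (simp add: a_def)
  ultimately show ?thesis using \<open>K > 0\<close> by (simp add: G_def)
qed

text \<open>\<open>prox\<close> inverts the identity plus the subdifferential, so with S a left
  inverse of D, every subgradient g' at x + k satisfies g' - g = S k - k + o(|k|). Integrating this
  along segments gives the expansion with B = S - id.\<close>

lemma second_order_expansion_if_prox_differentiable:
  fixes \<Psi> :: "'a::euclidean_space \<Rightarrow> real"
  assumes sub: "\<And>y. \<exists>h. subgradient \<Psi> y h" and subp: "\<And>z. subgradient \<Psi> (prox \<Psi> z) (z - prox \<Psi> z)"
    and g: "subgradient \<Psi> x g" and K: "K > 0"
    and up: "\<And>h. \<Psi> (x + h) \<le> \<Psi> x + g \<bullet> h + K / 2 * (norm h)\<^sup>2"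
    and D: "(prox \<Psi> has_derivative D) (at (x + g))"
  obtains B where "linear B" "second_order_expansion \<Psi> x g B"
proof -
  \<comment> \<open>2 K comes from \<open>subgradient_Lipschitz_at_touching_point\<close> and 1 from
    the identity part of z = prox z + (z - prox z).\<close>
  define C where "C = 2 * K + 1"
  have C: "C > 0" using K by (simp add: C_def)
  let ?J = "prox \<Psi>" and ?z = "x + g"
  have Jz: "?J ?z = x" by (rule prox_eqI) (simp add: g)
  have expand: "norm (z - ?z) \<le> C * norm (?J z - x)" for z
  proof -
    have "norm (z - ?J z - g) \<le> 2 * K * norm (?J z - x)"
      using subgradient_Lipschitz_at_touching_point[OF g subp K up] .
    moreover have "norm (z - ?z) \<le> norm (z - ?J z - g) + norm (?J z - x)"
      using norm_triangle_ineq[of "z - ?J z - g" "?J z - x"] by (simp add: algebra_simps)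
    ultimately show ?thesis by (simp add: C_def algebra_simps)
  qed
  have linD: "linear D" using D has_derivative_linear by blast
  have diffJ: "\<exists>d>0. \<forall>z. norm (z - ?z) < d \<longrightarrow> norm (?J z - x - D (z - ?z)) \<le> e * norm (z - ?z)" if "e > 0" for e
    using D that unfolding has_derivative_at_alt Jz by blast
  have "inj D"
  proof (rule linear_injective_0[THEN iffD2, OF linD], intro allI impI, rule ccontr)
    fix h assume h: "D h = 0" "h \<noteq> 0"
    \<comment> \<open>If D h = 0, the image of a small step along h moves at most by 1/(2 C) times
      the step, while \<open>expand\<close> demands at least 1/C times.\<close>
    obtain d where d: "d > 0" "\<And>z. norm (z - ?z) < d \<Longrightarrow> norm (?J z - x - D (z - ?z)) \<le> 1 / (2 * C) * norm (z - ?z)"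
      using diffJ[of "1 / (2 * C)"] C by auto
    define t where "t = d / (2 * norm h)"
    have t: "t > 0" using d h by (simp add: t_def)
    define z where "z = ?z + t *\<^sub>R h"
    have nz: "norm (z - ?z) = d / 2" using t d h by (simp add: z_def t_def)
    have D0: "D (z - ?z) = 0" using h linD by (simp add: z_def linear_cmul)
    have "norm (z - ?z) < d" using nz d(1) by simp
    from d(2)[OF this] have "norm (?J z - x) \<le> 1 / (2 * C) * norm (z - ?z)"
      unfolding D0 diff_zero .
    then have "C * norm (?J z - x) \<le> C * (1 / (2 * C) * norm (z - ?z))" using C by (intro mult_left_mono) auto
    also have "\<dots> = norm (z - ?z) / 2" using C by simp
    finally show False using expand[of z] nz d(1) by simp
  qed
  then obtain S where S: "linear S" "\<And>h. S (D h) = h"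
    using linear_injective_left_inverse[OF linD] by (auto simp: fun_eq_iff)
  obtain b where b: "b > 0" "\<And>h. norm (S h) \<le> b * norm h" using linear_bounded_pos[OF S(1)] by blast
  define B where "B h = S h - h" for h
  have linB: "linear B" unfolding B_def using S(1) by (intro linear_compose_sub linear_id[unfolded id_def])
  have "second_order_expansion \<Psi> x g B"
    unfolding second_order_expansion_def
  proof (intro allI impI)
    fix e :: real assume e: "e > 0"
    \<comment> \<open>C bounds the step in z by the step k, and b bounds S; their product is divided
      out in advance.\<close>
    define e1 where "e1 = e / (b * C)"
    have e1: "e1 > 0" using e b C by (simp add: e1_def)
    obtain d where d: "d > 0" "\<And>z. norm (z - ?z) < d \<Longrightarrow> norm (?J z - x - D (z - ?z)) \<le> e1 * norm (z - ?z)"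
      using diffJ[OF e1] by auto
    have near: "norm (g' - g - B k) \<le> e * norm k" if "norm k < d / C" and g': "subgradient \<Psi> (x + k) g'" for k g'
    proof -
      let ?z' = "x + k + g'"
      have J: "?J ?z' = x + k" by (rule prox_eqI) (simp add: g')
      have 1: "norm (?z' - ?z) \<le> C * norm k" using expand[of ?z'] J by simp
      also have "\<dots> < d" using that(1) C by (simp add: field_simps)
      finally have "norm (k - D (?z' - ?z)) \<le> e1 * norm (?z' - ?z)" using d(2)[of ?z'] J by simp
      also have "\<dots> \<le> e1 * (C * norm k)" using 1 e1 by (intro mult_left_mono) auto
      finally have 2: "norm (k - D (?z' - ?z)) \<le> e1 * (C * norm k)" .
      have "norm (S k - (?z' - ?z)) = norm (S (k - D (?z' - ?z)))"
        using S by (simp add: linear_diff)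
      also have "\<dots> \<le> b * (e1 * (C * norm k))"
        using b 2 by (intro order_trans[OF b(2)] mult_left_mono) auto
      also have "\<dots> = e * norm k" using b C by (simp add: e1_def)
      finally show ?thesis by (simp add: B_def norm_minus_commute algebra_simps)
    qed
    show "\<exists>r>0. \<forall>h. norm h < r \<longrightarrow> \<bar>\<Psi> (x + h) - \<Psi> x - g \<bullet> h - (h \<bullet> B h) / 2\<bar> \<le> e * (norm h)\<^sup>2"
    proof (rule exI[of _ "d / C"], intro conjI allI impI)
      fix h :: 'a assume h: "norm h < d / C"
      obtain s where s: "\<And>y. subgradient \<Psi> y (s y)" using sub by metis
      have "\<bar>\<Psi> (x + 1 *\<^sub>R h) - \<Psi> (x + 0 *\<^sub>R h) - g \<bullet> h - (h \<bullet> B h) / 2\<bar> \<le> e * (norm h)\<^sup>2"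
      proof (rule second_order_increment[of "\<lambda>t. \<Psi> (x + t *\<^sub>R h)" "\<lambda>t. s (x + t *\<^sub>R h) \<bullet> h" "g \<bullet> h" "h \<bullet> B h"])
        fix t \<tau> :: real
        have "x + \<tau> *\<^sub>R h - (x + t *\<^sub>R h) = (\<tau> - t) *\<^sub>R h" by (simp add: algebra_simps)
        with subgradientD[OF s, of "x + t *\<^sub>R h" "x + \<tau> *\<^sub>R h"]
        show "\<Psi> (x + t *\<^sub>R h) + s (x + t *\<^sub>R h) \<bullet> h * (\<tau> - t) \<le> \<Psi> (x + \<tau> *\<^sub>R h)"
          by (simp add: mult.commute)
      next
        fix t :: real assume t: "t \<in> {0..1}"
        have nt: "norm (t *\<^sub>R h) \<le> norm h" using t by (simp add: mult_left_le_one_le)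
        let ?v = "s (x + t *\<^sub>R h) - g - B (t *\<^sub>R h)"
        have "s (x + t *\<^sub>R h) \<bullet> h - g \<bullet> h - h \<bullet> B h * t = ?v \<bullet> h"
          unfolding linear_cmul[OF linB] by (simp add: inner_diff_left inner_commute[of h "B h"] mult.commute)
        then have "\<bar>s (x + t *\<^sub>R h) \<bullet> h - g \<bullet> h - h \<bullet> B h * t\<bar> \<le> norm ?v * norm h"
          using Cauchy_Schwarz_ineq2[of ?v h] by simp
        also have "\<dots> \<le> (e * norm (t *\<^sub>R h)) * norm h"
          using near[OF le_less_trans[OF nt h] s] by (intro mult_right_mono) auto
        also have "\<dots> \<le> (e * norm h) * norm h"
          using nt e by (intro mult_right_mono mult_left_mono) auto
        finally show "\<bar>s (x + t *\<^sub>R h) \<bullet> h - g \<bullet> h - h \<bullet> B h * t\<bar> \<le> e * (norm h)\<^sup>2"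
          by (simp add: power2_eq_square mult_ac)
      qed
      then show "\<bar>\<Psi> (x + h) - \<Psi> x - g \<bullet> h - (h \<bullet> B h) / 2\<bar> \<le> e * (norm h)\<^sup>2" by simp
    qed (use d C in simp)
  qed
  then show thesis using linB that by blast
qed

lemma touching_from_above:
  fixes \<Psi> :: "'a::real_inner \<Rightarrow> real"
  assumes Q: "linear Q" "\<And>x y. x \<bullet> Q y = Q x \<bullet> y"
    and max: "\<And>y. \<Psi> y - (y \<bullet> Q y) / 2 - p \<bullet> y \<le> \<Psi> x - (x \<bullet> Q x) / 2 - p \<bullet> x"
  shows "\<Psi> (x + h) \<le> \<Psi> x + (Q x + p) \<bullet> h + (h \<bullet> Q h) / 2"
proof -
  have "(x + h) \<bullet> Q (x + h) = x \<bullet> Q x + 2 * (Q x \<bullet> h) + h \<bullet> Q h"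
    using Q(2)[of x h] by (simp add: linear_add[OF Q(1)] inner_add_left inner_add_right inner_commute[of h "Q x"])
  then show ?thesis
    using max[of "x + h"] inner_add_right[of p x h] inner_add_left[of "Q x" p h] by argo
qed

text \<open>The selection m of maximisers has no regularity. What is used is a Lipschitz map P in
  the opposite direction, which recovers the slope p from the point \<open>?z p\<close>: if
  \<open>prox\<close> were nowhere differentiable on these points, the ball of slopes would be the
  Lipschitz image of a null set. Coercivity of Q provides a maximiser for every slope.\<close>

theorem Jensen_Alexandrov:
  fixes \<Psi> :: "'a::euclidean_space \<Rightarrow> real"
  assumes sub: "\<And>y. \<exists>h. subgradient \<Psi> y h" and growth: "\<And>x. \<bar>\<Psi> x\<bar> \<le> a + b * norm x"
    and Q: "linear Q" "\<And>x y. x \<bullet> Q y = Q x \<bullet> y" and \<kappa>: "\<kappa> > 0" "\<And>x. \<kappa> * (norm x)\<^sup>2 \<le> x \<bullet> Q x"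
    and "\<delta> > 0"
  obtains p x B where "norm p < \<delta>"
    "\<And>y. \<Psi> y - (y \<bullet> Q y) / 2 - p \<bullet> y \<le> \<Psi> x - (x \<bullet> Q x) / 2 - p \<bullet> x"
    "linear B" "second_order_expansion \<Psi> x (Q x + p) B"
proof -
  let ?w = "\<lambda>p y. \<Psi> y - (y \<bullet> Q y) / 2 - p \<bullet> y" and ?J = "prox \<Psi>"
  have conv: "convex_on UNIV \<Psi>" by (rule convex_on_if_subgradient[OF sub])
  have cont: "continuous_on UNIV \<Psi>" using conv by (intro convex_on_continuous) auto
  have subp: "subgradient \<Psi> (?J z) (z - ?J z)" for z by (rule subgradient_prox[OF conv growth])
  obtain K where K: "K > 0" "\<And>x. norm (Q x) \<le> K * norm x" using linear_bounded_pos[OF Q(1)] by blast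
  have contQ: "continuous_on UNIV Q" using Q(1) by (simp add: linear_continuous_on linear_conv_bounded_linear)
  have "\<exists>x. \<forall>y. ?w p y \<le> ?w p x" for p
  proof -
    have "\<kappa> / 2 * (norm x)\<^sup>2 - (b + norm p) * norm x - a \<le> - ?w p x" for x
    proof -
      have "- (p \<bullet> x) \<le> norm p * norm x" using norm_cauchy_schwarz[of "- p" x] by simp
      moreover have "(b + norm p) * norm x = b * norm x + norm p * norm x" by (simp add: algebra_simps)
      ultimately show ?thesis using growth[of x] \<kappa>(2)[of x] by linarith
    qed
    moreover have "continuous_on UNIV (\<lambda>x. - ?w p x)" by (intro continuous_intros cont contQ) auto
    ultimately obtain x where "\<And>y. - ?w p x \<le> - ?w p y"
      using attains_inf_if_quadratic_growth[of "\<lambda>x. - ?w p x" "\<kappa> / 2" "b + norm p" a] \<kappa>(1) by auto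
    then show ?thesis unfolding neg_le_iff_le by blast
  qed
  then obtain m where m: "\<And>p y. ?w p y \<le> ?w p (m p)" by metis
  have up1: "\<Psi> (m p + h) \<le> \<Psi> (m p) + (Q (m p) + p) \<bullet> h + (h \<bullet> Q h) / 2" for p h
    by (rule touching_from_above[OF Q m])
  have up: "\<Psi> (m p + h) \<le> \<Psi> (m p) + (Q (m p) + p) \<bullet> h + K / 2 * (norm h)\<^sup>2" for p h
  proof -
    have "h \<bullet> Q h \<le> norm h * (K * norm h)"
      by (rule order_trans[OF norm_cauchy_schwarz mult_left_mono[OF K(2)]]) simp
    then show ?thesis using up1[of p h] by (simp add: power2_eq_square mult_ac)
  qed
  have subm: "subgradient \<Psi> (m p) (Q (m p) + p)" for p
  proof -
    obtain g where g: "subgradient \<Psi> (m p) g" using sub by blast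
    \<comment> \<open>A paraboloid touching from above leaves only one subgradient: testing with the
      step v / K gives |v|^2 / K \<le> |v|^2 / (2 K).\<close>
    define v where "v = g - (Q (m p) + p)"
    have "\<Psi> (m p) + g \<bullet> ((1/K) *\<^sub>R v) \<le> \<Psi> (m p + (1/K) *\<^sub>R v)" using subgradientD[OF g, of "m p + (1/K) *\<^sub>R v"] by simp
    also have "\<dots> \<le> \<Psi> (m p) + (Q (m p) + p) \<bullet> ((1/K) *\<^sub>R v) + K / 2 * (norm ((1/K) *\<^sub>R v))\<^sup>2" by (rule up)
    finally have "g \<bullet> ((1/K) *\<^sub>R v) - (Q (m p) + p) \<bullet> ((1/K) *\<^sub>R v) \<le> K / 2 * (norm ((1/K) *\<^sub>R v))\<^sup>2"
      by linarith
    then have "v \<bullet> ((1/K) *\<^sub>R v) \<le> K / 2 * (norm ((1/K) *\<^sub>R v))\<^sup>2"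
      unfolding v_def inner_diff_left .
    then have "v \<bullet> v * 2 \<le> norm v * norm v"
      using K(1) by (simp add: power2_eq_square field_simps)
    then have "v \<bullet> v \<le> 0" by (simp add: dot_square_norm power2_eq_square)
    then have "v = 0" using inner_gt_zero_iff[of v] by linarith
    then show ?thesis using g by (simp add: v_def)
  qed
  let ?z = "\<lambda>p. m p + (Q (m p) + p)"
  have Jz: "?J (?z p) = m p" for p by (rule prox_eqI) (simp add: subm)
  \<comment> \<open>At z = \<open>?z p\<close> the proximal point is \<open>m p\<close>, and
    removing it together with its image under Q leaves exactly p.\<close>
  define P where "P z = z - ?J z - Q (?J z)" for z
  have Pz: "P (?z p) = p" for p by (simp add: P_def Jz)
  have Plip: "norm (P z - P z') \<le> (2 + K) * norm (z - z')" for z z'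
  proof -
    have J: "norm (?J z - ?J z') \<le> norm (z - z')" by (rule prox_nonexpansive[OF subp])
    have "P z - P z' = (z - z') - (?J z - ?J z') - Q (?J z - ?J z')"
      by (simp add: P_def linear_diff[OF Q(1)])
    then have "norm (P z - P z') \<le> norm (z - z') + norm (?J z - ?J z') + norm (Q (?J z - ?J z'))"
      using norm_triangle_ineq4[of "z - z' - (?J z - ?J z')" "Q (?J z - ?J z')"]
        norm_triangle_ineq4[of "z - z'" "?J z - ?J z'"] by simp
    also have "\<dots> \<le> norm (z - z') + norm (z - z') + K * norm (z - z')"
      using J K(1) by (intro add_mono order_trans[OF K(2)] mult_left_mono) auto
    finally show ?thesis by (simp add: algebra_simps)
  qed
  have "\<exists>p\<in>ball 0 \<delta>. ?J differentiable (at (?z p))"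
  proof (rule ccontr)
    assume "\<not> ?thesis"
    then have "?z ` ball 0 \<delta> \<subseteq> {z. \<not> ?J differentiable (at z)}" by auto
    moreover have "negligible {z. \<not> ?J differentiable (at z)}"
      by (rule Rademacher[where L=1]) (simp add: prox_nonexpansive[OF subp])
    ultimately have "negligible (?z ` ball 0 \<delta>)" using negligible_subset by blast
    then have "negligible (P ` (?z ` ball 0 \<delta>))"
      by (rule negligible_locally_Lipschitz_image[OF order_refl]) (use Plip in blast)
    moreover have "P ` (?z ` ball 0 \<delta>) = ball 0 \<delta>" using Pz by (simp add: image_image)
    ultimately show False using open_not_negligible[of "ball (0::'a) \<delta>"] \<open>\<delta> > 0\<close> by simp
  qed
  then obtain p D where p: "norm p < \<delta>" and D: "(?J has_derivative D) (at (?z p))"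
    unfolding differentiable_def by auto
  obtain B where "linear B" "second_order_expansion \<Psi> (m p) (Q (m p) + p) B"
    by (rule second_order_expansion_if_prox_differentiable[OF sub subp subm K(1) up D])
  then show thesis by (intro that[OF p m])
qed

section \<open>Quadratic test functions and semicontinuity\<close>

lemma has_derivative_quadratic:
  fixes B :: "'a::euclidean_space \<Rightarrow> 'a"
  assumes "linear B" and sym: "\<And>x y. x \<bullet> B y = B x \<bullet> y"
  shows "((\<lambda>z. c + q \<bullet> z + (z \<bullet> B z) / 2) has_derivative (\<lambda>v. (q \<bullet> v) + B x \<bullet> v)) (at x)"
proof -
  have "bounded_linear B" using assms(1) by (simp add: linear_conv_bounded_linear)
  then have "(B has_derivative B) (at x)" by (rule bounded_linear.has_derivative[OF _ has_derivative_ident])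
  from has_derivative_inner[OF has_derivative_ident this]
  have "((\<lambda>z. z \<bullet> B z / 2) has_derivative (\<lambda>v. (x \<bullet> B v + v \<bullet> B x) / 2)) (at x)"
    by (rule bounded_linear.has_derivative[OF bounded_linear_divide])
  from has_derivative_add[OF has_derivative_add[OF has_derivative_const
    has_derivative_inner_right[OF has_derivative_ident]] this]
  show ?thesis
    by (rule has_derivative_eq_rhs) (simp add: sym[of x] fun_eq_iff inner_commute[of _ "B x"])
qed

text \<open>The right-hand side is arranged to be affine in the base point x for fixed v, so that
  iterated derivatives stay within the class handled by the induction in
  \<open>Ck_on_quadratic\<close>.\<close>

lemma frechet_derivative_quadratic:
  fixes B :: "'a::euclidean_space \<Rightarrow> 'a"
  assumes "linear B" and sym: "\<And>x y. x \<bullet> B y = B x \<bullet> y"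
  shows "frechet_derivative (\<lambda>z. c + q \<bullet> z + (z \<bullet> B z) / 2) (at x) v = q \<bullet> v + B v \<bullet> x"
proof -
  have "B x \<bullet> v = B v \<bullet> x" using sym[of v x] by (simp add: inner_commute)
  then show ?thesis using frechet_derivative_at[OF has_derivative_quadratic[OF assms, of c q x]] by metis
qed

lemma Ck_on_quadratic:
  fixes B :: "'a::euclidean_space \<Rightarrow> 'a"
  assumes "linear B" "\<And>x y. x \<bullet> B y = B x \<bullet> y"
  shows "Ck_on k (\<lambda>z. c + q \<bullet> z + (z \<bullet> B z) / 2) S"
  using assms
proof (induction k arbitrary: c q B)
  case 0
  have "bounded_linear B" using 0(1) by (simp add: linear_conv_bounded_linear)
  from linear_continuous_on[OF this] show ?case by (auto intro!: continuous_intros)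
next
  case (Suc k)
  have "Ck_on k (\<lambda>x. frechet_derivative (\<lambda>z. c + q \<bullet> z + (z \<bullet> B z) / 2) (at x) v) S" for v
  proof -
    have "Ck_on k (\<lambda>z. q \<bullet> v + B v \<bullet> z + (z \<bullet> (\<lambda>_. 0) z) / 2) S"
      by (rule Suc.IH) (auto intro: linear_zero)
    then show ?thesis unfolding frechet_derivative_quadratic[OF Suc.prems] by simp
  qed
  moreover have "(\<lambda>z. c + q \<bullet> z + (z \<bullet> B z) / 2) differentiable_on S"
    unfolding differentiable_on_def
    using has_derivative_quadratic[OF Suc.prems] by (meson differentiable_def has_derivative_at_withinI)
  ultimately show ?case by simp
qed

lemma inner_matrix_symmetric:
  fixes X :: "real^'d^'d"
  assumes "transpose X = X"
  shows "a \<bullet> (X *v b) = (X *v a) \<bullet> b"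
  using dot_lmul_matrix[of a X b] assms by (metis transpose_matrix_vector)

lemma quadratic_test_function:
  fixes X :: "real^'d^'d" and q x :: "real^'d"
  assumes X: "transpose X = X"
  defines "\<phi> \<equiv> \<lambda>z. q \<bullet> (z - x) + ((z - x) \<bullet> (X *v (z - x))) / 2"
  shows "smooth_near y \<phi>" "gradient \<phi> x = q" "hessian \<phi> x = X"
proof -
  note sym = inner_matrix_symmetric[OF X]
  define c where "c = - (q \<bullet> x) + (x \<bullet> (X *v x)) / 2"
  define q' where "q' = q - X *v x"
  have \<phi>: "\<phi> = (\<lambda>z. c + q' \<bullet> z + (z \<bullet> (X *v z)) / 2)"
  proof
    fix z
    have "z \<bullet> (X *v x) = (X *v x) \<bullet> z" "x \<bullet> (X *v z) = (X *v x) \<bullet> z" using sym by (auto simp: inner_commute)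
    then show "\<phi> z = c + q' \<bullet> z + (z \<bullet> (X *v z)) / 2"
      by (simp add: \<phi>_def c_def q'_def matrix_vector_mult_diff_distrib inner_diff_left inner_diff_right field_simps)
  qed
  have lin: "linear ((*v) X)" by (rule matrix_vector_mul_linear)
  show "smooth_near y \<phi>"
    unfolding smooth_near_def \<phi> using Ck_on_quadratic[OF lin sym] by (intro exI[of _ UNIV]) auto
  have g: "gradient \<phi> z = q' + X *v z" for z
  proof -
    have "(X *v axis i 1) \<bullet> z = (X *v z) $ i" for i
      using sym[of "axis i 1" z] by (simp add: inner_axis')
    then show ?thesis
      unfolding gradient_def \<phi> frechet_derivative_quadratic[OF lin sym]
      by (simp add: vec_eq_iff inner_axis)
  qed
  then show "gradient \<phi> x = q" by (simp add: q'_def)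
  show "hessian \<phi> x = X"
  proof -
    have "frechet_derivative (\<lambda>z. gradient \<phi> z $ j) (at x) (axis i 1) = X $ i $ j" for i j
    proof -
      have "((\<lambda>z. (q' + X *v z) $ j) has_derivative (\<lambda>v. (X *v v) $ j)) (at x)"
        by (rule has_derivative_eq_rhs, (rule derivative_intros bounded_linear.has_derivative[OF bounded_linear_vec_nth]
           bounded_linear.has_derivative[OF matrix_vector_mul_bounded_linear])+) simp
      then have "frechet_derivative (\<lambda>z. gradient \<phi> z $ j) (at x) = (\<lambda>v. (X *v v) $ j)"
        unfolding g by (rule frechet_derivative_at[symmetric])
      then have "frechet_derivative (\<lambda>z. gradient \<phi> z $ j) (at x) (axis i 1) = X $ j $ i"
        by (simp add: matrix_vector_mult_basis column_def)
      also have "\<dots> = transpose X $ i $ j" by (simp add: transpose_def)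
      finally show ?thesis using X by simp
    qed
    then show ?thesis by (simp add: hessian_def vec_eq_iff)
  qed
qed

lemma viscosity_le_quadratic:
  fixes X :: "real^'d^'d"
  assumes "viscosity_le A H c U u" "x \<in> U" "transpose X = X"
    and "\<forall>\<^sub>F z in at x within U. u z \<le> u x + q \<bullet> (z - x) + ((z - x) \<bullet> (X *v (z - x))) / 2"
  shows "- trace (A x ** X) + H q x \<le> c"
proof -
  let ?\<phi> = "\<lambda>z. q \<bullet> (z - x) + ((z - x) \<bullet> (X *v (z - x))) / 2"
  note t = quadratic_test_function[OF assms(3), where q=q and x=x]
  have "\<forall>\<^sub>F z in at x within U. u z - ?\<phi> z \<le> u x - ?\<phi> x"
    using assms(4) by (rule eventually_mono) simp
  then have "- trace (A x ** hessian ?\<phi> x) + H (gradient ?\<phi> x) x \<le> c"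
    using assms(1,2) t(1) unfolding viscosity_le_def by blast
  then show ?thesis unfolding t(2,3) .
qed

lemma viscosity_ge_quadratic:
  fixes X :: "real^'d^'d"
  assumes "viscosity_ge A H c U v" "x \<in> U" "transpose X = X"
    and "\<forall>\<^sub>F z in at x within U. v z \<ge> v x + q \<bullet> (z - x) + ((z - x) \<bullet> (X *v (z - x))) / 2"
  shows "- trace (A x ** X) + H q x \<ge> c"
proof -
  let ?\<phi> = "\<lambda>z. q \<bullet> (z - x) + ((z - x) \<bullet> (X *v (z - x))) / 2"
  note t = quadratic_test_function[OF assms(3), where q=q and x=x]
  have "\<forall>\<^sub>F z in at x within U. v z - ?\<phi> z \<ge> v x - ?\<phi> x"
    using assms(4) by (rule eventually_mono) simp
  then have "- trace (A x ** hessian ?\<phi> x) + H (gradient ?\<phi> x) x \<ge> c"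
    using assms(1,2) t(1) unfolding viscosity_ge_def by blast
  then show ?thesis unfolding t(2,3) .
qed

text \<open>Written through the rows of S, the trace is a sum of values of the quadratic form of X,
  so an inequality between quadratic forms can be applied row by row.\<close>

lemma trace_diffusion:
  fixes S :: "real^'d^'n" and X :: "real^'d^'d"
  shows "trace (((1/2) *\<^sub>R (transpose S ** S)) ** X) = (\<Sum>i\<in>UNIV. S $ i \<bullet> (X *v S $ i)) / 2"
proof -
  have "trace (((1/2) *\<^sub>R (transpose S ** S)) ** X)
     = (\<Sum>j\<in>UNIV. \<Sum>k\<in>UNIV. \<Sum>i\<in>UNIV. S$i$j * (X$k$j * S$i$k)) / 2"
    by (simp add: trace_def matrix_matrix_mult_def transpose_def sum_distrib_left sum_distrib_right sum_divide_distrib mult_ac)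
  also have "(\<Sum>j\<in>UNIV. \<Sum>k\<in>UNIV. \<Sum>i\<in>UNIV. S$i$j * (X$k$j * S$i$k)) = (\<Sum>i\<in>UNIV. \<Sum>k\<in>UNIV. \<Sum>j\<in>UNIV. S$i$j * (X$k$j * S$i$k))"
    by (subst sum.swap, subst (2) sum.swap, subst sum.swap, subst (2) sum.swap) (rule sum.swap)
  also have "\<dots> = (\<Sum>i\<in>UNIV. S $ i \<bullet> (X *v S $ i))"
    by (simp add: inner_vec_def matrix_vector_mult_def sum_distrib_left mult_ac)
  finally show ?thesis .
qed

lemma norm_matrix_rows: "(norm (S :: real^'d^'n))\<^sup>2 = (\<Sum>i\<in>UNIV. (norm (S $ i))\<^sup>2)"
  by (simp add: norm_vec_def L2_set_def sum_nonneg)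

section \<open>Upper semicontinuous functions\<close>

lemma usc_on_add_continuous:
  assumes "usc_on S f" "continuous_on S g"
  shows "usc_on S (\<lambda>x. f x + (g x :: real))"
  unfolding usc_on_def
proof (intro ballI allI impI)
  fix x a assume x: "x \<in> S" and a: "f x + g x < a"
  define e where "e = (a - (f x + g x)) / 2"
  have e: "e > 0" using a by (simp add: e_def)
  have "\<forall>\<^sub>F y in at x within S. f y < f x + e" using assms(1) x e by (auto simp: usc_on_def)
  moreover have "\<forall>\<^sub>F y in at x within S. dist (g y) (g x) < e"
    using assms(2) x e unfolding continuous_on by (blast intro: tendstoD)
  ultimately show "\<forall>\<^sub>F y in at x within S. f y + g y < a"
  proof eventually_elim
    fix y assume "f y < f x + e" "dist (g y) (g x) < e"
    then show "f y + g y < a" unfolding e_def dist_real_def by argo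
  qed
qed

lemma usc_on_cmult:
  assumes "usc_on S f" "0 \<le> (c::real)"
  shows "usc_on S (\<lambda>x. c * f x)"
  unfolding usc_on_def
proof (intro ballI allI impI)
  fix x a assume x: "x \<in> S" and a: "c * f x < a"
  show "\<forall>\<^sub>F y in at x within S. c * f y < a"
  proof (cases "c = 0")
    case False
    then have "f x < a / c" using a assms(2) by (simp add: field_simps)
    then have "\<forall>\<^sub>F y in at x within S. f y < a / c" using assms(1) x by (auto simp: usc_on_def)
    then show ?thesis by (rule eventually_mono) (use False assms(2) in \<open>simp add: field_simps\<close>)
  qed (use a in simp)
qed

lemma usc_on_add:
  assumes "usc_on S f" "usc_on S g"
  shows "usc_on S (\<lambda>x. f x + (g x :: real))"
  unfolding usc_on_def
proof (intro ballI allI impI)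
  fix x a assume x: "x \<in> S" and a: "f x + g x < a"
  define e where "e = (a - (f x + g x)) / 2"
  have e: "e > 0" using a by (simp add: e_def)
  have "\<forall>\<^sub>F y in at x within S. f y < f x + e" "\<forall>\<^sub>F y in at x within S. g y < g x + e"
    using assms x e by (auto simp: usc_on_def)
  then show "\<forall>\<^sub>F y in at x within S. f y + g y < a"
  proof eventually_elim
    fix y assume "f y < f x + e" "g y < g x + e"
    then show "f y + g y < a" unfolding e_def by argo
  qed
qed

text \<open>Were there no maximum, each x would have a neighbourhood on which f stays below some
  value f (y x). In a finite subcover, the largest of these values is itself exceeded.\<close>

lemma usc_on_attains_sup:
  fixes f :: "'a::topological_space \<Rightarrow> real"
  assumes "usc_on K f" "compact K" "K \<noteq> {}"
  shows "\<exists>x\<in>K. \<forall>y\<in>K. f y \<le> f x"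
proof (rule ccontr)
  assume "\<not> ?thesis"
  then have no: "\<exists>y\<in>K. f x < f y" if "x \<in> K" for x using that by (meson not_le)
  have "\<exists>V y. open V \<and> x \<in> V \<and> y \<in> K \<and> (\<forall>z\<in>V \<inter> K. f z < f y)" if "x \<in> K" for x
  proof -
    obtain y where y: "y \<in> K" "f x < f y" using no \<open>x \<in> K\<close> by blast
    then have "\<forall>\<^sub>F z in at x within K. f z < f y" using assms(1) that by (auto simp: usc_on_def)
    then obtain V where "open V" "x \<in> V" "\<forall>z\<in>V. z \<noteq> x \<longrightarrow> z \<in> K \<longrightarrow> f z < f y"
      unfolding eventually_at_topological by blast
    then show ?thesis using y by (intro exI[of _ V] exI[of _ y]) auto
  qed
  then obtain V y where V: "\<And>x. x \<in> K \<Longrightarrow> open (V x) \<and> x \<in> V x \<and> y x \<in> K \<and> (\<forall>z\<in>V x \<inter> K. f z < f (y x))"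
    by metis
  obtain D where D: "D \<subseteq> K" "finite D" "K \<subseteq> (\<Union>x\<in>D. V x)"
    using compactE_image[OF assms(2), of K V] V by blast
  then have "D \<noteq> {}" using assms(3) by auto
  let ?m = "Max ((f \<circ> y) ` D)"
  have "?m \<in> (f \<circ> y) ` D" using D \<open>D \<noteq> {}\<close> by (intro Max_in) auto
  then obtain x where x: "x \<in> D" "f (y x) = ?m" by auto
  then have "y x \<in> K" using V D by auto
  then obtain x' where x': "x' \<in> D" "y x \<in> V x'" using D by auto
  then have "f (y x) < f (y x')" using V[of x'] D \<open>y x \<in> K\<close> by auto
  moreover have "f (y x') \<le> ?m" using D x' by (intro Max_ge) auto
  ultimately show False using x by simp
qed

section \<open>The theorem on sums and the Hamiltonian\<close>

text \<open>For g x = u x - \<kappa>/2 |x|^2, the sup-convolution of u, the maximum over x of u x -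
  \<kappa>/2 |x - \<xi>|^2, equals G \<xi> - \<kappa>/2 |\<xi>|^2. The affine functions under the
  maximum have slopes \<kappa> x with x in the compact K; this bounds the growth of G, and \<kappa>
  times a maximising point is a subgradient.\<close>

lemma sup_affine:
  fixes K :: "'a::euclidean_space set" and g :: "'a \<Rightarrow> real"
  assumes K: "compact K" "K \<noteq> {}" and g: "usc_on K g" and "\<kappa> > 0"
  obtains G a b where "\<And>\<xi>. \<exists>x\<in>K. G \<xi> = g x + \<kappa> * (x \<bullet> \<xi>)" "\<And>x \<xi>. x \<in> K \<Longrightarrow> g x + \<kappa> * (x \<bullet> \<xi>) \<le> G \<xi>"
    "\<And>\<xi>. \<exists>h. subgradient G \<xi> h"
    "\<And>\<xi>. \<bar>G \<xi>\<bar> \<le> a + b * norm \<xi>"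
proof -
  have "\<exists>x\<in>K. \<forall>y\<in>K. g y + \<kappa> * (y \<bullet> \<xi>) \<le> g x + \<kappa> * (x \<bullet> \<xi>)" for \<xi>
    by (rule usc_on_attains_sup[OF usc_on_add_continuous[OF g] K]) (intro continuous_intros)
  then obtain x where x: "\<And>\<xi>. x \<xi> \<in> K" "\<And>\<xi> y. y \<in> K \<Longrightarrow> g y + \<kappa> * (y \<bullet> \<xi>) \<le> g (x \<xi>) + \<kappa> * (x \<xi> \<bullet> \<xi>)"
    by metis
  define G where "G \<xi> = g (x \<xi>) + \<kappa> * (x \<xi> \<bullet> \<xi>)" for \<xi>
  have G1: "\<exists>x\<in>K. G \<xi> = g x + \<kappa> * (x \<bullet> \<xi>)" for \<xi> using x(1) by (auto simp: G_def)
  have G2: "g y + \<kappa> * (y \<bullet> \<xi>) \<le> G \<xi>" if "y \<in> K" for y \<xi> using x(2)[OF that] by (simp add: G_def)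
  have G3: "\<exists>h. subgradient G \<xi> h" for \<xi>
  proof -
    obtain z where z: "z \<in> K" "G \<xi> = g z + \<kappa> * (z \<bullet> \<xi>)" using G1 by blast
    have "subgradient G \<xi> (\<kappa> *\<^sub>R z)"
      unfolding subgradient_def
    proof
      fix y
      have "G \<xi> + (\<kappa> *\<^sub>R z) \<bullet> (y - \<xi>) = g z + \<kappa> * (z \<bullet> y)"
        using z(2) by (simp add: inner_diff_right algebra_simps)
      also have "\<dots> \<le> G y" by (rule G2[OF z(1)])
      finally show "G \<xi> + (\<kappa> *\<^sub>R z) \<bullet> (y - \<xi>) \<le> G y" .
    qed
    then show ?thesis ..
  qed
  obtain R where R: "\<And>y. y \<in> K \<Longrightarrow> norm y \<le> R" using compact_imp_bounded[OF K(1)] unfolding bounded_iff by auto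
  have inn: "\<bar>\<kappa> * (y \<bullet> \<xi>)\<bar> \<le> (\<kappa> * R) * norm \<xi>" if "y \<in> K" for y \<xi>
  proof -
    have "\<bar>\<kappa> * (y \<bullet> \<xi>)\<bar> = \<kappa> * \<bar>y \<bullet> \<xi>\<bar>" using \<open>\<kappa> > 0\<close> by (simp add: abs_mult)
    also have "\<dots> \<le> \<kappa> * (norm y * norm \<xi>)" using \<open>\<kappa> > 0\<close> by (intro mult_left_mono Cauchy_Schwarz_ineq2) auto
    also have "\<dots> \<le> \<kappa> * (R * norm \<xi>)" using \<open>\<kappa> > 0\<close> R[OF that] by (intro mult_left_mono mult_right_mono) auto
    finally show ?thesis by simp
  qed
  have gx: "g y \<le> g (x 0)" if "y \<in> K" for y using x(2)[of y 0] that by simp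
  have grow: "\<bar>G \<xi>\<bar> \<le> \<bar>g (x 0)\<bar> + (\<kappa> * R) * norm \<xi>" for \<xi>
    using G2[OF x(1)[of 0], of \<xi>] inn[OF x(1)[of 0], of \<xi>] inn[OF x(1)[of \<xi>], of \<xi>] gx[OF x(1)[of \<xi>]]
    unfolding G_def by linarith
  show thesis by (rule that[OF G1 G2 G3 grow])
qed

text \<open>Quadratic test functions need a symmetric Hessian, while the derivative of the proximal
  map is not shown to be symmetric. The symmetric part has the same quadratic form.\<close>

lemma symmetric_matrix_of_quadratic_form:
  fixes f :: "real^'d \<Rightarrow> real^'d"
  assumes "linear f"
  obtains X where "transpose X = X" "\<And>a. a \<bullet> (X *v a) = a \<bullet> f a"
proof
  define M where "M = matrix f"
  have M: "M *v a = f a" for a using assms by (simp add: M_def matrix_works)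
  show "transpose ((1/2) *\<^sub>R (M + transpose M)) = (1/2) *\<^sub>R (M + transpose M)"
    by (simp add: transpose_def vec_eq_iff)
  have "a \<bullet> (transpose M *v a) = a \<bullet> f a" for a
    using dot_lmul_matrix[of a M a] by (simp add: M inner_commute transpose_matrix_vector)
  then show "a \<bullet> (((1/2) *\<^sub>R (M + transpose M)) *v a) = a \<bullet> f a" for a
    by (simp add: scaleR_matrix_vector_assoc[symmetric] matrix_vector_mult_add_rdistrib inner_add_right M)
qed

lemma eventually_at_within_if_ball:
  fixes x :: "'a::real_normed_vector"
  assumes "r > 0" "\<And>h. norm h < r \<Longrightarrow> x + h \<in> S \<Longrightarrow> P (x + h)"
  shows "\<forall>\<^sub>F z in at x within S. P z"
  unfolding eventually_at
  using assms(1) assms(2)[of "z - x" for z] by (intro exI[of _ r]) (auto simp: dist_norm)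

text \<open>The Crandall-Ishii lemma with both sup-convolutions explicit; p1 and p2 are the price of
  having a second-order expansion at the maximiser itself. The diagonal blocks of that expansion lie
  below \<kappa> (|a|^2 + |b|^2 + |a - b|^2), and returning to u and v subtracts \<kappa> from each
  block. The margin e pays for turning expansions into one-sided quadratic bounds.\<close>

theorem theorem_on_sums:
  fixes K :: "(real^'d) set" and u v :: "real^'d \<Rightarrow> real"
  assumes K: "compact K" "K \<noteq> {}" and u: "usc_on K u" and v: "usc_on K (\<lambda>x. - v x)"
    and pos: "\<kappa> > 0" "\<delta> > 0" "e > 0"
  obtains p1 p2 x y \<xi> \<eta> X Y where "norm p1 < \<delta>" "norm p2 < \<delta>" "x \<in> K" "y \<in> K"
    "\<And>x' y' \<xi>' \<eta>'. x' \<in> K \<Longrightarrow> y' \<in> K \<Longrightarrow>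
      u x' - v y' - \<kappa> / 2 * ((norm (x' - \<xi>'))\<^sup>2 + (norm (y' - \<eta>'))\<^sup>2 + (norm (\<xi>' - \<eta>'))\<^sup>2) - p1 \<bullet> \<xi>' - p2 \<bullet> \<eta>'
      \<le> u x - v y - \<kappa> / 2 * ((norm (x - \<xi>))\<^sup>2 + (norm (y - \<eta>))\<^sup>2 + (norm (\<xi> - \<eta>))\<^sup>2) - p1 \<bullet> \<xi> - p2 \<bullet> \<eta>"
    "transpose X = X" "transpose Y = Y"
    "\<forall>\<^sub>F z in at x within K. u z \<le> u x + (\<kappa> *\<^sub>R (\<xi> - \<eta>) + p1) \<bullet> (z - x) + ((z - x) \<bullet> (X *v (z - x))) / 2"
    "\<forall>\<^sub>F z in at y within K. v z \<ge> v y + (\<kappa> *\<^sub>R (\<xi> - \<eta>) - p2) \<bullet> (z - y) + ((z - y) \<bullet> (Y *v (z - y))) / 2"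
    "\<And>a b. a \<bullet> (X *v a) - b \<bullet> (Y *v b) \<le> \<kappa> * (norm (a - b))\<^sup>2 + e * ((norm a)\<^sup>2 + (norm b)\<^sup>2)"
proof -
  have sq: "usc_on K (\<lambda>x. f x + - (\<kappa> / 2 * (norm x)\<^sup>2))" if "usc_on K f" for f
    by (rule usc_on_add_continuous[OF that]) (intro continuous_intros)
  obtain G a b where G: "\<And>\<xi>. \<exists>x\<in>K. G \<xi> = u x + - (\<kappa> / 2 * (norm x)\<^sup>2) + \<kappa> * (x \<bullet> \<xi>)"
    "\<And>x \<xi>. x \<in> K \<Longrightarrow> u x + - (\<kappa> / 2 * (norm x)\<^sup>2) + \<kappa> * (x \<bullet> \<xi>) \<le> G \<xi>"
    "\<And>\<xi>. \<exists>g. subgradient G \<xi> g" "\<And>\<xi>. \<bar>G \<xi>\<bar> \<le> a + b * norm \<xi>"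
    by (rule sup_affine[OF K sq[OF u] pos(1)]) blast
  obtain G' a' b' where G': "\<And>\<xi>. \<exists>x\<in>K. G' \<xi> = - v x + - (\<kappa> / 2 * (norm x)\<^sup>2) + \<kappa> * (x \<bullet> \<xi>)"
    "\<And>x \<xi>. x \<in> K \<Longrightarrow> - v x + - (\<kappa> / 2 * (norm x)\<^sup>2) + \<kappa> * (x \<bullet> \<xi>) \<le> G' \<xi>"
    "\<And>\<xi>. \<exists>g. subgradient G' \<xi> g" "\<And>\<xi>. \<bar>G' \<xi>\<bar> \<le> a' + b' * norm \<xi>"
    by (rule sup_affine[OF K sq[OF v] pos(1)]) blast
  define \<Psi> where "\<Psi> \<zeta> = G (fst \<zeta>) + G' (snd \<zeta>)" for \<zeta>
  \<comment> \<open>The form of Q / 2 collects what the penalty contains in \<xi> and \<eta> alone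
    once |x - \<xi>|^2 and |y - \<eta>|^2 are expanded; the mixed terms go into G and G'.\<close>
  define Q :: "(real^'d) \<times> (real^'d) \<Rightarrow> (real^'d) \<times> (real^'d)"
    where "Q \<zeta> = \<kappa> *\<^sub>R (fst \<zeta> + (fst \<zeta> - snd \<zeta>), snd \<zeta> + (snd \<zeta> - fst \<zeta>))" for \<zeta>
  have Qf: "(a, b) \<bullet> Q (a, b) = \<kappa> * ((norm a)\<^sup>2 + (norm b)\<^sup>2 + (norm (a - b))\<^sup>2)" for a b
  proof -
    have "(a, b) \<bullet> Q (a, b) = \<kappa> * (a \<bullet> (a + (a - b)) + b \<bullet> (b + (b - a)))"
      by (simp add: Q_def distrib_left)
    also have "a \<bullet> (a + (a - b)) + b \<bullet> (b + (b - a)) = (norm a)\<^sup>2 + (norm b)\<^sup>2 + (norm (a - b))\<^sup>2"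
      unfolding power2_norm_eq_inner inner_add_right inner_diff_right inner_diff_left
      by (simp add: inner_commute[of b a])
    finally show ?thesis .
  qed
  have linQ: "linear Q" unfolding Q_def
    by (intro linearI) (auto simp: prod_eq_iff algebra_simps)
  have symQ: "x \<bullet> Q y = Q x \<bullet> y" for x y
  proof -
    obtain a b where ab: "x = (a, b)" by (cases x)
    obtain c d where cd: "y = (c, d)" by (cases y)
    have "x \<bullet> Q y = \<kappa> * (a \<bullet> (c + (c - d)) + b \<bullet> (d + (d - c)))"
      by (simp add: Q_def ab cd distrib_left)
    also have "a \<bullet> (c + (c - d)) + b \<bullet> (d + (d - c)) = (a + (a - b)) \<bullet> c + (b + (b - a)) \<bullet> d"
      unfolding inner_add_right inner_diff_right inner_diff_left inner_add_left by simp
    also have "\<kappa> * \<dots> = Q x \<bullet> y" by (simp add: Q_def ab cd distrib_left)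
    finally show ?thesis .
  qed
  have coerQ: "\<kappa> * (norm x)\<^sup>2 \<le> x \<bullet> Q x" for x
  proof (cases x)
    case (Pair a b)
    have "(norm x)\<^sup>2 = (norm a)\<^sup>2 + (norm b)\<^sup>2" by (simp add: Pair norm_Pair)
    then show ?thesis using pos(1) unfolding Pair Qf by simp
  qed
  have sub: "\<exists>h. subgradient \<Psi> \<zeta> h" for \<zeta>
  proof -
    obtain g g' where "subgradient G (fst \<zeta>) g" "subgradient G' (snd \<zeta>) g'" using G(3) G'(3) by blast
    then have "subgradient \<Psi> \<zeta> (g, g')"
      unfolding subgradient_def \<Psi>_def by (auto simp: inner_prod_def) (smt (verit))
    then show ?thesis by blast
  qed
  have growth: "\<bar>\<Psi> \<zeta>\<bar> \<le> (\<bar>a\<bar> + \<bar>a'\<bar>) + (\<bar>b\<bar> + \<bar>b'\<bar>) * norm \<zeta>" for \<zeta>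
  proof -
    have "b * norm (fst \<zeta>) \<le> \<bar>b\<bar> * norm \<zeta>" "b' * norm (snd \<zeta>) \<le> \<bar>b'\<bar> * norm \<zeta>"
      using norm_fst_le[of "fst \<zeta>" "snd \<zeta>"] norm_snd_le[of "snd \<zeta>" "fst \<zeta>"] by (auto intro!: mult_mono)
    moreover have "(\<bar>b\<bar> + \<bar>b'\<bar>) * norm \<zeta> = \<bar>b\<bar> * norm \<zeta> + \<bar>b'\<bar> * norm \<zeta>" by (simp add: algebra_simps)
    ultimately show ?thesis using G(4)[of "fst \<zeta>"] G'(4)[of "snd \<zeta>"] unfolding \<Psi>_def by linarith
  qed
  obtain p \<zeta> B where p: "norm p < \<delta>"
    and max: "\<And>y. \<Psi> y - (y \<bullet> Q y) / 2 - p \<bullet> y \<le> \<Psi> \<zeta> - (\<zeta> \<bullet> Q \<zeta>) / 2 - p \<bullet> \<zeta>"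
    and B: "linear B" "second_order_expansion \<Psi> \<zeta> (Q \<zeta> + p) B"
    by (rule Jensen_Alexandrov[OF sub growth linQ symQ pos(1) coerQ pos(2)]) (rule that)
  obtain p1 p2 where pp: "p = (p1, p2)" by (cases p)
  obtain \<xi> \<eta> where \<zeta>: "\<zeta> = (\<xi>, \<eta>)" by (cases \<zeta>)
  obtain x where x: "x \<in> K" "G \<xi> = u x + - (\<kappa> / 2 * (norm x)\<^sup>2) + \<kappa> * (x \<bullet> \<xi>)" using G(1) by blast
  obtain y where y: "y \<in> K" "G' \<eta> = - v y + - (\<kappa> / 2 * (norm y)\<^sup>2) + \<kappa> * (y \<bullet> \<eta>)" using G'(1) by blast
  \<comment> \<open>The error enters four times: 2 e0 through \<open>block\<close> and 2 e0 through
    the shifts that define X and Y.\<close>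
  define e0 where "e0 = e / 4"
  have e0: "e0 > 0" using pos by (simp add: e0_def)
  obtain r where r: "r > 0" "\<And>h. norm h < r \<Longrightarrow>
      \<bar>\<Psi> (\<zeta> + h) - \<Psi> \<zeta> - (Q \<zeta> + p) \<bullet> h - (h \<bullet> B h) / 2\<bar> \<le> e0 * (norm h)\<^sup>2"
    using B(2) e0 unfolding second_order_expansion_def by meson
  \<comment> \<open>The parts \<kappa> \<xi> and \<kappa> \<eta> belong to the outer squares and
    disappear on return to u and v; the common slope \<kappa> (\<xi> - \<eta>) and the perturbation
    remain.\<close>
  define g where "g = \<kappa> *\<^sub>R \<xi> + \<kappa> *\<^sub>R (\<xi> - \<eta>) + p1"
  define g' where "g' = \<kappa> *\<^sub>R \<eta> - \<kappa> *\<^sub>R (\<xi> - \<eta>) + p2"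
  have Qp: "Q \<zeta> + p = (g, g')" by (simp add: Q_def \<zeta> pp g_def g'_def algebra_simps)
  \<comment> \<open>Since \<Psi> splits into G and G', increments in one variable only see the
    diagonal blocks of B. Mixed entries never enter.\<close>
  define F where "F a = fst (B (a, 0))" for a
  define F' where "F' b = snd (B (0, b))" for b
  have e1: "\<bar>G (\<xi> + a) - G \<xi> - g \<bullet> a - (a \<bullet> F a) / 2\<bar> \<le> e0 * (norm a)\<^sup>2" if "norm a < r" for a
    using r(2)[of "(a, 0)", unfolded Qp] that by (simp add: \<zeta> \<Psi>_def F_def inner_prod_def)
  have e2: "\<bar>G' (\<eta> + b) - G' \<eta> - g' \<bullet> b - (b \<bullet> F' b) / 2\<bar> \<le> e0 * (norm b)\<^sup>2" if "norm b < r" for b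
    using r(2)[of "(0, b)", unfolded Qp] that by (simp add: \<zeta> \<Psi>_def F'_def inner_prod_def)
  have linF: "linear F" "linear F'"
  proof -
    show "linear F" unfolding F_def
      by (rule linearI; simp add: linear_add[OF B(1), symmetric] linear_cmul[OF B(1), symmetric] flip: fst_add fst_scaleR)
    show "linear F'" unfolding F'_def
      by (rule linearI; simp add: linear_add[OF B(1), symmetric] linear_cmul[OF B(1), symmetric] flip: snd_add snd_scaleR)
  qed
  have block: "a \<bullet> F a + b \<bullet> F' b \<le> \<kappa> * ((norm a)\<^sup>2 + (norm b)\<^sup>2 + (norm (a - b))\<^sup>2) + 2 * e0 * ((norm a)\<^sup>2 + (norm b)\<^sup>2)" for a b
  proof -
    \<comment> \<open>Small enough that both scaled vectors stay in the range of the expansions; the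
      factor t^2 is cancelled at the end.\<close>
    define t where "t = r / (norm a + norm b + 1)"
    have n1: "norm a + norm b + 1 > 0" by (simp add: add_nonneg_pos)
    have t: "t > 0" using r(1) n1 by (simp add: t_def)
    have "t * (norm a + norm b + 1) = r" using n1 by (simp add: t_def)
    then have "t * norm a + t * norm b + t = r" by (simp add: algebra_simps)
    moreover have "0 \<le> t * norm a" "0 \<le> t * norm b" using t by auto
    ultimately have "t * norm a < r" "t * norm b < r" using t by linarith+
    then have lt: "norm (t *\<^sub>R a) < r" "norm (t *\<^sub>R b) < r" using t by simp_all
    have "\<Psi> (\<zeta> + t *\<^sub>R (a, b)) \<le> \<Psi> \<zeta> + (Q \<zeta> + p) \<bullet> (t *\<^sub>R (a, b)) + ((t *\<^sub>R (a, b)) \<bullet> Q (t *\<^sub>R (a, b))) / 2"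
      by (rule touching_from_above[OF linQ symQ max])
    moreover have "(t *\<^sub>R (a, b)) \<bullet> Q (t *\<^sub>R (a, b)) = t\<^sup>2 * (\<kappa> * ((norm a)\<^sup>2 + (norm b)\<^sup>2 + (norm (a - b))\<^sup>2))"
      unfolding linear_cmul[OF linQ] inner_scaleR_left inner_scaleR_right Qf by (simp add: power2_eq_square)
    moreover have "\<Psi> (\<zeta> + t *\<^sub>R (a, b)) = G (\<xi> + t *\<^sub>R a) + G' (\<eta> + t *\<^sub>R b)" "\<Psi> \<zeta> = G \<xi> + G' \<eta>"
      by (simp_all add: \<zeta> \<Psi>_def)
    moreover have "(Q \<zeta> + p) \<bullet> (t *\<^sub>R (a, b)) = g \<bullet> (t *\<^sub>R a) + g' \<bullet> (t *\<^sub>R b)"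
      unfolding Qp by simp
    ultimately have up: "G (\<xi> + t *\<^sub>R a) + G' (\<eta> + t *\<^sub>R b) \<le> G \<xi> + G' \<eta> + (g \<bullet> (t *\<^sub>R a) + g' \<bullet> (t *\<^sub>R b))
      + t\<^sup>2 * (\<kappa> * ((norm a)\<^sup>2 + (norm b)\<^sup>2 + (norm (a - b))\<^sup>2)) / 2"
      by linarith
    have ta: "t *\<^sub>R a \<bullet> F (t *\<^sub>R a) = t\<^sup>2 * (a \<bullet> F a)" "t *\<^sub>R b \<bullet> F' (t *\<^sub>R b) = t\<^sup>2 * (b \<bullet> F' b)"
      using linF by (simp_all add: linear_cmul power2_eq_square)
    have nt: "(norm (t *\<^sub>R a))\<^sup>2 = t\<^sup>2 * (norm a)\<^sup>2" "(norm (t *\<^sub>R b))\<^sup>2 = t\<^sup>2 * (norm b)\<^sup>2"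
      by (simp_all add: power_mult_distrib)
    have "t\<^sup>2 * (a \<bullet> F a) / 2 + t\<^sup>2 * (b \<bullet> F' b) / 2 - e0 * (t\<^sup>2 * (norm a)\<^sup>2) - e0 * (t\<^sup>2 * (norm b)\<^sup>2)
       \<le> t\<^sup>2 * (\<kappa> * ((norm a)\<^sup>2 + (norm b)\<^sup>2 + (norm (a - b))\<^sup>2)) / 2"
      using up e1[OF lt(1)] e2[OF lt(2)] unfolding ta nt abs_le_iff by linarith
    then have "t\<^sup>2 * (a \<bullet> F a + b \<bullet> F' b) \<le> t\<^sup>2 * (\<kappa> * ((norm a)\<^sup>2 + (norm b)\<^sup>2 + (norm (a - b))\<^sup>2) + 2 * e0 * ((norm a)\<^sup>2 + (norm b)\<^sup>2))"
      by (simp add: algebra_simps)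
    then show ?thesis by (rule mult_left_le_imp_le) (use t in simp)
  qed
  \<comment> \<open>The term -\<kappa> undoes the penalty and 2 e0 turns the error e0 |h|^2 into
    part of the quadratic form. The form for Y is negated because G' is built from -v.\<close>
  have lin1: "linear (\<lambda>a. F a + (2 * e0 - \<kappa>) *\<^sub>R a)"
    using linF by (intro linear_compose_add linear_compose_scale_right linear_id[unfolded id_def])
  have lin2: "linear (\<lambda>a. - (F' a + (2 * e0 - \<kappa>) *\<^sub>R a))"
    using linF by (intro linear_compose_neg linear_compose_add linear_compose_scale_right linear_id[unfolded id_def])
  obtain X where X: "transpose X = X" "\<And>a. a \<bullet> (X *v a) = a \<bullet> (F a + (2 * e0 - \<kappa>) *\<^sub>R a)"
    by (rule symmetric_matrix_of_quadratic_form[OF lin1]) (rule that)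
  obtain Y where Y: "transpose Y = Y" "\<And>a. a \<bullet> (Y *v a) = a \<bullet> - (F' a + (2 * e0 - \<kappa>) *\<^sub>R a)"
    by (rule symmetric_matrix_of_quadratic_form[OF lin2]) (rule that)
  have Xa: "a \<bullet> (X *v a) = a \<bullet> F a + (2 * e0 - \<kappa>) * (norm a)\<^sup>2"
    and Yb: "a \<bullet> (Y *v a) = - (a \<bullet> F' a) - (2 * e0 - \<kappa>) * (norm a)\<^sup>2" for a
    unfolding X(2) Y(2) power2_norm_eq_inner by (simp_all add: inner_add_right inner_diff_right)
  show thesis
  proof (rule that[of p1 p2 x y \<xi> \<eta> X Y])
    show "norm p1 < \<delta>" "norm p2 < \<delta>"
      using p norm_fst_le[of p1 p2] norm_snd_le[of p2 p1] unfolding pp by linarith+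
    show "u x' - v y' - \<kappa> / 2 * ((norm (x' - \<xi>'))\<^sup>2 + (norm (y' - \<eta>'))\<^sup>2 + (norm (\<xi>' - \<eta>'))\<^sup>2) - p1 \<bullet> \<xi>' - p2 \<bullet> \<eta>'
      \<le> u x - v y - \<kappa> / 2 * ((norm (x - \<xi>))\<^sup>2 + (norm (y - \<eta>))\<^sup>2 + (norm (\<xi> - \<eta>))\<^sup>2) - p1 \<bullet> \<xi> - p2 \<bullet> \<eta>"
      if "x' \<in> K" "y' \<in> K" for x' y' \<xi>' \<eta>'
    proof -
      have n: "\<kappa> / 2 * ((norm (x - \<xi>))\<^sup>2 + (norm (y - \<eta>))\<^sup>2 + (norm (\<xi> - \<eta>))\<^sup>2) = \<kappa> / 2 * (norm x)\<^sup>2 - \<kappa> * (x \<bullet> \<xi>)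
        + \<kappa> / 2 * (norm y)\<^sup>2 - \<kappa> * (y \<bullet> \<eta>) + (\<kappa> * ((norm \<xi>)\<^sup>2 + (norm \<eta>)\<^sup>2 + (norm (\<xi> - \<eta>))\<^sup>2)) / 2" for x y \<xi> \<eta> :: "real^'d"
        unfolding power2_norm_eq_inner by (simp add: inner_diff_left inner_diff_right inner_commute field_simps)
      have "\<Psi> (\<xi>', \<eta>') - ((\<xi>', \<eta>') \<bullet> Q (\<xi>', \<eta>')) / 2 - (p1, p2) \<bullet> (\<xi>', \<eta>')
        \<le> \<Psi> (\<xi>, \<eta>) - ((\<xi>, \<eta>) \<bullet> Q (\<xi>, \<eta>)) / 2 - (p1, p2) \<bullet> (\<xi>, \<eta>)"
        using max[of "(\<xi>', \<eta>')"] unfolding pp \<zeta> .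
      then show ?thesis
        using G(2)[OF that(1), of \<xi>'] G'(2)[OF that(2), of \<eta>'] x(2) y(2)
        unfolding Qf n \<Psi>_def fst_conv snd_conv inner_Pair by linarith
    qed
    \<comment> \<open>Moving x and \<xi> by the same vector leaves |x - \<xi>| unchanged. This is
      how the expansion of G at \<xi> becomes a bound for u at x.\<close>
    have incr: "\<kappa> / 2 * (norm (x + a))\<^sup>2 - \<kappa> * ((x + a) \<bullet> (\<xi> + a)) = \<kappa> / 2 * (norm x)\<^sup>2 - \<kappa> * (x \<bullet> \<xi>) - \<kappa> * (\<xi> \<bullet> a) - \<kappa> / 2 * (norm a)\<^sup>2"
      for x a \<xi> :: "real^'d"
      unfolding power2_norm_eq_inner
      by (simp add: inner_add_left inner_add_right inner_commute field_simps)
    show "\<forall>\<^sub>F z in at x within K. u z \<le> u x + (\<kappa> *\<^sub>R (\<xi> - \<eta>) + p1) \<bullet> (z - x) + ((z - x) \<bullet> (X *v (z - x))) / 2"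
    proof (rule eventually_at_within_if_ball[OF r(1)])
      fix h assume h: "norm h < r" "x + h \<in> K"
      have "g \<bullet> h = \<kappa> * (\<xi> \<bullet> h) + (\<kappa> *\<^sub>R (\<xi> - \<eta>) + p1) \<bullet> h"
        unfolding g_def by (simp add: inner_add_left)
      moreover have "(2 * e0 - \<kappa>) * (norm h)\<^sup>2 = 2 * (e0 * (norm h)\<^sup>2) - 2 * (\<kappa> / 2 * (norm h)\<^sup>2)"
        by (simp add: algebra_simps)
      ultimately show "u (x + h) \<le> u x + (\<kappa> *\<^sub>R (\<xi> - \<eta>) + p1) \<bullet> (x + h - x) + ((x + h - x) \<bullet> (X *v (x + h - x))) / 2"
        using G(2)[OF h(2), of "\<xi> + h"] x(2) abs_le_D1[OF e1[OF h(1)]] incr[of x h \<xi>]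
        unfolding add_diff_cancel_left' Xa by argo
    qed
    show "\<forall>\<^sub>F z in at y within K. v z \<ge> v y + (\<kappa> *\<^sub>R (\<xi> - \<eta>) - p2) \<bullet> (z - y) + ((z - y) \<bullet> (Y *v (z - y))) / 2"
    proof (rule eventually_at_within_if_ball[OF r(1)])
      fix h assume h: "norm h < r" "y + h \<in> K"
      have "g' \<bullet> h = \<kappa> * (\<eta> \<bullet> h) - (\<kappa> *\<^sub>R (\<xi> - \<eta>) - p2) \<bullet> h"
        unfolding g'_def by (simp add: inner_add_left inner_diff_left)
      moreover have "(2 * e0 - \<kappa>) * (norm h)\<^sup>2 = 2 * (e0 * (norm h)\<^sup>2) - 2 * (\<kappa> / 2 * (norm h)\<^sup>2)"
        by (simp add: algebra_simps)
      ultimately show "v y + (\<kappa> *\<^sub>R (\<xi> - \<eta>) - p2) \<bullet> (y + h - y) + ((y + h - y) \<bullet> (Y *v (y + h - y))) / 2 \<le> v (y + h)"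
        using G'(2)[OF h(2), of "\<eta> + h"] y(2) abs_le_D1[OF e2[OF h(1)]] incr[of y h \<eta>]
        unfolding add_diff_cancel_left' Yb by argo
    qed
    show "a \<bullet> (X *v a) - b \<bullet> (Y *v b) \<le> \<kappa> * (norm (a - b))\<^sup>2 + e * ((norm a)\<^sup>2 + (norm b)\<^sup>2)" for a b
    proof -
      have "e * ((norm a)\<^sup>2 + (norm b)\<^sup>2) = 2 * e0 * ((norm a)\<^sup>2 + (norm b)\<^sup>2) + 2 * e0 * (norm a)\<^sup>2 + 2 * e0 * (norm b)\<^sup>2"
        by (simp add: e0_def algebra_simps)
      moreover have "\<kappa> * ((norm a)\<^sup>2 + (norm b)\<^sup>2 + (norm (a - b))\<^sup>2) = \<kappa> * (norm a)\<^sup>2 + \<kappa> * (norm b)\<^sup>2 + \<kappa> * (norm (a - b))\<^sup>2"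
        by (simp add: algebra_simps)
      moreover have "(2 * e0 - \<kappa>) * (norm a)\<^sup>2 = 2 * e0 * (norm a)\<^sup>2 - \<kappa> * (norm a)\<^sup>2"
        "(2 * e0 - \<kappa>) * (norm b)\<^sup>2 = 2 * e0 * (norm b)\<^sup>2 - \<kappa> * (norm b)\<^sup>2"
        by (simp_all add: algebra_simps)
      ultimately show ?thesis using block[of a b] unfolding Xa Yb by linarith
    qed
  qed (use x y X Y in auto)
qed

text \<open>The point p is a convex combination of p / \<mu> and a short vector d p. As m > 1, the
  upper bound at d p is of order d^m |p|^m, small against d times the coercive lower bound at p, and
  the difference is the gain. The constants do not depend on h or \<mu>, so they serve all x in the
  ball at once.\<close>

lemma hamiltonian_scaling_gain:
  fixes a M \<Lambda> m :: real
  assumes "0 < a" "1 \<le> M" "1 \<le> \<Lambda>" "1 < m"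
  shows "\<exists>c>0. \<exists>C. \<forall>(h :: 'a::real_normed_vector \<Rightarrow> real) \<mu> p. convex_on UNIV h \<longrightarrow>
    (\<forall>p. a * norm p powr m - M \<le> h p \<and> h p \<le> \<Lambda> * (norm p powr m + 1)) \<longrightarrow> 0 < \<mu> \<longrightarrow> \<mu> < 1 \<longrightarrow>
    h p + (1 - \<mu>) * (c * norm p powr m - C) \<le> \<mu> * h ((1 / \<mu>) *\<^sub>R p)"
proof -
  \<comment> \<open>The power makes \<Lambda> d^(m-1) \<le> a / 2, so half of the coercive term
    survives; the cap 1/2 allows the later division by 1 - d.\<close>
  define d where "d = min (1/2) ((a / (2 * \<Lambda>)) powr (1 / (m - 1)))"
  have d: "0 < d" "d \<le> 1/2" using assms by (auto simp: d_def)
  have "d powr (m - 1) \<le> ((a / (2 * \<Lambda>)) powr (1 / (m - 1))) powr (m - 1)"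
    using d assms by (intro powr_mono2) (auto simp: d_def)
  also have "\<dots> = a / (2 * \<Lambda>)" using assms by (simp add: powr_powr)
  finally have "\<Lambda> * d powr (m - 1) \<le> a / 2" using assms by (simp add: field_simps)
  then have "d * (\<Lambda> * d powr (m - 1)) \<le> d * (a / 2)" using d by (intro mult_left_mono) auto
  moreover have "d * d powr (m - 1) = d powr m" using d by (simp add: powr_diff)
  ultimately have dm: "\<Lambda> * d powr m \<le> d * a / 2" by (metis mult.left_commute times_divide_eq_right)
  show ?thesis
  proof (rule exI[of _ "d * a / 2"], intro conjI exI[of _ "2 * (M + \<Lambda>)"] allI impI)
    show "d * a / 2 > 0" using d assms by simp
    fix h :: "'a \<Rightarrow> real" and \<mu> :: real and p :: 'a
    assume conv: "convex_on UNIV h" and "\<forall>p. a * norm p powr m - M \<le> h p \<and> h p \<le> \<Lambda> * (norm p powr m + 1)"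
      and \<mu>: "0 < \<mu>" "\<mu> < 1"
    then have lo: "a * norm p powr m - M \<le> h p" and hi: "h p \<le> \<Lambda> * (norm p powr m + 1)" for p by auto
    define P where "P = norm p powr m"
    have "\<mu> * d < 1" using mult_strict_mono[of \<mu> 1 d 1] \<mu> d by simp
    then have pos: "1 - \<mu> * d > 0" by simp
    \<comment> \<open>The solution of s / \<mu> + (1 - s) d = 1, the condition for the combination
      to equal p.\<close>
    define s where "s = \<mu> * (1 - d) / (1 - \<mu> * d)"
    have s1: "1 - s = (1 - \<mu>) / (1 - \<mu> * d)" using pos by (simp add: s_def field_simps)
    have s: "0 \<le> s" "s \<le> 1" using \<mu> d pos s1 by (simp add: s_def) (metis s1 diff_ge_0_iff_ge divide_nonneg_pos less_imp_le \<mu>(2) pos)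
    have "(1 - (1 - s)) *\<^sub>R ((1 / \<mu>) *\<^sub>R p) + (1 - s) *\<^sub>R (d *\<^sub>R p) = (s / \<mu> + (1 - s) * d) *\<^sub>R p"
      by (simp add: algebra_simps)
    also have "s / \<mu> + (1 - s) * d = 1"
    proof -
      have "s / \<mu> = (1 - d) / (1 - \<mu> * d)" using \<mu> by (simp add: s_def)
      then have "s / \<mu> + (1 - s) * d = ((1 - d) + (1 - \<mu>) * d) / (1 - \<mu> * d)"
        unfolding s1 by (simp add: add_divide_distrib)
      also have "(1 - d) + (1 - \<mu>) * d = 1 - \<mu> * d" by (simp add: algebra_simps)
      finally show ?thesis using pos by simp
    qed
    finally have "h p \<le> (1 - (1 - s)) * h ((1 / \<mu>) *\<^sub>R p) + (1 - s) * h (d *\<^sub>R p)"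
      using convex_onD[OF conv, of "1 - s" "(1 / \<mu>) *\<^sub>R p" "d *\<^sub>R p"] s by simp
    then have "(1 - \<mu> * d) * h p \<le> (1 - \<mu> * d) * (s * h ((1 / \<mu>) *\<^sub>R p) + (1 - s) * h (d *\<^sub>R p))"
      using pos by (intro mult_left_mono) auto
    also have "\<dots> = ((1 - \<mu> * d) * s) * h ((1 / \<mu>) *\<^sub>R p) + ((1 - \<mu> * d) * (1 - s)) * h (d *\<^sub>R p)"
      by (simp add: algebra_simps)
    also have "(1 - \<mu> * d) * s = \<mu> * (1 - d)" using pos by (simp add: s_def)
    also have "(1 - \<mu> * d) * (1 - s) = 1 - \<mu>" using pos by (simp add: s1)
    finally have conv': "(1 - \<mu> * d) * h p \<le> \<mu> * (1 - d) * h ((1 / \<mu>) *\<^sub>R p) + (1 - \<mu>) * h (d *\<^sub>R p)" .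
    have nd: "norm (d *\<^sub>R p) powr m = d powr m * P" using d by (simp add: P_def powr_mult)
    have "h (d *\<^sub>R p) \<le> \<Lambda> * (d powr m * P + 1)" using hi[of "d *\<^sub>R p"] nd by simp
    moreover have "(\<Lambda> * d powr m) * P \<le> (d * a / 2) * P" using dm by (intro mult_right_mono) (auto simp: P_def)
    ultimately have 1: "h (d *\<^sub>R p) \<le> d * a / 2 * P + \<Lambda>" by (simp add: algebra_simps)
    have "d * (a * P - M) \<le> d * h p" using lo[of p] d by (intro mult_left_mono) (auto simp: P_def)
    moreover have "d * M \<le> 1 * M" using d assms by (intro mult_right_mono) auto
    ultimately have 2: "d * a * P - M \<le> d * h p" by (simp add: algebra_simps)
    have "(1 - \<mu>) * (d * a / 2 * P - (M + \<Lambda>)) \<le> (1 - \<mu>) * (d * h p - h (d *\<^sub>R p))"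
      using 1 2 \<mu> by (intro mult_left_mono) auto
    \<comment> \<open>The coefficient of h p is split as 1 - \<mu> d = (1 - d) + (1 - \<mu>) d; the
      second part produces the gain.\<close>
    with conv' have 3: "(1 - d) * h p + (1 - \<mu>) * (d * a / 2 * P - (M + \<Lambda>)) \<le> (1 - d) * (\<mu> * h ((1 / \<mu>) *\<^sub>R p))"
      by (simp add: algebra_simps)
    \<comment> \<open>The factor 2 in the constant makes room for pulling out 1 - d \<ge>
      1/2.\<close>
    have "(1 - d) * (d * a / 2 * P - 2 * (M + \<Lambda>)) \<le> d * a / 2 * P - (M + \<Lambda>)"
    proof -
      have expand: "(1 - d) * (X - 2 * N) \<le> X - N" if "0 \<le> d * X" "2 * (d * N) \<le> N" for X N :: real
        using that by (simp add: algebra_simps)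
      have "2 * d * (M + \<Lambda>) \<le> 1 * (M + \<Lambda>)"
        using d assms by (intro mult_right_mono) auto
      then show ?thesis using d assms by (intro expand) (auto simp: P_def)
    qed
    then have "(1 - \<mu>) * ((1 - d) * (d * a / 2 * P - 2 * (M + \<Lambda>))) \<le> (1 - \<mu>) * (d * a / 2 * P - (M + \<Lambda>))"
      using \<mu> by (intro mult_left_mono) auto
    with 3 have "(1 - d) * (h p + (1 - \<mu>) * (d * a / 2 * P - 2 * (M + \<Lambda>))) \<le> (1 - d) * (\<mu> * h ((1 / \<mu>) *\<^sub>R p))"
      by (simp add: algebra_simps)
    then show "h p + (1 - \<mu>) * (d * a / 2 * norm p powr m - 2 * (M + \<Lambda>)) \<le> \<mu> * h ((1 / \<mu>) *\<^sub>R p)"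
      unfolding P_def by (rule mult_left_le_imp_le) (use d in simp)
  qed
qed

section \<open>The comparison principle\<close>

text \<open>The base comes from norm q + norm q' + 1 with norm q' \<le> norm q + 2. Raising the
  exponent to m matches the error to the gain in |p|^m; 5 = 2 + 3 covers both s \<le> 1 and s >
  1.\<close>

lemma powr_le_5_powr:
  fixes s m :: real
  assumes "0 \<le> s" "1 < m"
  shows "(2 * s + 3) powr (m - 1) \<le> 5 powr m * (s powr m + 1)"
proof -
  have "(2 * s + 3) powr (m - 1) \<le> (2 * s + 3) powr m" using assms by (intro powr_mono) auto
  also have "\<dots> \<le> 5 powr m * (s powr m + 1)"
  proof (cases "s \<le> 1")
    case True
    have "(2 * s + 3) powr m \<le> 5 powr m" using True assms by (intro powr_mono2) auto
    also have "\<dots> \<le> 5 powr m * (s powr m + 1)" by (simp add: algebra_simps)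
    finally show ?thesis .
  next
    case False
    have "(2 * s + 3) powr m \<le> (5 * s) powr m" using False assms by (intro powr_mono2) auto
    also have "\<dots> = 5 powr m * s powr m" using assms by (simp add: powr_mult)
    also have "\<dots> \<le> 5 powr m * (s powr m + 1)" by (simp add: algebra_simps)
    finally show ?thesis .
  qed
  finally show ?thesis .
qed

text \<open>The inequality for X and Y is tested on corresponding rows of \<open>\<sigma> x\<close>
  and \<open>\<sigma> y\<close>. Summation produces Frobenius norms, to which the bound and the
  Lipschitz condition on \<sigma> apply.\<close>

lemma trace_diffusion_difference:
  fixes \<sigma> :: "real^'d \<Rightarrow> real^'d^'n"
  assumes "admissible_diffusion \<Lambda> \<sigma> A" and "0 \<le> \<kappa>" "0 \<le> e"
    and XY: "\<And>a b. a \<bullet> (X *v a) - b \<bullet> (Y *v b) \<le> \<kappa> * (norm (a - b))\<^sup>2 + e * ((norm a)\<^sup>2 + (norm b)\<^sup>2)"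
  shows "trace (A x ** X) - trace (A y ** Y) \<le> \<kappa> / 2 * \<Lambda>\<^sup>2 * (norm (x - y))\<^sup>2 + e * \<Lambda>\<^sup>2"
proof -
  have A: "A z = (1/2) *\<^sub>R (transpose (\<sigma> z) ** \<sigma> z)" and b: "norm (\<sigma> z) \<le> \<Lambda>"
    and l: "norm (\<sigma> z - \<sigma> z') \<le> \<Lambda> * norm (z - z')" for z z'
    using assms(1) unfolding admissible_diffusion_def by blast+
  have b2: "(norm (\<sigma> z))\<^sup>2 \<le> \<Lambda>\<^sup>2" for z using b by (intro power_mono) auto
  have l2: "(norm (\<sigma> x - \<sigma> y))\<^sup>2 \<le> \<Lambda>\<^sup>2 * (norm (x - y))\<^sup>2"
    using power_mono[OF l[of x y], of 2] by (simp add: power_mult_distrib)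
  have "2 * (trace (A x ** X) - trace (A y ** Y)) = (\<Sum>i\<in>UNIV. \<sigma> x $ i \<bullet> (X *v \<sigma> x $ i) - \<sigma> y $ i \<bullet> (Y *v \<sigma> y $ i))"
    unfolding A trace_diffusion by (simp add: sum_subtractf)
  also have "\<dots> \<le> (\<Sum>i\<in>UNIV. \<kappa> * (norm ((\<sigma> x - \<sigma> y) $ i))\<^sup>2 + e * ((norm (\<sigma> x $ i))\<^sup>2 + (norm (\<sigma> y $ i))\<^sup>2))"
    using XY by (intro sum_mono) simp
  also have "\<dots> = \<kappa> * (norm (\<sigma> x - \<sigma> y))\<^sup>2 + e * ((norm (\<sigma> x))\<^sup>2 + (norm (\<sigma> y))\<^sup>2)"
    by (simp add: norm_matrix_rows sum.distrib distrib_left flip: sum_distrib_left)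
  also have "\<dots> \<le> \<kappa> * (\<Lambda>\<^sup>2 * (norm (x - y))\<^sup>2) + e * (\<Lambda>\<^sup>2 + \<Lambda>\<^sup>2)"
    using assms(2,3) b2 l2 by (intro add_mono mult_left_mono) auto
  finally show ?thesis by (simp add: algebra_simps)
qed

lemma norm_triple_bound:
  fixes x y \<xi> \<eta> :: "'a::real_normed_vector"
  shows "(norm (x - y))\<^sup>2 \<le> 3 * ((norm (x - \<xi>))\<^sup>2 + (norm (y - \<eta>))\<^sup>2 + (norm (\<xi> - \<eta>))\<^sup>2)"
proof -
  let ?a = "norm (x - \<xi>)" and ?b = "norm (y - \<eta>)" and ?c = "norm (\<xi> - \<eta>)"
  have e: "x - y = (x - \<xi>) - (y - \<eta>) + (\<xi> - \<eta>)" by simp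
  have "norm (x - y) \<le> ?a + ?b + ?c"
    unfolding e
    by (rule order_trans[OF norm_triangle_ineq add_right_mono[OF norm_triangle_ineq4]])
  then have "(norm (x - y))\<^sup>2 \<le> (?a + ?b + ?c)\<^sup>2" by (intro power_mono) auto
  also have "\<dots> \<le> 3 * (?a\<^sup>2 + ?b\<^sup>2 + ?c\<^sup>2)"
    using zero_le_power2[of "?a - ?b"] zero_le_power2[of "?b - ?c"] zero_le_power2[of "?a - ?c"]
    by (simp add: power2_eq_square algebra_simps)
  finally show ?thesis .
qed

text \<open>For fixed parameters, the first estimate compares the maximum with the competitor whose
  four points are all x0. The second combines both viscosity inequalities, with P = |q|^m for the
  unbounded slope q.\<close>

lemma doubling_estimate:
  fixes \<sigma> :: "real^'d \<Rightarrow> real^'d^'n" and u v :: "real^'d \<Rightarrow> real"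
  assumes A: "admissible_diffusion \<Lambda>\<^sub>2 \<sigma> A"
    and sub: "viscosity_le A H (- \<theta>) U u" and super: "viscosity_ge A H 0 U v"
    and K: "compact K" "U \<subseteq> K" "K \<subseteq> ball 0 R" and x0: "x0 \<in> K"
    and u: "usc_on K u" and v: "usc_on K (\<lambda>x. - v x)"
    and \<mu>: "0 < \<mu>" "\<mu> < 1" and \<delta>: "0 < \<delta>" "\<delta> \<le> 1" and \<kappa>: "1 \<le> \<kappa>" and m: "1 < m" and \<Lambda>\<^sub>1: "0 \<le> \<Lambda>\<^sub>1"
    and gain: "\<And>p x. x \<in> ball 0 R \<Longrightarrow>
      H p x + (1 - \<mu>) * (c * norm p powr m - C) \<le> \<mu> * H ((1 / \<mu>) *\<^sub>R p) x"
    and Hx: "\<And>p x y. x \<in> ball 0 R \<Longrightarrow> y \<in> ball 0 R \<Longrightarrow>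
      \<bar>H p x - H p y\<bar> \<le> (\<Lambda>\<^sub>1 * norm p powr m + M) * norm (x - y)"
    and Hp: "\<And>p q x. x \<in> ball 0 R \<Longrightarrow>
      \<bar>H p x - H q x\<bar> \<le> \<Lambda>\<^sub>1 * (norm p + norm q + 1) powr (m - 1) * norm (p - q)"
  obtains x y P where "x \<in> K" "y \<in> K" "P \<ge> 0"
    "\<kappa> / 12 * (norm (x - y))\<^sup>2 \<le> (\<mu> * u x - v y) - (\<mu> * u x0 - v x0) + \<delta> * (4 * R + 2)"
    "x \<in> U \<Longrightarrow> y \<in> U \<Longrightarrow>
      (1 - \<mu>) * (c * P - C) - (\<Lambda>\<^sub>1 * P + M) * norm (x - y) - 2 * \<delta> * \<Lambda>\<^sub>1 * 5 powr m * (P + 1)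
      \<le> - \<mu> * \<theta> + \<kappa> / 2 * \<Lambda>\<^sub>2\<^sup>2 * (norm (x - y))\<^sup>2 + \<delta> * \<Lambda>\<^sub>2\<^sup>2"
proof -
  have K0: "K \<noteq> {}" and \<kappa>0: "\<kappa> > 0" and \<mu>0: "0 \<le> \<mu>" using x0 \<kappa> \<mu> by auto
  have nR: "norm z \<le> R" if "z \<in> K" for z using that K(3) by (auto simp: subset_iff less_imp_le)
  obtain p1 p2 x y \<xi> \<eta> X Y where p: "norm p1 < \<delta>" "norm p2 < \<delta>" and xy: "x \<in> K" "y \<in> K"
    and max: "\<And>x' y' \<xi>' \<eta>'. x' \<in> K \<Longrightarrow> y' \<in> K \<Longrightarrow>
      \<mu> * u x' - v y' - \<kappa> / 2 * ((norm (x' - \<xi>'))\<^sup>2 + (norm (y' - \<eta>'))\<^sup>2 + (norm (\<xi>' - \<eta>'))\<^sup>2) - p1 \<bullet> \<xi>' - p2 \<bullet> \<eta>'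
      \<le> \<mu> * u x - v y - \<kappa> / 2 * ((norm (x - \<xi>))\<^sup>2 + (norm (y - \<eta>))\<^sup>2 + (norm (\<xi> - \<eta>))\<^sup>2) - p1 \<bullet> \<xi> - p2 \<bullet> \<eta>"
    and X: "transpose X = X" and Y: "transpose Y = Y"
    and jx: "\<forall>\<^sub>F z in at x within K. \<mu> * u z \<le> \<mu> * u x + (\<kappa> *\<^sub>R (\<xi> - \<eta>) + p1) \<bullet> (z - x) + ((z - x) \<bullet> (X *v (z - x))) / 2"
    and jy: "\<forall>\<^sub>F z in at y within K. v z \<ge> v y + (\<kappa> *\<^sub>R (\<xi> - \<eta>) - p2) \<bullet> (z - y) + ((z - y) \<bullet> (Y *v (z - y))) / 2"
    and XY: "\<And>a b. a \<bullet> (X *v a) - b \<bullet> (Y *v b) \<le> \<kappa> * (norm (a - b))\<^sup>2 + \<delta> * ((norm a)\<^sup>2 + (norm b)\<^sup>2)"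
    by (rule theorem_on_sums[OF K(1) K0 usc_on_cmult[OF u \<mu>0] v \<kappa>0 \<delta>(1) \<delta>(1)]) (rule that)
  define q where "q = \<kappa> *\<^sub>R (\<xi> - \<eta>) + p1"
  define q' where "q' = \<kappa> *\<^sub>R (\<xi> - \<eta>) - p2"
  define P where "P = norm q powr m"
  let ?E = "(norm (x - \<xi>))\<^sup>2 + (norm (y - \<eta>))\<^sup>2 + (norm (\<xi> - \<eta>))\<^sup>2"
  show thesis
  proof (rule that[OF xy, of P])
    show "P \<ge> 0" by (simp add: P_def)
    \<comment> \<open>The auxiliary points range over the whole space, so the linear perturbation is
      not bounded a priori. Half of the penalty absorbs it, thanks to \<delta> \<le> 1 \<le>
      \<kappa>.\<close>
    have drift: "r \<bullet> (x0 - w) \<le> \<delta> * (2 * R + 1) + \<kappa> / 4 * (norm (z - w))\<^sup>2" if "norm r < \<delta>" "z \<in> K" for r z w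
    proof -
      have "norm (x0 - w) \<le> norm x0 + norm z + norm (z - w)"
        using norm_triangle_ineq[of "x0 - z" "z - w"] norm_triangle_ineq4[of x0 z] by simp
      also have "\<dots> \<le> 2 * R + norm (z - w)" using nR[OF x0] nR[OF that(2)] by simp
      finally have "norm (x0 - w) \<le> 2 * R + norm (z - w)" .
      moreover have "norm (z - w) \<le> 1 + (norm (z - w))\<^sup>2 / 4"
        using zero_le_power2[of "norm (z - w) - 2"] by (simp add: power2_eq_square algebra_simps)
      ultimately have n: "norm (x0 - w) \<le> (2 * R + 1) + (norm (z - w))\<^sup>2 / 4" by simp
      have "r \<bullet> (x0 - w) \<le> norm r * norm (x0 - w)" by (rule norm_cauchy_schwarz)
      also have "\<dots> \<le> \<delta> * ((2 * R + 1) + (norm (z - w))\<^sup>2 / 4)"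
        using that(1) n \<delta>(1) by (intro mult_mono) auto
      also have "\<dots> = \<delta> * (2 * R + 1) + \<delta> / 4 * (norm (z - w))\<^sup>2" by (simp add: algebra_simps)
      also have "\<delta> / 4 * (norm (z - w))\<^sup>2 \<le> \<kappa> / 4 * (norm (z - w))\<^sup>2"
        using \<delta> \<kappa> by (intro mult_right_mono) auto
      finally show ?thesis by simp
    qed
    have "p1 \<bullet> (x0 - \<xi>) \<le> \<delta> * (2 * R + 1) + \<kappa> / 4 * (norm (x - \<xi>))\<^sup>2"
      "p2 \<bullet> (x0 - \<eta>) \<le> \<delta> * (2 * R + 1) + \<kappa> / 4 * (norm (y - \<eta>))\<^sup>2"
      using drift p xy by blast+
    moreover have "\<mu> * u x0 - v x0 - p1 \<bullet> x0 - p2 \<bullet> x0 \<le> \<mu> * u x - v y - \<kappa> / 2 * ?E - p1 \<bullet> \<xi> - p2 \<bullet> \<eta>"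
      using max[OF x0 x0, of x0 x0] by simp
    ultimately have "\<kappa> / 2 * ?E \<le> \<mu> * u x - v y - (\<mu> * u x0 - v x0) + 2 * (\<delta> * (2 * R + 1))
      + \<kappa> / 4 * (norm (x - \<xi>))\<^sup>2 + \<kappa> / 4 * (norm (y - \<eta>))\<^sup>2"
      unfolding inner_diff_right by argo
    moreover have "0 \<le> \<kappa> / 4 * (norm (\<xi> - \<eta>))\<^sup>2" using \<kappa>0 by simp
    moreover have "\<kappa> / 2 * ?E = \<kappa> / 4 * ?E + \<kappa> / 4 * (norm (x - \<xi>))\<^sup>2 + \<kappa> / 4 * (norm (y - \<eta>))\<^sup>2 + \<kappa> / 4 * (norm (\<xi> - \<eta>))\<^sup>2"
      by (simp add: algebra_simps)
    moreover have "2 * (\<delta> * (2 * R + 1)) = \<delta> * (4 * R + 2)" by (simp add: algebra_simps)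
    \<comment> \<open>One quarter of \<kappa> is left after the drift; the factor 3 of
      \<open>norm_triple_bound\<close> then gives 1/12.\<close>
    moreover have "\<kappa> / 12 * (norm (x - y))\<^sup>2 \<le> \<kappa> / 12 * (3 * ?E)"
      using \<kappa>0 by (intro mult_left_mono norm_triple_bound) auto
    ultimately show "\<kappa> / 12 * (norm (x - y))\<^sup>2 \<le> (\<mu> * u x - v y) - (\<mu> * u x0 - v x0) + \<delta> * (4 * R + 2)"
      by linarith
    assume xU: "x \<in> U" and yU: "y \<in> U"
    let ?r = "norm (x - y)"
    have xR: "x \<in> ball 0 R" "y \<in> ball 0 R" using xy K(3) by auto
    have le: "at x within U \<le> at x within K" "at y within U \<le> at y within K" by (rule at_le[OF K(2)])+
    \<comment> \<open>The expansion belongs to \<mu> u, so u is tested with X / \<mu> and q / \<mu>.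
      Multiplying back by \<mu> leaves the trace unscaled and produces \<mu> H(q / \<mu>), the
      quantity with the gain.\<close>
    have "- trace (A x ** ((1 / \<mu>) *\<^sub>R X)) + H ((1 / \<mu>) *\<^sub>R q) x \<le> - \<theta>"
    proof (rule viscosity_le_quadratic[OF sub xU])
      show "transpose ((1 / \<mu>) *\<^sub>R X) = (1 / \<mu>) *\<^sub>R X"
        using X by (simp add: transpose_def vec_eq_iff)
      show "\<forall>\<^sub>F z in at x within U. u z \<le> u x + ((1 / \<mu>) *\<^sub>R q) \<bullet> (z - x) + ((z - x) \<bullet> (((1 / \<mu>) *\<^sub>R X) *v (z - x))) / 2"
        using filter_leD[OF le(1) jx]
      proof eventually_elim
        case (elim z)
        have "u x + ((1 / \<mu>) *\<^sub>R q) \<bullet> (z - x) + ((z - x) \<bullet> (((1 / \<mu>) *\<^sub>R X) *v (z - x))) / 2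
          = (1 / \<mu>) * (\<mu> * u x + q \<bullet> (z - x) + ((z - x) \<bullet> (X *v (z - x))) / 2)"
          using \<mu> by (simp add: scaleR_matrix_vector_assoc[symmetric] field_simps)
        also have "\<dots> \<ge> (1 / \<mu>) * (\<mu> * u z)" using elim \<mu> unfolding q_def by (intro mult_left_mono) auto
        finally show ?case using \<mu> by simp
      qed
    qed
    moreover have "trace (A x ** ((1 / \<mu>) *\<^sub>R X)) = (1 / \<mu>) * trace (A x ** X)"
      by (simp add: trace_def matrix_matrix_mult_def sum_distrib_left mult_ac)
    ultimately have "\<mu> * (- ((1 / \<mu>) * trace (A x ** X)) + H ((1 / \<mu>) *\<^sub>R q) x) \<le> \<mu> * (- \<theta>)"
      using \<mu> by (intro mult_left_mono) auto
    moreover have "\<mu> * (- ((1 / \<mu>) * trace (A x ** X)) + H ((1 / \<mu>) *\<^sub>R q) x) = - trace (A x ** X) + \<mu> * H ((1 / \<mu>) *\<^sub>R q) x"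
      using \<mu> by (simp add: field_simps)
    ultimately have i1: "- trace (A x ** X) + \<mu> * H ((1 / \<mu>) *\<^sub>R q) x \<le> - \<mu> * \<theta>" by simp
    have i2: "0 \<le> - trace (A y ** Y) + H q' y"
      using viscosity_ge_quadratic[OF super yU Y, of q'] filter_leD[OF le(2) jy] unfolding q'_def by blast
    have i3: "trace (A x ** X) - trace (A y ** Y) \<le> \<kappa> / 2 * \<Lambda>\<^sub>2\<^sup>2 * ?r\<^sup>2 + \<delta> * \<Lambda>\<^sub>2\<^sup>2"
      by (rule trace_diffusion_difference[OF A _ _ XY]) (use \<kappa>0 \<delta> in auto)
    have i4: "H q x + (1 - \<mu>) * (c * P - C) \<le> \<mu> * H ((1 / \<mu>) *\<^sub>R q) x"
      unfolding P_def by (rule gain[OF xR(1)])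
    have i5: "H q y - H q x \<le> (\<Lambda>\<^sub>1 * P + M) * ?r"
      using Hx[OF xR, of q] unfolding P_def by linarith
    have qq: "q - q' = p1 + p2" by (simp add: q_def q'_def)
    then have nqq: "norm (q - q') \<le> 2 * \<delta>" using norm_triangle_ineq[of p1 p2] p by simp
    have "norm q' \<le> norm q + 2" using nqq \<delta> norm_triangle_sub[of q' q] by (simp add: norm_minus_commute)
    then have "(norm q + norm q' + 1) powr (m - 1) \<le> (2 * norm q + 3) powr (m - 1)"
      using m by (intro powr_mono2) auto
    also have "\<dots> \<le> 5 powr m * (P + 1)" unfolding P_def by (rule powr_le_5_powr) (use m in auto)
    finally have "\<Lambda>\<^sub>1 * (norm q + norm q' + 1) powr (m - 1) * norm (q - q') \<le> \<Lambda>\<^sub>1 * (5 powr m * (P + 1)) * (2 * \<delta>)"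
      using nqq \<Lambda>\<^sub>1 by (intro mult_mono mult_left_mono) (auto simp: P_def)
    then have i6: "H q' y - H q y \<le> 2 * \<delta> * \<Lambda>\<^sub>1 * 5 powr m * (P + 1)"
      using Hp[OF xR(2), of q q'] by (simp add: mult_ac)
    show "(1 - \<mu>) * (c * P - C) - (\<Lambda>\<^sub>1 * P + M) * ?r - 2 * \<delta> * \<Lambda>\<^sub>1 * 5 powr m * (P + 1)
      \<le> - \<mu> * \<theta> + \<kappa> / 2 * \<Lambda>\<^sub>2\<^sup>2 * ?r\<^sup>2 + \<delta> * \<Lambda>\<^sub>2\<^sup>2"
      using i1 i2 i3 i4 i5 i6 by linarith
  qed
qed

lemma usc_on_LIMSEQ:
  assumes "usc_on S f" "x \<in> S" "X \<longlonglongrightarrow> x" "\<And>n. X n \<in> S" "f x < (a::real)"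
  shows "\<forall>\<^sub>F n in sequentially. f (X n) < a"
proof -
  have "\<forall>\<^sub>F y in at x within S. f y < a" using assms by (auto simp: usc_on_def)
  then obtain V where V: "open V" "x \<in> V" "\<And>y. y \<in> V \<Longrightarrow> y \<noteq> x \<Longrightarrow> y \<in> S \<Longrightarrow> f y < a"
    unfolding eventually_at_topological by blast
  have "\<forall>\<^sub>F n in sequentially. X n \<in> V" using topological_tendstoD[OF assms(3) V(1,2)] .
  then show ?thesis by (rule eventually_mono) (use V(3) assms(4,5) in metis)
qed

text \<open>A real b strictly between the two suprema reduces the claim to finite bounds, and
  infinite suprema or an empty F need no separate treatment.\<close>

lemma ereal_SUP_comparison:
  assumes "\<And>x (b::real). x \<in> U \<Longrightarrow> (\<And>z. z \<in> F \<Longrightarrow> f z \<le> b) \<Longrightarrow> f x \<le> b"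
  shows "(SUP x\<in>U. ereal (f x)) \<le> (SUP x\<in>F. ereal (f x))"
proof (rule ccontr)
  assume "\<not> ?thesis"
  then obtain x where x: "x \<in> U" "(SUP x\<in>F. ereal (f x)) < ereal (f x)" by (auto simp: not_le less_SUP_iff)
  obtain b where b: "(SUP x\<in>F. ereal (f x)) < ereal b" "ereal b < ereal (f x)"
    using ereal_dense2[OF x(2)] by blast
  have "f z \<le> b" if "z \<in> F" for z
  proof -
    have "ereal (f z) \<le> (SUP x\<in>F. ereal (f x))" using that by (rule SUP_upper)
    then show ?thesis using b(1) by (metis ereal_less_eq(3) le_less_trans less_imp_le)
  qed
  with assms[OF x(1)] b(2) show False by force
qed

theorem theorem2p2:
  fixes m \<Lambda>\<^sub>1 \<Lambda>\<^sub>2 \<theta> :: real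
    and \<sigma> :: "real^'d \<Rightarrow> real^'d^'n"
    and A :: "real^'d \<Rightarrow> real^'d^'d"
    and H :: "real^'d \<Rightarrow> real^'d \<Rightarrow> real"
    and U :: "(real^'d) set"
    and u v :: "real^'d \<Rightarrow> real"
  assumes "m > 1" and "\<Lambda>\<^sub>1 \<ge> 1" and "\<Lambda>\<^sub>2 \<ge> 0"
    and "admissible_diffusion \<Lambda>\<^sub>2 \<sigma> A"
    and "admissible_hamiltonian m \<Lambda>\<^sub>1 H"
    and "\<theta> > 0"
    and "open U" and "bounded U"
    and "usc_on (closure U) u"
    and "usc_on (closure U) (\<lambda>x. - v x)"
    and "viscosity_le A H (- \<theta>) U u"
    and "viscosity_ge A H 0 U v"
  shows "(SUP x\<in>U. ereal (u x - v x)) \<le> (SUP x\<in>frontier U. ereal (u x - v x))"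
proof (rule ereal_SUP_comparison, rule ccontr)
  fix x1 b assume x1: "x1 \<in> U" and b: "\<And>z. z \<in> frontier U \<Longrightarrow> u z - v z \<le> b" and "\<not> u x1 - v x1 \<le> b"
  then have gap: "b < u x1 - v x1" by simp
  define K where "K = closure U"
  have K: "compact K" "U \<subseteq> K" "K \<noteq> {}"
    using \<open>bounded U\<close> x1 closure_subset[of U] by (auto simp: K_def compact_closure)
  have u: "usc_on K u" and v: "usc_on K (\<lambda>x. - v x)" using assms by (auto simp: K_def)
  have inU: "z \<in> U" if "z \<in> K" "\<not> u z - v z \<le> b" for z
    using that b[of z] \<open>open U\<close> by (auto simp: K_def frontier_def interior_open)
  obtain R where R: "R > 0" "K \<subseteq> ball 0 R"
    using compact_imp_bounded[OF K(1)] by (metis bounded_subset_ballD)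
  obtain a M where aM: "0 < a" "1 \<le> M" and HR: "\<And>p q x y. x \<in> ball 0 R \<Longrightarrow> y \<in> ball 0 R \<Longrightarrow>
         a * norm p powr m - M \<le> H p x \<and> H p x \<le> \<Lambda>\<^sub>1 * (norm p powr m + 1) \<and>
         \<bar>H p x - H p y\<bar> \<le> (\<Lambda>\<^sub>1 * norm p powr m + M) * norm (x - y) \<and>
         \<bar>H p x - H q x\<bar> \<le> \<Lambda>\<^sub>1 * (norm p + norm q + 1) powr (m - 1) * norm (p - q)"
    using \<open>admissible_hamiltonian m \<Lambda>\<^sub>1 H\<close> R(1) unfolding admissible_hamiltonian_def by meson
  have conv: "convex_on UNIV (\<lambda>p. H p x)" for x
    using \<open>admissible_hamiltonian m \<Lambda>\<^sub>1 H\<close> unfolding admissible_hamiltonian_def by blast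
  obtain c C where c: "c > 0" and cC: "\<forall>(h :: real^'d \<Rightarrow> real) \<mu> p. convex_on UNIV h \<longrightarrow>
    (\<forall>p. a * norm p powr m - M \<le> h p \<and> h p \<le> \<Lambda>\<^sub>1 * (norm p powr m + 1)) \<longrightarrow> 0 < \<mu> \<longrightarrow> \<mu> < 1 \<longrightarrow>
    h p + (1 - \<mu>) * (c * norm p powr m - C) \<le> \<mu> * h ((1 / \<mu>) *\<^sub>R p)"
    using hamiltonian_scaling_gain[OF aM \<open>\<Lambda>\<^sub>1 \<ge> 1\<close> \<open>m > 1\<close>, where 'a="real^'d"] by blast
  obtain zv where zv: "zv \<in> K" "\<And>z. z \<in> K \<Longrightarrow> - v z \<le> - v zv"
    using usc_on_attains_sup[OF v K(1,3)] by blast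
  \<comment> \<open>Wherever u - v \<le> b, one has \<mu> u - v \<le> \<mu> b - (1 - \<mu>) v zv,
    since \<open>zv\<close> minimises v. Positivity here says that x1 beats all such points, in
    particular the frontier; at \<mu> = 1 it is the assumed gap.\<close>
  have "((\<lambda>\<mu>. \<mu> * (u x1 - b) - v x1 + (1 - \<mu>) * v zv) \<longlongrightarrow> 1 * (u x1 - b) - v x1 + (1 - 1) * v zv) (at_left 1)"
    by (intro tendsto_intros)
  from order_tendstoD(1)[OF this, of 0] gap
  have ev1: "\<forall>\<^sub>F \<mu> in at_left 1. 0 < \<mu> * (u x1 - b) - v x1 + (1 - \<mu>) * v zv" by simp
  have "((\<lambda>\<mu>. \<mu> * \<theta> - (1 - \<mu>) * C) \<longlongrightarrow> 1 * \<theta> - (1 - 1) * C) (at_left 1)"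
    by (intro tendsto_intros)
  from order_tendstoD(1)[OF this, of 0] \<open>\<theta> > 0\<close>
  have ev2: "\<forall>\<^sub>F \<mu> in at_left 1. 0 < \<mu> * \<theta> - (1 - \<mu>) * C" by simp
  have ev3: "\<forall>\<^sub>F \<mu> in at_left 1. \<mu> \<in> {0<..<1::real}" by (rule eventually_at_left_real) simp
  obtain \<mu> where \<mu>1: "0 < \<mu> * (u x1 - b) - v x1 + (1 - \<mu>) * v zv" and \<mu>2: "0 < \<mu> * \<theta> - (1 - \<mu>) * C"
    and \<mu>: "0 < \<mu>" "\<mu> < 1"
    using eventually_happens'[OF trivial_limit_at_left_real eventually_conj[OF ev1 eventually_conj[OF ev2 ev3]]] by auto
  have high: "z \<in> U" if "z \<in> K" "\<mu> * u x1 - v x1 \<le> \<mu> * u z - v z" for z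
  proof (rule inU[OF that(1)], rule notI)
    have "(1 - \<mu>) * - v z \<le> (1 - \<mu>) * - v zv" using zv(2)[OF that(1)] \<mu> by (intro mult_left_mono) auto
    moreover assume "u z - v z \<le> b"
    then have "\<mu> * (u z - v z) \<le> \<mu> * b" using \<mu> by (intro mult_left_mono) auto
    ultimately show False using \<mu>1 that(2) by (simp add: algebra_simps)
  qed
  obtain x0 where x0: "x0 \<in> K" "\<And>z. z \<in> K \<Longrightarrow> \<mu> * u z + - v z \<le> \<mu> * u x0 + - v x0"
    using usc_on_attains_sup[OF usc_on_add[OF usc_on_cmult[OF u less_imp_le[OF \<mu>(1)]] v] K(1,3)] by blast
  obtain zu where zu: "zu \<in> K" "\<And>z. z \<in> K \<Longrightarrow> u z \<le> u zu"
    using usc_on_attains_sup[OF u K(1,3)] by blast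
  define S where "S = \<mu> * u x0 - v x0"
  let ?\<kappa> = "\<lambda>n. real (Suc n)" and ?\<delta> = "\<lambda>n. inverse (real (Suc n))"
  have "\<exists>x y P. x \<in> K \<and> y \<in> K \<and> P \<ge> 0 \<and>
    ?\<kappa> n / 12 * (norm (x - y))\<^sup>2 \<le> (\<mu> * u x - v y) - S + ?\<delta> n * (4 * R + 2) \<and>
    (x \<in> U \<longrightarrow> y \<in> U \<longrightarrow>
      (1 - \<mu>) * (c * P - C) - (\<Lambda>\<^sub>1 * P + M) * norm (x - y) - 2 * ?\<delta> n * \<Lambda>\<^sub>1 * 5 powr m * (P + 1)
      \<le> - \<mu> * \<theta> + ?\<kappa> n / 2 * \<Lambda>\<^sub>2\<^sup>2 * (norm (x - y))\<^sup>2 + ?\<delta> n * \<Lambda>\<^sub>2\<^sup>2)" for n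
  proof -
    have \<delta>: "0 < ?\<delta> n" "?\<delta> n \<le> 1" and \<kappa>: "1 \<le> ?\<kappa> n" by (simp_all add: field_simps)
    have "0 \<le> \<Lambda>\<^sub>1" using \<open>\<Lambda>\<^sub>1 \<ge> 1\<close> by simp
    have gain: "H p x + (1 - \<mu>) * (c * norm p powr m - C) \<le> \<mu> * H ((1 / \<mu>) *\<^sub>R p) x"
      if "x \<in> ball 0 R" for p x
      using cC conv[of x] HR[OF that that] \<mu> by blast
    show ?thesis
      unfolding S_def
      by (rule doubling_estimate[OF \<open>admissible_diffusion \<Lambda>\<^sub>2 \<sigma> A\<close> \<open>viscosity_le A H (- \<theta>) U u\<close>
          \<open>viscosity_ge A H 0 U v\<close> K(1,2) R(2) x0(1) u v \<mu> \<delta> \<kappa> \<open>m > 1\<close> \<open>0 \<le> \<Lambda>\<^sub>1\<close> gain])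
        (use HR in \<open>blast+\<close>)
  qed
  then obtain xs ys Ps where xs: "\<And>n. xs n \<in> K" and ys: "\<And>n. ys n \<in> K" and Ps: "\<And>n. Ps n \<ge> (0::real)"
    and est1: "\<And>n. ?\<kappa> n / 12 * (norm (xs n - ys n))\<^sup>2 \<le> (\<mu> * u (xs n) - v (ys n)) - S + ?\<delta> n * (4 * R + 2)"
    and est2: "\<And>n. xs n \<in> U \<Longrightarrow> ys n \<in> U \<Longrightarrow>
      (1 - \<mu>) * (c * Ps n - C) - (\<Lambda>\<^sub>1 * Ps n + M) * norm (xs n - ys n) - 2 * ?\<delta> n * \<Lambda>\<^sub>1 * 5 powr m * (Ps n + 1)
      \<le> - \<mu> * \<theta> + ?\<kappa> n / 2 * \<Lambda>\<^sub>2\<^sup>2 * (norm (xs n - ys n))\<^sup>2 + ?\<delta> n * \<Lambda>\<^sub>2\<^sup>2"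
    by metis
  define D where "D n = norm (xs n - ys n)" for n
  define B where "B = 12 * ((\<mu> * u zu - v zv) - S + (4 * R + 2))"
  have D2: "(D n)\<^sup>2 \<le> B * ?\<delta> n" for n
  proof -
    have "\<mu> * u (xs n) \<le> \<mu> * u zu" using zu(2)[OF xs] \<mu> by (intro mult_left_mono) auto
    moreover have "- v (ys n) \<le> - v zv" by (rule zv(2)[OF ys])
    moreover have "?\<delta> n * (4 * R + 2) \<le> 1 * (4 * R + 2)"
      using R(1) by (intro mult_right_mono) (auto simp: field_simps)
    ultimately have "?\<kappa> n / 12 * (D n)\<^sup>2 \<le> B / 12"
      using est1[of n] unfolding D_def B_def by simp
    then show ?thesis by (simp add: divide_simps mult_ac)
  qed
  have "(\<lambda>n. B * ?\<delta> n) \<longlonglongrightarrow> B * 0" by (intro tendsto_intros LIMSEQ_inverse_real_of_nat)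
  then have "(\<lambda>n. B * ?\<delta> n) \<longlonglongrightarrow> 0" by simp
  then have "(\<lambda>n. (D n)\<^sup>2) \<longlonglongrightarrow> 0"
    by (rule tendsto_sandwich[OF _ _ tendsto_const, rotated -1]) (use D2 in auto)
  then have D0: "D \<longlonglongrightarrow> 0" by (simp add: power_tendsto_0_iff)
  then have xy0: "(\<lambda>n. xs n - ys n) \<longlonglongrightarrow> 0" unfolding D_def by (rule tendsto_norm_zero_cancel)
  obtain l r where l: "l \<in> K" and r: "strict_mono (r :: nat \<Rightarrow> nat)" and "(xs \<circ> r) \<longlonglongrightarrow> l"
    using K(1) xs unfolding compact_def by metis
  then have xl: "(\<lambda>n. xs (r n)) \<longlonglongrightarrow> l" by (simp add: o_def)
  have "(\<lambda>n. xs (r n) - (xs (r n) - ys (r n))) \<longlonglongrightarrow> l - 0"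
    using LIMSEQ_subseq_LIMSEQ[OF xy0 r] by (intro tendsto_diff xl) (simp add: o_def)
  then have yl: "(\<lambda>n. ys (r n)) \<longlonglongrightarrow> l" by simp
  have \<delta>0: "(\<lambda>n. ?\<delta> (r n)) \<longlonglongrightarrow> 0"
    using LIMSEQ_subseq_LIMSEQ[OF LIMSEQ_inverse_real_of_nat r] by (simp add: o_def)
  have Dr0: "(\<lambda>n. D (r n)) \<longlonglongrightarrow> 0" using LIMSEQ_subseq_LIMSEQ[OF D0 r] by (simp add: o_def)
  have "(\<lambda>n. ?\<delta> (r n) * (4 * R + 2)) \<longlonglongrightarrow> 0 * (4 * R + 2)" by (intro tendsto_intros \<delta>0)
  then have \<delta>R: "(\<lambda>n. ?\<delta> (r n) * (4 * R + 2)) \<longlonglongrightarrow> 0" by simp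
  \<comment> \<open>Semicontinuity at the common limit l improves the bound on \<kappa> |x - y|^2
    from bounded to vanishing, once l is seen to maximise \<mu> u - v.\<close>
  have squeeze: "\<forall>\<^sub>F n in sequentially. ?\<kappa> (r n) / 12 * (D (r n))\<^sup>2 < (\<mu> * u l - v l) - S + e" if "e > 0" for e
  proof -
    have "\<forall>\<^sub>F n in sequentially. \<mu> * u (xs (r n)) < \<mu> * u l + e / 3"
      by (rule usc_on_LIMSEQ[OF usc_on_cmult[OF u less_imp_le[OF \<mu>(1)]] l xl xs]) (use that in simp)
    moreover have "\<forall>\<^sub>F n in sequentially. - v (ys (r n)) < - v l + e / 3"
      by (rule usc_on_LIMSEQ[OF v l yl ys]) (use that in simp)
    moreover have "\<forall>\<^sub>F n in sequentially. ?\<delta> (r n) * (4 * R + 2) < e / 3"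
      by (rule order_tendstoD(2)[OF \<delta>R]) (use that in simp)
    ultimately show ?thesis
    proof eventually_elim
      case (elim n)
      then show ?case using est1[of "r n"] unfolding D_def by linarith
    qed
  qed
  have "S \<le> \<mu> * u l - v l"
  proof (rule field_le_epsilon)
    fix e :: real assume "e > 0"
    obtain n where "?\<kappa> (r n) / 12 * (D (r n))\<^sup>2 < (\<mu> * u l - v l) - S + e"
      using eventually_happens'[OF sequentially_bot squeeze[OF \<open>e > 0\<close>]] by blast
    moreover have "0 \<le> ?\<kappa> (r n) / 12 * (D (r n))\<^sup>2" by simp
    ultimately show "S \<le> \<mu> * u l - v l + e" by linarith
  qed
  moreover have "\<mu> * u l - v l \<le> S" using x0(2)[OF l] by (simp add: S_def)
  ultimately have lS: "\<mu> * u l - v l = S" by simp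
  have "\<mu> * u x1 - v x1 \<le> S" using x0(2)[of x1] x1 K(2) by (auto simp: S_def)
  then have lU: "l \<in> U" using high[OF l] lS by simp
  define Z where "Z n = ?\<kappa> (r n) * (D (r n))\<^sup>2" for n
  have Z0: "Z \<longlonglongrightarrow> 0"
  proof (rule tendstoI)
    fix e :: real assume "e > 0"
    then have "\<forall>\<^sub>F n in sequentially. ?\<kappa> (r n) / 12 * (D (r n))\<^sup>2 < (\<mu> * u l - v l) - S + e / 12"
      by (intro squeeze) simp
    then show "\<forall>\<^sub>F n in sequentially. dist (Z n) 0 < e"
    proof eventually_elim
      case (elim n)
      moreover have "0 \<le> Z n" by (simp add: Z_def)
      ultimately show ?case by (simp add: Z_def lS)
    qed
  qed
  \<comment> \<open>All errors without the factor \<open>Ps n\<close>. They vanish in the limit,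
    against the fixed margin \<mu> \<theta> - (1 - \<mu>) C.\<close>
  define T where "T n = M * D (r n) + 2 * ?\<delta> (r n) * \<Lambda>\<^sub>1 * 5 powr m + Z n / 2 * \<Lambda>\<^sub>2\<^sup>2 + ?\<delta> (r n) * \<Lambda>\<^sub>2\<^sup>2" for n
  have "T \<longlonglongrightarrow> M * 0 + 2 * 0 * \<Lambda>\<^sub>1 * 5 powr m + 0 / 2 * \<Lambda>\<^sub>2\<^sup>2 + 0 * \<Lambda>\<^sub>2\<^sup>2"
    unfolding T_def by (intro tendsto_intros Dr0 \<delta>0 Z0) simp
  then have evT: "\<forall>\<^sub>F n in sequentially. T n < \<mu> * \<theta> - (1 - \<mu>) * C"
    using order_tendstoD(2)[of T 0] \<mu>2 by simp
  have "(\<lambda>n. (1 - \<mu>) * c - \<Lambda>\<^sub>1 * D (r n) - 2 * ?\<delta> (r n) * \<Lambda>\<^sub>1 * 5 powr m) \<longlonglongrightarrow> (1 - \<mu>) * c - \<Lambda>\<^sub>1 * 0 - 2 * 0 * \<Lambda>\<^sub>1 * 5 powr m"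
    by (intro tendsto_intros Dr0 \<delta>0)
  from order_tendstoD(1)[OF this, of 0]
  have evc: "\<forall>\<^sub>F n in sequentially. 0 < (1 - \<mu>) * c - \<Lambda>\<^sub>1 * D (r n) - 2 * ?\<delta> (r n) * \<Lambda>\<^sub>1 * 5 powr m"
    using \<mu> c by simp
  have evx: "\<forall>\<^sub>F n in sequentially. xs (r n) \<in> U" and evy: "\<forall>\<^sub>F n in sequentially. ys (r n) \<in> U"
    using topological_tendstoD[OF xl \<open>open U\<close> lU] topological_tendstoD[OF yl \<open>open U\<close> lU] .
  obtain n where n: "T n < \<mu> * \<theta> - (1 - \<mu>) * C" "xs (r n) \<in> U" "ys (r n) \<in> U"
    "0 < (1 - \<mu>) * c - \<Lambda>\<^sub>1 * D (r n) - 2 * ?\<delta> (r n) * \<Lambda>\<^sub>1 * 5 powr m"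
    using eventually_happens'[OF sequentially_bot eventually_conj[OF evT eventually_conj[OF evx eventually_conj[OF evy evc]]]]
    by blast
  have expand: "(1 - \<mu>) * (c * P - C) - (\<Lambda>\<^sub>1 * P + M) * d - 2 * \<delta> * \<Lambda>\<^sub>1 * 5 powr m * (P + 1)
    = P * ((1 - \<mu>) * c - \<Lambda>\<^sub>1 * d - 2 * \<delta> * \<Lambda>\<^sub>1 * 5 powr m) - (1 - \<mu>) * C - (M * d + 2 * \<delta> * \<Lambda>\<^sub>1 * 5 powr m)"
    for P d \<delta> :: real
    by (simp add: algebra_simps)
  have "0 \<le> Ps (r n) * ((1 - \<mu>) * c - \<Lambda>\<^sub>1 * D (r n) - 2 * ?\<delta> (r n) * \<Lambda>\<^sub>1 * 5 powr m)"
    using Ps n(4) by (intro mult_nonneg_nonneg) auto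
  moreover have "Z n / 2 * \<Lambda>\<^sub>2\<^sup>2 = ?\<kappa> (r n) / 2 * \<Lambda>\<^sub>2\<^sup>2 * (D (r n))\<^sup>2" by (simp add: Z_def)
  ultimately show False
    using est2[OF n(2,3), folded D_def] n(1) unfolding expand T_def by linarith
qed

end
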